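(* Let the entries of the matrices $F_k,G_k,H_k,Q_k,R_k,\Pi_0$ describing the linear discrete-time stochastic system given in the context be differentiable functions of a parameter $\theta\in\mathbb R^p$. Then, in order to compute the negative log-likelihood function $L_\theta(Z_1^N)$ and its gradient with respect to $\theta$, the extended square-root covariance filter (eSRCF, described in the context) used to filter the data is to be extended as follows. Assume that $R_k>0$. Given the initial values $\Pi_0^{1/2}$, $\Pi_0^{-T/2}\bar x_0$ and $\partial_{\theta_i}\Pi_0^{1/2}$, $\partial_{\theta_i}(\Pi_0^{-T/2}\bar x_0)$, recursively update $P_k^{1/2}$, $P_k^{-T/2}\hat x_k$ and $\partial_{\theta_i}P_k^{1/2}$, $\partial_{\theta_i}(P_k^{-T/2}\hat x_k)$ by the following steps. **I.** Replace the eSRCF array equation by $$ O_k\left[\begin{array}{cc|c||cc|c} R_k^{1/2} & 0 & -R_k^{-T/2}z_k & \partial_{\theta_i}R_k^{1/2} & 0 & \partial_{\theta_i}(-R_k^{-T/2}z_k) \\ P_k^{1/2}H_k^T & P_k^{1/2}F_k^T & P_k^{-T/2}\hat x_k & \partial_{\theta_i}(P_k^{1/2}H_k^T) & \partial_{\theta_i}(P_k^{1/2}F_k^T) & \partial_{\theta_i}(P_k^{-T/2}\hat x_k) \\ 0 & Q_k^{1/2}G_k^T & 0 & 0 & \partial_{\theta_i}(Q_k^{1/2}G_k^T) & 0 \end{array}\right] =\left[\begin{array}{cc|c||cc|c} R_{e,k}^{1/2} & \bar K_{p,k}^T & -\bar e_k & X_i & Y_i & M_i \\ 0 & P_{k+1}^{1/2}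 & P_{k+1}^{-T/2}\hat x_{k+1} & N_i & V_i & W_i \\ 0 & 0 & \gamma_k & B_i & K_i & T_i \end{array}\right], $$ where $O_k$ is any orthogonal rotation that upper-triangularizes the first two (block) columns of the matrix on the left-hand side. The block rows have heights $m,n,q$ and the block columns widths $m,n,1,m,n,1$; the last three block columns on the right define $X_i,Y_i,M_i,N_i,V_i,W_i,B_i,K_i,T_i$. **II.** Having computed the elements of the right-hand side matrix, calculate for each $\theta_i$: $$ \begin{bmatrix} \partial_{\theta_i}R_{e,k}^{1/2} & \partial_{\theta_i}\bar K_{p,k}^T \\ 0 & \partial_{\theta_i}P_{k+1}^{1/2} \end{bmatrix}=\bigl[\bar L_i^T+D_i+\bar U_i\bigr]\begin{bmatrix} R_{e,k}^{1/2} & \bar K_{p,k}^T \\ 0 & P_{k+1}^{1/2} \end{bmatrix}, $$ $$ \begin{bmatrix} -\partial_{\theta_i}\bar e_k \\ \partial_{\theta_i}(P_{k+1}^{-T/2}\hat x_{k+1}) \end{bmatrix}=\bigl[\bar L_i^T-\bar L_i\bigr]\begin{bmatrix} -\bar e_k \\ P_{k+1}^{-T/2}\hat x_{k+1} \end{bmatrix}+\begin{bmatrix} R_{e,k}^{1/2} & \bar K_{p,k}^T \\ 0 & P_{k+1}^{1/2} \end{bmatrix}^{-T}\begin{bmatrix} B_i^T \\ K_i^T \end{bmatrix}\gamma_k+\begin{bmatrix} M_i \\ W_i \end{bmatrix}, $$ where $\bar L_i$, $D_i$ and $\bar U_i$ are the strictly lower triangular, diagonal and strictly upper triangular parts of the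 matrix product $$ \begin{bmatrix} X_i & Y_i \\ N_i & V_i \end{bmatrix}\begin{bmatrix} R_{e,k}^{-1/2} & -R_{e,k}^{-1/2}\bar K_{p,k}^TP_{k+1}^{-1/2} \\ 0 & P_{k+1}^{-1/2} \end{bmatrix}=\bar L_i+D_i+\bar U_i . $$ **III.** Having determined $\bar e_k$, $R_{e,k}^{1/2}$ and $\partial_{\theta_i}\bar e_k$, $\partial_{\theta_i}R_{e,k}^{1/2}$, compute the negative log-likelihood and its gradient by $$ L_\theta(Z_1^N)=\frac12\sum_{k=1}^N\Bigl\{m\ln(2\pi)+2\ln\bigl(\det R_{e,k}^{1/2}\bigr)+\bar e_k^T\bar e_k\Bigr\}, $$ $$ \partial_{\theta_i}L_\theta(Z_1^N)=\sum_{k=1}^N\Bigl\{\operatorname{tr}\bigl[R_{e,k}^{-1/2}\,\partial_{\theta_i}R_{e,k}^{1/2}\bigr]+\bar e_k^T\,\partial_{\theta_i}\bar e_k\Bigr\},\qquad i=1,\dots,p. $$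
   Context: **System.** $x_k=F_kx_{k-1}+G_kw_k$, $z_k=H_kx_k+v_k$, $k=1,\dots,N$, where $x_k\in\mathbb R^n$ is the state and $z_k\in\mathbb R^m$ the measurement. The noises $w_k\sim\mathcal N(0,Q_k)$ in $\mathbb R^q$, $v_k\sim\mathcal N(0,R_k)$ in $\mathbb R^m$ and the initial state $x_0\sim\mathcal N(\bar x_0,\Pi_0)$ are taken from mutually independent Gaussian distributions. The entries of $F_k,G_k,H_k,Q_k,R_k,\Pi_0$ are functions of an unknown parameter vector $\theta=[\theta_1,\dots,\theta_p]\in\mathbb R^p$ (the dependence is suppressed in the notation). $Z_1^N=[z_1,\dots,z_N]$ is the measurement history. **Notation.** $\partial_{\theta_i}A$ is the partial derivative of $A$ with respect to the $i$-th component of $\theta$. For a covariance matrix $A$, the Cholesky decomposition is written $A=A^{T/2}A^{1/2}$ with $A^{1/2}$ upper triangular and $A^{T/2}=(A^{1/2})^T$; $A^{-1/2}=(A^{1/2})^{-1}$, $A^{-T/2}=(A^{-1/2})^T$. For an invertible matrix $C$, $C^{-T}=(C^{-1})^T$. **Kalman filter quantities.** $\hat x_k$ is the one-step ahead predicted state estimate and $P_k$ the one-step predicted error covariance matrix defined by the discrete-time Kalman filter; $e_k=z_k-H_k\hat x_k$ are the innovations, with covariance $R_{e,k}=H_kP_kH_k^T+R_k$. Further, $\bar K_{p,k}=F_kP_kH_k^TR_{e,k}^{-1/2}$ and $\bar e_k=R_{e,k}^{-T/2}e_k$. **Negative log-likelihood.** $L_\theta(Z_1^N)=\frac12\sum_{k=1}^N\{m\ln(2\pi)+\ln(\det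 R_{e,k})+e_k^TR_{e,k}^{-1}e_k\}$. **eSRCF ("condensed form").** Assume $R_k>0$. Given $\Pi_0^{1/2}$ and $\Pi_0^{-T/2}\bar x_0$, recursively update $P_k^{1/2}$ and $P_k^{-T/2}\hat x_k$ by $$ O_k\left[\begin{array}{cc|c} R_k^{1/2} & 0 & -R_k^{-T/2}z_k\\ P_k^{1/2}H_k^T & P_k^{1/2}F_k^T & P_k^{-T/2}\hat x_k\\ 0 & Q_k^{1/2}G_k^T & 0 \end{array}\right]=\left[\begin{array}{cc|c} R_{e,k}^{1/2} & \bar K_{p,k}^T & -\bar e_k\\ 0 & P_{k+1}^{1/2} & P_{k+1}^{-T/2}\hat x_{k+1}\\ 0 & 0 & \gamma_k \end{array}\right], $$ where $O_k$ is any orthogonal rotation that upper-triangularizes the first two (block) columns of the matrix on the left-hand side; $\gamma_k\in\mathbb R^q$ is simply the resulting last block. *)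

theory Defs
  imports "HOL-Analysis.Analysis" "Jordan_Normal_Form.Gauss_Jordan_Elimination"
    "Jordan_Normal_Form.Determinant"
begin

unbundle no vec_syntax
unbundle no inner_syntax

text \<open>
  Matrices and vectors carry their dimensions \<open>n\<close>, \<open>m\<close>, \<open>q\<close> explicitly; only the
  parameter space is a type, \<open>real ^ 'p\<close>.  All names \<open>mat\<close>, \<open>vec\<close>, \<open>det\<close>, \<open>$\<close> below are
  those of the matrix library with explicit dimensions.
\<close>


section \<open>Matrix notions\<close>

definition minv :: "real mat \<Rightarrow> real mat" where
  "minv A = the (mat_inverse A)"

definition mtrace :: "real mat \<Rightarrow> real" where
  "mtrace A = (\<Sum>j<dim_row A. A $$ (j, j))"

definition pos_def :: "real mat \<Rightarrow> bool" where
  "pos_def A \<longleftrightarrow> dim_row A = dim_col A \<and> transpose_mat A = A \<and>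
     (\<forall>v \<in> carrier_vec (dim_row A). v \<noteq> 0\<^sub>v (dim_row A) \<longrightarrow> 0 < v \<bullet> (A *\<^sub>v v))"

definition orth_mat :: "real mat \<Rightarrow> bool" where
  "orth_mat A \<longleftrightarrow> dim_row A = dim_col A \<and> transpose_mat A * A = 1\<^sub>m (dim_row A)"

definition str_lower :: "real mat \<Rightarrow> real mat" where
  "str_lower A = Matrix.mat (dim_row A) (dim_col A) (\<lambda>(a, b). if b < a then A $$ (a, b) else 0)"

definition diag_part :: "real mat \<Rightarrow> real mat" where
  "diag_part A = Matrix.mat (dim_row A) (dim_col A) (\<lambda>(a, b). if a = b then A $$ (a, b) else 0)"

definition str_upper :: "real mat \<Rightarrow> real mat" where
  "str_upper A = Matrix.mat (dim_row A) (dim_col A) (\<lambda>(a, b). if a < b then A $$ (a, b) else 0)"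

definition append_cols :: "real mat \<Rightarrow> real mat \<Rightarrow> real mat" (infixr \<open>@\<^sub>c\<close> 66) where
  "A @\<^sub>c B = four_block_mat A B (0\<^sub>m 0 (dim_col A)) (0\<^sub>m 0 (dim_col B))"

definition colmat :: "real Matrix.vec \<Rightarrow> real mat" where
  "colmat v = mat_of_cols (dim_vec v) [v]"

text \<open>
  An upper triangular factor \<open>U\<close> with \<open>U\<^sup>T U = A\<close> is determined by a positive definite \<open>A\<close> only
  up to the signs of its rows.  The function \<open>\<sigma>\<close>, with values 1 and -1, records the sign
  convention for the diagonal; \<open>\<sigma> = (\<lambda>_. 1)\<close> gives the usual Cholesky factor.
  For a singular positive semidefinite \<open>A\<close> even that does not determine \<open>U\<close>, so that
  \<open>chol\<close> is only meant to be used for positive definite matrices.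
\<close>

definition chol_factor :: "(nat \<Rightarrow> real) \<Rightarrow> real mat \<Rightarrow> real mat \<Rightarrow> bool" where
  "chol_factor \<sigma> A U \<longleftrightarrow> U \<in> carrier_mat (dim_row A) (dim_row A) \<and> upper_triangular U \<and>
     (\<forall>j<dim_row A. 0 \<le> \<sigma> j * U $$ (j, j)) \<and> transpose_mat U * U = A"

definition chol :: "(nat \<Rightarrow> real) \<Rightarrow> real mat \<Rightarrow> real mat" where
  "chol \<sigma> A = (THE U. chol_factor \<sigma> A U)"


section \<open>Partial derivatives and differentiability, entry by entry\<close>

definition partial_deriv :: "'p \<Rightarrow> (real ^ 'p::finite \<Rightarrow> real) \<Rightarrow> real ^ 'p \<Rightarrow> real" where
  "partial_deriv i f \<theta> = deriv (\<lambda>t. f (\<theta> + t *\<^sub>R axis i 1)) 0"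

definition mat_pd :: "'p \<Rightarrow> (real ^ 'p::finite \<Rightarrow> real mat) \<Rightarrow> real ^ 'p \<Rightarrow> real mat" where
  "mat_pd i A \<theta> = Matrix.mat (dim_row (A \<theta>)) (dim_col (A \<theta>))
     (\<lambda>(a, b). partial_deriv i (\<lambda>\<theta>'. A \<theta>' $$ (a, b)) \<theta>)"

definition vec_pd :: "'p \<Rightarrow> (real ^ 'p::finite \<Rightarrow> real Matrix.vec) \<Rightarrow> real ^ 'p \<Rightarrow> real Matrix.vec" where
  "vec_pd i v \<theta> = Matrix.vec (dim_vec (v \<theta>)) (\<lambda>a. partial_deriv i (\<lambda>\<theta>'. v \<theta>' $ a) \<theta>)"

definition mat_diff :: "(real ^ 'p::finite \<Rightarrow> real mat) \<Rightarrow> real ^ 'p \<Rightarrow> bool" where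
  "mat_diff A \<theta> \<longleftrightarrow> (\<forall>a<dim_row (A \<theta>). \<forall>b<dim_col (A \<theta>).
     (\<lambda>\<theta>'. A \<theta>' $$ (a, b)) differentiable (at \<theta>))"

definition vec_diff :: "(real ^ 'p::finite \<Rightarrow> real Matrix.vec) \<Rightarrow> real ^ 'p \<Rightarrow> bool" where
  "vec_diff v \<theta> \<longleftrightarrow> (\<forall>a<dim_vec (v \<theta>). (\<lambda>\<theta>'. v \<theta>' $ a) differentiable (at \<theta>))"


section \<open>The parametrized system, its measurements and the Kalman filter\<close>

text \<open>
  \<open>sF\<close>, \<open>sG\<close>, \<open>sH\<close>, \<open>sQ\<close>, \<open>sR\<close> are the matrices \<open>F\<^sub>k, G\<^sub>k, H\<^sub>k, Q\<^sub>k, R\<^sub>k\<close>, \<open>sPi0\<close> and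
  \<open>sx0\<close> the covariance and mean of the initial state, and \<open>sz k\<close> the observed \<open>z\<^sub>k\<close>, which does
  not depend on the parameter.
\<close>

record 'a system =
  sF :: "nat \<Rightarrow> 'a \<Rightarrow> real mat"
  sG :: "nat \<Rightarrow> 'a \<Rightarrow> real mat"
  sH :: "nat \<Rightarrow> 'a \<Rightarrow> real mat"
  sQ :: "nat \<Rightarrow> 'a \<Rightarrow> real mat"
  sR :: "nat \<Rightarrow> 'a \<Rightarrow> real mat"
  sPi0 :: "'a \<Rightarrow> real mat"
  sx0 :: "'a \<Rightarrow> real Matrix.vec"
  sz :: "nat \<Rightarrow> real Matrix.vec"

text \<open>
  Filtering starts at \<open>k = 1\<close> with \<open>P\<^sub>1 = \<Pi>\<^sub>0\<close> and predicted state \<open>x\<^sub>0\<close>; step \<open>k\<close> uses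
  \<open>F\<^sub>k, G\<^sub>k, Q\<^sub>k\<close>.  The value at index 0 is not used.
\<close>

primrec kf_P :: "'a system \<Rightarrow> nat \<Rightarrow> 'a \<Rightarrow> real mat" where
  "kf_P S 0 \<theta> = sPi0 S \<theta>"
| "kf_P S (Suc k) \<theta> = (if k = 0 then sPi0 S \<theta> else
     let F = sF S k \<theta>; G = sG S k \<theta>; H = sH S k \<theta>; P = kf_P S k \<theta>;
         Re = H * P * transpose_mat H + sR S k \<theta>;
         Kp = F * P * transpose_mat H * minv Re
     in F * P * transpose_mat F + G * sQ S k \<theta> * transpose_mat G - Kp * Re * transpose_mat Kp)"

definition innov_cov :: "'a system \<Rightarrow> nat \<Rightarrow> 'a \<Rightarrow> real mat" where
  "innov_cov S k \<theta> = sH S k \<theta> * kf_P S k \<theta> * transpose_mat (sH S k \<theta>) + sR S k \<theta>"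

primrec kf_x :: "'a system \<Rightarrow> nat \<Rightarrow> 'a \<Rightarrow> real Matrix.vec" where
  "kf_x S 0 \<theta> = sx0 S \<theta>"
| "kf_x S (Suc k) \<theta> = (if k = 0 then sx0 S \<theta> else
     let F = sF S k \<theta>; H = sH S k \<theta>;
         Kp = F * kf_P S k \<theta> * transpose_mat H * minv (innov_cov S k \<theta>)
     in F *\<^sub>v kf_x S k \<theta> + Kp *\<^sub>v (sz S k - H *\<^sub>v kf_x S k \<theta>))"

definition innov :: "'a system \<Rightarrow> nat \<Rightarrow> 'a \<Rightarrow> real Matrix.vec" where
  "innov S k \<theta> = sz S k - sH S k \<theta> *\<^sub>v kf_x S k \<theta>"

definition neg_loglik :: "'a system \<Rightarrow> nat \<Rightarrow> nat \<Rightarrow> 'a \<Rightarrow> real" where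
  "neg_loglik S m N \<theta> = 1/2 * (\<Sum>k=1..N. real m * ln (2 * pi) + ln (Determinant.det (innov_cov S k \<theta>)) +
     innov S k \<theta> \<bullet> (minv (innov_cov S k \<theta>) *\<^sub>v innov S k \<theta>))"


section \<open>Square-root and normalized quantities\<close>

definition sqrtR :: "(nat \<Rightarrow> nat \<Rightarrow> real) \<Rightarrow> 'a system \<Rightarrow> nat \<Rightarrow> 'a \<Rightarrow> real mat" where
  "sqrtR \<sigma> S k \<theta> = chol (\<sigma> k) (sR S k \<theta>)"

definition sqrtP :: "(nat \<Rightarrow> nat \<Rightarrow> real) \<Rightarrow> 'a system \<Rightarrow> nat \<Rightarrow> 'a \<Rightarrow> real mat" where
  "sqrtP \<sigma> S k \<theta> = chol (\<sigma> k) (kf_P S k \<theta>)"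

definition sqrtRe :: "(nat \<Rightarrow> nat \<Rightarrow> real) \<Rightarrow> 'a system \<Rightarrow> nat \<Rightarrow> 'a \<Rightarrow> real mat" where
  "sqrtRe \<sigma> S k \<theta> = chol (\<sigma> k) (innov_cov S k \<theta>)"

text \<open>\<open>R\<^sub>k\<^sup>-\<^sup>T\<^sup>/\<^sup>2 z\<^sub>k\<close>, and likewise for the predicted state and the innovation:\<close>

definition meas_bar :: "(nat \<Rightarrow> nat \<Rightarrow> real) \<Rightarrow> 'a system \<Rightarrow> nat \<Rightarrow> 'a \<Rightarrow> real Matrix.vec" where
  "meas_bar \<sigma> S k \<theta> = transpose_mat (minv (sqrtR \<sigma> S k \<theta>)) *\<^sub>v sz S k"

definition state_bar :: "(nat \<Rightarrow> nat \<Rightarrow> real) \<Rightarrow> 'a system \<Rightarrow> nat \<Rightarrow> 'a \<Rightarrow> real Matrix.vec" where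
  "state_bar \<sigma> S k \<theta> = transpose_mat (minv (sqrtP \<sigma> S k \<theta>)) *\<^sub>v kf_x S k \<theta>"

definition innov_bar :: "(nat \<Rightarrow> nat \<Rightarrow> real) \<Rightarrow> 'a system \<Rightarrow> nat \<Rightarrow> 'a \<Rightarrow> real Matrix.vec" where
  "innov_bar \<sigma> S k \<theta> = transpose_mat (minv (sqrtRe \<sigma> S k \<theta>)) *\<^sub>v innov S k \<theta>"

definition gain_bar :: "(nat \<Rightarrow> nat \<Rightarrow> real) \<Rightarrow> 'a system \<Rightarrow> nat \<Rightarrow> 'a \<Rightarrow> real mat" where
  "gain_bar \<sigma> S k \<theta> =
     sF S k \<theta> * kf_P S k \<theta> * transpose_mat (sH S k \<theta>) * minv (sqrtRe \<sigma> S k \<theta>)"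

end

theory Submission
  imports Defs
begin

text \<open>
  Write the first two block columns of the pre-array as \<open>M\<close> and its third one as \<open>b\<close>, and let \<open>J\<close> and
  \<open>c\<close> be the corresponding blocks of the post-array without the last block row.  The Kalman
  recursions say exactly that \<open>J\<^sup>T J = M\<^sup>T M\<close> and \<open>J\<^sup>T c = M\<^sup>T b\<close> for all parameters.  An orthogonal
  \<open>Ok\<close> preserves such products, so that the triangular \<open>J\<close> is a Cholesky factor of \<open>M\<^sup>T M\<close>, unique for
  given signs of its diagonal.  Differentiating \<open>J\<^sup>T J = M\<^sup>T M\<close> and multiplying with \<open>J\<^sup>-\<^sup>T\<close> and \<open>J\<^sup>-\<^sup>1\<close>
  shows that \<open>(\<partial>J) J\<^sup>-\<^sup>1\<close>, which is upper triangular, has the same symmetric part as the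
  known matrix \<open>L + D + U\<close>, hence equals \<open>L\<^sup>T + D + U\<close>; the derivative of \<open>c\<close> follows from the second
  identity.  Cholesky factors are differentiable because their rows are given recursively by
  explicit formulas.
\<close>

section \<open>Inverses and triangular matrices\<close>

text \<open>The \<open>q\<close> bottom rows explain the shape of the update formulas. Rotating
  \<open>M\<close> annihilates these rows at the given parameter, but the same rows of the rotated
  derivative of \<open>M\<close>, the blocks \<open>B\<close> and \<open>K\<close>, need not vanish.
  In the product with the rotated \<open>M\<close> they meet zeros, so that the derivative of
  \<open>J\<close> involves only \<open>X\<close>, \<open>Y\<close>, \<open>L\<close>,
  \<open>V\<close>; in the product with the rotated \<open>b\<close> they meet \<gamma>, which
  produces the summand with \<open>minv J\<close>, \<open>B\<close>, \<open>K\<close> and \<gamma>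
  in the derivative of \<open>c\<close>. The block \<open>T\<close> meets zeros only and leaves no
  trace.

  Signs are the other obstacle. Triangularity and the Gram matrix fix the rows of \<open>J\<close>
  only up to sign, so a rotation may produce negative diagonal entries. The functions \<sigma>
  select one branch of each square root, the same for all parameters; on that branch the factor is a
  function that can be differentiated.

  Existence of the derivatives is itself part of the claim: the covariances and estimates are
  differentiable by induction along the filter recursion, and the roots inherit this.\<close>

lemma index_mult_mat_sum:
  assumes "A \<in> carrier_mat r n" "B \<in> carrier_mat n c" "i < r" "j < c"
  shows "(A * B) $$ (i, j) = (\<Sum>k<n. A $$ (i, k) * B $$ (k, j))"
  using assms by (auto simp: scalar_prod_def lessThan_atLeast0 intro!: sum.cong)

lemma minv:
  assumes A: "A \<in> carrier_mat n n" and "Determinant.det A \<noteq> 0"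
  shows minv_carrier: "minv A \<in> carrier_mat n n"
    and mult_minv: "A * minv A = 1\<^sub>m n"
    and minv_mult: "minv A * A = 1\<^sub>m n"
proof -
  have "mat_inverse A \<noteq> None"
    using mat_inverse(1)[OF A, of "()"] det_non_zero_imp_unit[OF assms, of "()"] by blast
  then obtain B where "mat_inverse A = Some B" by blast
  with mat_inverse(2)[OF A this] 
  show "minv A \<in> carrier_mat n n" "A * minv A = 1\<^sub>m n" "minv A * A = 1\<^sub>m n"
    by (auto simp: minv_def)
qed

lemma det_nonzero_of_inverse:
  fixes A :: "real mat"
  assumes "A \<in> carrier_mat n n" "B \<in> carrier_mat n n" "A * B = 1\<^sub>m n"
  shows "Determinant.det A \<noteq> 0"
  using det_mult[OF assms(1,2)] assms(3) by auto

lemma mult_left_cancel_inv: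
  fixes A :: "real mat"
  assumes "A \<in> carrier_mat n n" "B \<in> carrier_mat n n" "B * A = 1\<^sub>m n"
    "C \<in> carrier_mat n c" "D \<in> carrier_mat n c" "A * C = A * D"
  shows "C = D"
proof -
  have "C = B * A * C" using assms by simp
  also have "\<dots> = B * (A * D)" using assms(1,2,4,6) by (simp add: assoc_mult_mat[of B n n A n C c])
  also have "\<dots> = D" using assms by (simp add: assoc_mult_mat[of B n n A n D c, symmetric])
  finally show ?thesis .
qed

lemma minv_eqI:
  assumes A: "A \<in> carrier_mat n n" and B: "B \<in> carrier_mat n n" and AB: "A * B = 1\<^sub>m n"
  shows "minv A = B"
proof -
  have d: "Determinant.det A \<noteq> 0" using det_nonzero_of_inverse[OF assms] .
  show ?thesis
    using mult_left_cancel_inv[OF A minv_carrier[OF A d] minv_mult[OF A d] minv_carrier[OF A d] B]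
      mult_minv[OF A d] AB by simp
qed

text \<open>Cramer's rule. It exhibits the entries of the inverse as quotients of determinants, from
  which their differentiability is read off later.\<close>

lemma minv_eq_adj_mat:
  assumes A: "A \<in> carrier_mat n n" and d: "Determinant.det A \<noteq> 0"
  shows "minv A = (1 / Determinant.det A) \<cdot>\<^sub>m adj_mat A"
proof (rule minv_eqI[OF A])
  show "(1 / Determinant.det A) \<cdot>\<^sub>m adj_mat A \<in> carrier_mat n n" using adj_mat(1)[OF A] by simp
  show "A * ((1 / Determinant.det A) \<cdot>\<^sub>m adj_mat A) = 1\<^sub>m n"
    using adj_mat(1,2)[OF A] A d by (subst mult_smult_distrib[OF A]) auto
qed

lemma det_upper_triangular_prod:
  fixes U :: "real mat"
  assumes "U \<in> carrier_mat n n" "upper_triangular U"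
  shows "Determinant.det U = (\<Prod>j<n. U $$ (j, j))"
  using det_upper_triangular[OF assms(2,1)] assms(1)
  by (simp add: prod_list_diag_prod lessThan_atLeast0)

lemma upper_triangular_entry:
  assumes "U \<in> carrier_mat n c" "upper_triangular U" "j < i" "i < n"
  shows "U $$ (i, j) = 0"
  using assms by auto

lemma upper_triangular_mult:
  fixes A B :: "real mat"
  assumes "A \<in> carrier_mat n n" "B \<in> carrier_mat n n" "upper_triangular A" "upper_triangular B"
  shows "upper_triangular (A * B)"
proof (rule upper_triangularI)
  fix i j assume ji: "j < i" "i < dim_row (A * B)"
  have "A $$ (i, k) * B $$ (k, j) = 0" if "k < n" for k
    using upper_triangular_entry[OF assms(1,3), of k i] upper_triangular_entry[OF assms(2,4), of j k]
      assms(1) ji that by (cases "k < i") auto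
  then show "(A * B) $$ (i, j) = 0"
    using ji assms(1,2) by (subst index_mult_mat_sum[of _ n n _ n]) (auto intro!: sum.neutral)
qed

text \<open>In the sum over the middle index, k < j kills the first factor and k > j the second.
  This reduces the trace in the gradient formula to diagonal entries.\<close>

lemma diag_mult_upper_triangular:
  fixes A B :: "real mat"
  assumes "A \<in> carrier_mat n n" "B \<in> carrier_mat n n" "upper_triangular A" "upper_triangular B"
    "j < n"
  shows "(A * B) $$ (j, j) = A $$ (j, j) * B $$ (j, j)"
proof -
  have "(A * B) $$ (j, j) = (\<Sum>k<n. A $$ (j, k) * B $$ (k, j))"
    using assms by (intro index_mult_mat_sum) auto
  also have "\<dots> = (\<Sum>k\<in>{j}. A $$ (j, k) * B $$ (k, j))"
  proof (rule sum.mono_neutral_right)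
    show "\<forall>k\<in>{..<n} - {j}. A $$ (j, k) * B $$ (k, j) = 0"
    proof
      fix k assume "k \<in> {..<n} - {j}"
      then have "k < j \<or> j < k" "k < n" by auto
      then show "A $$ (j, k) * B $$ (k, j) = 0"
        using upper_triangular_entry[OF assms(1,3), of k j] upper_triangular_entry[OF assms(2,4), of j k]
          assms(5) by auto
    qed
  qed (use assms in auto)
  finally show ?thesis by simp
qed

text \<open>Back substitution, from the last row upwards, hence the induction on n - i. At position
  (i, j) with j < i the product \<open>U * minv U\<close> is 0; its terms with k < i vanish because
  \<open>U\<close> is triangular, those with k > i by induction, and the remaining term has the
  nonzero pivot \<open>U $$ (i, i)\<close> as a factor.\<close>

lemma upper_triangular_minv:
  assumes U: "U \<in> carrier_mat n n" and ut: "upper_triangular U" and d: "Determinant.det U \<noteq> 0"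
  shows "upper_triangular (minv U)"
proof (rule upper_triangularI)
  note V = minv_carrier[OF U d]
  have nz: "U $$ (i, i) \<noteq> 0" if "i < n" for i
    using d that by (auto simp: det_upper_triangular_prod[OF U ut])
  fix i j assume "j < i" "i < dim_row (minv U)"
  then have "i < n" "j < i" using V by auto
  then show "minv U $$ (i, j) = 0"
  proof (induction "n - i" arbitrary: i rule: less_induct)
    case less
    have "0 = (U * minv U) $$ (i, j)" using less.prems by (simp add: mult_minv[OF U d])
    also have "\<dots> = (\<Sum>k<n. U $$ (i, k) * minv U $$ (k, j))"
      using less.prems by (intro index_mult_mat_sum[OF U V]) auto
    also have "\<dots> = (\<Sum>k\<in>{i}. U $$ (i, k) * minv U $$ (k, j))"
    proof (rule sum.mono_neutral_right)
      show "\<forall>k\<in>{..<n} - {i}. U $$ (i, k) * minv U $$ (k, j) = 0"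
      proof
        fix k assume k: "k \<in> {..<n} - {i}"
        show "U $$ (i, k) * minv U $$ (k, j) = 0"
        proof (cases "k < i")
          case True
          then show ?thesis using upper_triangular_entry[OF U ut True] less.prems by simp
        next
          case False
          then have "minv U $$ (k, j) = 0" using k less.prems by (intro less.hyps) auto
          then show ?thesis by simp
        qed
      qed
    qed (use less.prems in auto)
    finally show ?case using nz less.prems by simp
  qed
qed

lemma diag_minv_upper_triangular:
  assumes U: "U \<in> carrier_mat n n" and ut: "upper_triangular U" and d: "Determinant.det U \<noteq> 0"
    and j: "j < n"
  shows "minv U $$ (j, j) = 1 / U $$ (j, j)"
proof -
  have "U $$ (j, j) * minv U $$ (j, j) = 1"
    using diag_mult_upper_triangular[OF U minv_carrier[OF U d] ut upper_triangular_minv[OF U ut d] j] j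
    by (simp add: mult_minv[OF U d])
  then show ?thesis by (metis mult_eq_0_iff nonzero_eq_divide_eq mult.commute zero_neq_one)
qed

lemma transpose_minv_mult:
  assumes U: "U \<in> carrier_mat n n" and d: "Determinant.det U \<noteq> 0"
  shows "transpose_mat U * transpose_mat (minv U) = 1\<^sub>m n"
    and "transpose_mat (minv U) * transpose_mat U = 1\<^sub>m n"
  using transpose_mult[OF minv_carrier[OF U d] U, symmetric] transpose_mult[OF U minv_carrier[OF U d], symmetric]
  by (auto simp: minv_mult[OF U d] mult_minv[OF U d])

text \<open>Splits the inverse of a covariance into its root factors. The quadratic form of the
  likelihood and the passage from the Kalman gain to the normalized gain both rest on it.\<close>

lemma minv_gram:
  assumes U: "U \<in> carrier_mat n n" and d: "Determinant.det U \<noteq> 0"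
  shows "minv (transpose_mat U * U) = minv U * transpose_mat (minv U)"
proof (rule minv_eqI)
  let ?V = "minv U"
  note V = minv_carrier[OF U d]
  have "U\<^sup>T * U * (?V * ?V\<^sup>T) = U\<^sup>T * (U * (?V * ?V\<^sup>T))"
    using U V by (intro assoc_mult_mat[of _ n n _ n _ n]) auto
  also have "U * (?V * ?V\<^sup>T) = (U * ?V) * ?V\<^sup>T"
    using U V by (intro assoc_mult_mat[of _ n n _ n _ n, symmetric]) auto
  finally show "U\<^sup>T * U * (?V * ?V\<^sup>T) = 1\<^sub>m n"
    using V by (simp add: mult_minv[OF U d] transpose_minv_mult[OF U d])
qed (use U minv_carrier[OF U d] in auto)

text \<open>With \<open>U\<close> a root of P_k this turns inner products of the blocks P_k^{1/2}
  H_k^T and P_k^{1/2} F_k^T into expressions in P_k itself.\<close>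

lemma gram_of_products:
  fixes U A B :: "real mat"
  assumes "U \<in> carrier_mat s n" "A \<in> carrier_mat n a" "B \<in> carrier_mat n b"
  shows "transpose_mat (U * A) * (U * B) = transpose_mat A * (transpose_mat U * U) * B"
proof -
  have "(U * A)\<^sup>T * (U * B) = A\<^sup>T * U\<^sup>T * (U * B)" using assms by (simp add: transpose_mult[of U s n A a])
  also have "\<dots> = A\<^sup>T * U\<^sup>T * U * B"
    using assms by (intro assoc_mult_mat[of _ a s _ n _ b, symmetric]) auto
  also have "A\<^sup>T * U\<^sup>T * U = A\<^sup>T * (U\<^sup>T * U)" using assms by (intro assoc_mult_mat[of _ a n _ s _ n]) auto
  finally show ?thesis .
qed

section \<open>The Cholesky factor\<close>

lemma pos_defD:
  assumes "pos_def A" "A \<in> carrier_mat n n" "v \<in> carrier_vec n"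
  shows "v \<noteq> 0\<^sub>v n \<Longrightarrow> 0 < v \<bullet> (A *\<^sub>v v)" and "0 \<le> v \<bullet> (A *\<^sub>v v)"
proof -
  show *: "0 < v \<bullet> (A *\<^sub>v v)" if "v \<noteq> 0\<^sub>v n"
    using assms that by (auto simp: pos_def_def)
  show "0 \<le> v \<bullet> (A *\<^sub>v v)"
    using * assms(2,3) by (cases "v = 0\<^sub>v n") auto
qed

lemma det_pos_def_nonzero:
  assumes "pos_def A" "A \<in> carrier_mat n n"
  shows "Determinant.det A \<noteq> 0"
proof
  assume "Determinant.det A = 0"
  then obtain v where v: "v \<in> carrier_vec n" "v \<noteq> 0\<^sub>v n" "A *\<^sub>v v = 0\<^sub>v n"
    using det_0_iff_vec_prod_zero[OF assms(2)] by auto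
  then show False using pos_defD(1)[OF assms v(1,2)] by simp
qed

lemma chol_factorD:
  assumes "chol_factor \<sigma> A U" "A \<in> carrier_mat n n"
  shows "U \<in> carrier_mat n n" "upper_triangular U" "\<And>j. j < n \<Longrightarrow> 0 \<le> \<sigma> j * U $$ (j, j)"
    "transpose_mat U * U = A"
  using assms by (auto simp: chol_factor_def)

lemma chol_factor_det_nonzero:
  assumes "chol_factor \<sigma> A U" "A \<in> carrier_mat n n" "pos_def A"
  shows "Determinant.det U \<noteq> 0"
proof
  note U = chol_factorD[OF assms(1,2)]
  assume "Determinant.det U = 0"
  then have "Determinant.det A = 0"
    using det_mult[of "U\<^sup>T" n U] U(1) by (simp add: U(4))
  then show False using det_pos_def_nonzero assms by blast
qed

lemma chol_factor_diag_nonzero: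
  assumes "chol_factor \<sigma> A U" "A \<in> carrier_mat n n" "pos_def A" "j < n"
  shows "U $$ (j, j) \<noteq> 0"
  using chol_factor_det_nonzero[OF assms(1-3)] det_upper_triangular_prod[of U n]
    chol_factorD(1,2)[OF assms(1,2)] assms(4) by auto

text \<open>The Cholesky recursion: position (i, j) of U^T U, where the sum stops at k = i because
  column i of \<open>U\<close> vanishes below the diagonal. Uniqueness and differentiability of the
  factor both follow from it row by row.\<close>

lemma chol_factor_entry:
  assumes "chol_factor \<sigma> A U" "A \<in> carrier_mat n n" "i \<le> j" "j < n"
  shows "U $$ (i, i) * U $$ (i, j) = A $$ (i, j) - (\<Sum>k<i. U $$ (k, i) * U $$ (k, j))"
proof -
  note U = chol_factorD[OF assms(1,2)]
  have "A $$ (i, j) = (\<Sum>k<n. U\<^sup>T $$ (i, k) * U $$ (k, j))"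
    unfolding U(4)[symmetric] using U assms by (intro index_mult_mat_sum) auto
  also have "\<dots> = (\<Sum>k<n. U $$ (k, i) * U $$ (k, j))"
    using U assms by (intro sum.cong) auto
  also have "\<dots> = (\<Sum>k<Suc i. U $$ (k, i) * U $$ (k, j))"
    using upper_triangular_entry[OF U(1,2), of i] assms(3,4) by (intro sum.mono_neutral_right) auto
  finally show ?thesis by simp
qed

text \<open>The recursion gives only the square of the pivot; this is the one place where \<sigma>
  decides between the two roots.\<close>

lemma chol_factor_diag:
  assumes "chol_factor \<sigma> A U" "A \<in> carrier_mat n n" "i < n" "\<sigma> i \<in> {1, -1}"
  shows "U $$ (i, i) = \<sigma> i * sqrt (A $$ (i, i) - (\<Sum>k<i. U $$ (k, i) * U $$ (k, i)))"
proof -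
  have "sqrt (A $$ (i, i) - (\<Sum>k<i. U $$ (k, i) * U $$ (k, i))) = \<bar>U $$ (i, i)\<bar>"
    using chol_factor_entry[OF assms(1,2) order_refl assms(3)] by (metis real_sqrt_abs2)
  moreover have "0 \<le> \<sigma> i * U $$ (i, i)" using chol_factorD(3)[OF assms(1-3)] .
  ultimately show ?thesis using assms(4) by (auto simp: abs_if)
qed

text \<open>Induction over the rows: the sums in the recursion involve earlier rows only, the sign
  convention determines the pivot, and positive definiteness makes the pivot nonzero, so that it can
  be cancelled from the rest of the row.\<close>

lemma chol_factor_unique:
  assumes U: "chol_factor \<sigma> A U" and V: "chol_factor \<sigma> A V"
    and A: "A \<in> carrier_mat n n" "pos_def A" and \<sigma>: "\<And>j. \<sigma> j \<in> {1, -1}"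
  shows "U = V"
proof -
  note UD = chol_factorD[OF U A(1)] and VD = chol_factorD[OF V A(1)]
  have eq: "U $$ (i, j) = V $$ (i, j)" if "i < n" "j < n" for i j
    using that
  proof (induction i arbitrary: j rule: less_induct)
    case (less i)
    have S: "(\<Sum>k<i. U $$ (k, i) * U $$ (k, j)) = (\<Sum>k<i. V $$ (k, i) * V $$ (k, j))" if "j < n" for j
      using less that by (intro sum.cong) auto
    have d: "U $$ (i, i) = V $$ (i, i)"
      using chol_factor_diag[OF U A(1) less.prems(1) \<sigma>] chol_factor_diag[OF V A(1) less.prems(1) \<sigma>]
        S[OF less.prems(1)] by simp
    show ?case
    proof (cases "i \<le> j")
      case True
      have "U $$ (i, i) * U $$ (i, j) = V $$ (i, i) * V $$ (i, j)"
        using chol_factor_entry[OF U A(1) True less.prems(2)] S[OF less.prems(2)]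
          chol_factor_entry[OF V A(1) True less.prems(2)] by simp
      then show ?thesis using d chol_factor_diag_nonzero[OF V A less.prems(1)] by simp
    next
      case False
      then show ?thesis
        using upper_triangular_entry[OF UD(1,2)] upper_triangular_entry[OF VD(1,2)] less.prems by simp
    qed
  qed
  show ?thesis using eq UD(1) VD(1) by (intro eq_matI) auto
qed

text \<open>Induction by bordering. Write \<open>A\<close> with leading block \<open>A1\<close>,
  last column (b, d), and seek the factor with leading block \<open>U1\<close>, last column (u, s).
  This requires U1^T u = b and s^2 = d - u \<bullet> u, so everything hinges on the Schur complement
  d - u \<bullet> u being positive.\<close>

lemma chol_factor_exists:
  assumes "A \<in> carrier_mat n n" "pos_def A" "\<And>j. \<sigma> j \<in> {1, -1}"
  shows "\<exists>U. chol_factor \<sigma> A U"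
  using assms(1,2)
proof (induction n arbitrary: A)
  case 0
  then have "chol_factor \<sigma> A A" by (auto simp: chol_factor_def)
  then show ?case by blast
next
  case (Suc n)
  define A1 where "A1 = Matrix.mat n n (\<lambda>(i, j). A $$ (i, j))"
  define b where "b = Matrix.vec n (\<lambda>i. A $$ (i, n))"
  define d where "d = A $$ (n, n)"
  have sym: "A $$ (i, j) = A $$ (j, i)" if "i < Suc n" "j < Suc n" for i j
    using Suc.prems that unfolding pos_def_def by (metis carrier_matD index_transpose_mat(1))
  have A1: "A1 \<in> carrier_mat n n" and b: "b \<in> carrier_vec n" by (auto simp: A1_def b_def)
  \<comment> \<open>The quadratic form of \<open>A\<close> on a bordered vector. It is used twice:
    with s = 0 to see that \<open>A1\<close> is positive definite, and with s = -1 for the Schur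
    complement.\<close>
  have quad: "(v @\<^sub>v vCons s vNil) \<bullet> (A *\<^sub>v (v @\<^sub>v vCons s vNil))
      = v \<bullet> (A1 *\<^sub>v v) + 2 * s * (b \<bullet> v) + s * s * d" if v: "v \<in> carrier_vec n" for v s
  proof -
    have vs: "dim_vec v = n" using v by simp
    have row: "(A *\<^sub>v (v @\<^sub>v vCons s vNil)) $ i = (\<Sum>j<n. A $$ (i, j) * v $ j) + A $$ (i, n) * s"
      if "i < Suc n" for i
      using that Suc.prems vs
      by (auto simp: scalar_prod_def lessThan_atLeast0[symmetric] intro!: sum.cong)
    have "(v @\<^sub>v vCons s vNil) \<bullet> (A *\<^sub>v (v @\<^sub>v vCons s vNil))
       = (\<Sum>i<Suc n. (v @\<^sub>v vCons s vNil) $ i * (A *\<^sub>v (v @\<^sub>v vCons s vNil)) $ i)"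
      unfolding scalar_prod_def using Suc.prems(1) by (simp add: lessThan_atLeast0)
    also have "\<dots> = (\<Sum>i<n. v $ i * ((\<Sum>j<n. A $$ (i, j) * v $ j) + A $$ (i, n) * s))
        + s * ((\<Sum>j<n. A $$ (n, j) * v $ j) + A $$ (n, n) * s)"
      using vs by (simp add: row)
    also have "(\<Sum>j<n. A $$ (n, j) * v $ j) = b \<bullet> v"
      using vs sym by (auto simp: scalar_prod_def b_def lessThan_atLeast0 intro!: sum.cong)
    also have "(\<Sum>i<n. v $ i * ((\<Sum>j<n. A $$ (i, j) * v $ j) + A $$ (i, n) * s))
       = v \<bullet> (A1 *\<^sub>v v) + s * (b \<bullet> v)"
      using vs by (simp add: scalar_prod_def A1_def b_def lessThan_atLeast0 algebra_simps
         sum.distrib sum_distrib_left)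
    finally show ?thesis by (simp add: d_def algebra_simps)
  qed
  have "pos_def A1"
    unfolding pos_def_def
  proof (intro conjI ballI impI)
    show "transpose_mat A1 = A1" using sym by (intro eq_matI) (auto simp: A1_def)
    fix v :: "real Matrix.vec" assume v: "v \<in> carrier_vec (dim_row A1)" "v \<noteq> 0\<^sub>v (dim_row A1)"
    have vn: "v \<in> carrier_vec n" using v A1 by auto
    obtain i where i: "i < n" "v $ i \<noteq> 0" using v A1 by (metis carrier_matD(1) carrier_vecD eq_vecI index_zero_vec)
    have "(v @\<^sub>v vCons 0 vNil) $ i \<noteq> 0" using i vn by simp
    then have "v @\<^sub>v vCons 0 vNil \<noteq> 0\<^sub>v (Suc n)" using i by auto
    moreover have "v @\<^sub>v vCons 0 vNil \<in> carrier_vec (Suc n)"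
      using append_carrier_vec[OF vn, of "vCons 0 vNil" 1] by simp
    ultimately show "0 < v \<bullet> (A1 *\<^sub>v v)"
      using pos_defD(1)[OF Suc.prems(2,1), of "v @\<^sub>v vCons 0 vNil"] quad[OF vn, of 0] by simp
  qed (simp add: A1_def)
  then obtain U1 where U1: "chol_factor \<sigma> A1 U1" using Suc.IH A1 by blast
  note U1D = chol_factorD[OF U1 A1] and d1 = chol_factor_det_nonzero[OF U1 A1 \<open>pos_def A1\<close>]
  note V = minv_carrier[OF U1D(1) d1]
  \<comment> \<open>\<open>u\<close> is the forced last column of the factor; \<open>w\<close>
    solves A1 w = b and serves only as a test vector.\<close>
  define u where "u = transpose_mat (minv U1) *\<^sub>v b"
  define w where "w = minv U1 *\<^sub>v u"
  have u: "u \<in> carrier_vec n" and w: "w \<in> carrier_vec n" using V b by (auto simp: u_def w_def)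
  have U1u: "transpose_mat U1 *\<^sub>v u = b"
    unfolding u_def using U1D(1) V b transpose_minv_mult(1)[OF U1D(1) d1]
    by (subst assoc_mult_mat_vec[symmetric, of _ n n _ n]) auto
  have U1w: "U1 *\<^sub>v w = u"
    unfolding w_def using U1D(1) V u mult_minv[OF U1D(1) d1]
    by (subst assoc_mult_mat_vec[symmetric, of _ n n _ n]) auto
  have A1w: "A1 *\<^sub>v w = b"
    unfolding U1D(4)[symmetric] using U1D(1) w U1w U1u
    by (subst assoc_mult_mat_vec[of _ n n _ n]) auto
  have bw: "b \<bullet> w = u \<bullet> u"
  proof -
    have "b \<bullet> w = w \<bullet> (U1\<^sup>T *\<^sub>v u)" unfolding U1u using b w by (rule comm_scalar_prod)
    also have "\<dots> = (U1 *\<^sub>v w) \<bullet> u"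
      using transpose_vec_mult_scalar[of "U1" n n w u] U1D(1) u w
      by (metis comm_scalar_prod mult_mat_vec_carrier transpose_carrier_mat)
    finally show ?thesis by (simp add: U1w)
  qed
  \<comment> \<open>At (w, -1) the quadratic form equals w \<bullet> b - 2 (b \<bullet> w) + d = d -
    b \<bullet> w, which is the Schur complement.\<close>
  have pos: "0 < d - u \<bullet> u"
  proof -
    let ?x = "w @\<^sub>v vCons (-1) vNil"
    have "?x \<in> carrier_vec (Suc n)" using append_carrier_vec[OF w, of "vCons (-1) vNil" 1] by simp
    moreover have "?x $ n \<noteq> 0" using w by simp
    then have "?x \<noteq> 0\<^sub>v (Suc n)" by (metis index_zero_vec(1) lessI)
    ultimately have "0 < ?x \<bullet> (A *\<^sub>v ?x)" using pos_defD(1)[OF Suc.prems(2,1)] by blast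
    also have "?x \<bullet> (A *\<^sub>v ?x) = d - u \<bullet> u"
      using quad[OF w, of "-1"] A1w bw comm_scalar_prod[OF w b] by simp
    finally show ?thesis .
  qed
  define s where "s = \<sigma> n * sqrt (d - u \<bullet> u)"
  have s2: "s * s = d - u \<bullet> u" using pos assms(3)[of n] by (auto simp: s_def)
  define U where "U = Matrix.mat (Suc n) (Suc n) (\<lambda>(i, j). if j < n then (if i < n then U1 $$ (i, j) else 0)
     else if i < n then u $ i else s)"
  have U: "U \<in> carrier_mat (Suc n) (Suc n)" by (simp add: U_def)
  have gram1: "(\<Sum>k<n. U1 $$ (k, i) * U1 $$ (k, j)) = A $$ (i, j)" if "i < n" "j < n" for i j
    using arg_cong[OF U1D(4), of "\<lambda>M. M $$ (i, j)"] U1D(1) that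
      index_mult_mat_sum[of "U1\<^sup>T" n n U1 n i j] by (simp add: A1_def)
  have gram2: "(\<Sum>k<n. U1 $$ (k, i) * u $ k) = A $$ (i, n)" if "i < n" for i
    using arg_cong[OF U1u, of "\<lambda>v. v $ i"] U1D(1) that u
    by (simp add: b_def scalar_prod_def lessThan_atLeast0)
  have gram3: "(\<Sum>k<n. u $ k * u $ k) = u \<bullet> u"
    using u by (simp add: scalar_prod_def lessThan_atLeast0)
  have "transpose_mat U * U = A"
  proof (rule eq_matI)
    fix i j assume "i < dim_row A" "j < dim_col A"
    then have ij: "i < Suc n" "j < Suc n" using Suc.prems by auto
    have "(transpose_mat U * U) $$ (i, j) = (\<Sum>k<Suc n. transpose_mat U $$ (i, k) * U $$ (k, j))"
      using U ij by (intro index_mult_mat_sum) auto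
    also have "\<dots> = (\<Sum>k<n. U $$ (k, i) * U $$ (k, j)) + U $$ (n, i) * U $$ (n, j)"
      using U ij by simp
    also have "\<dots> = A $$ (i, j)"
    proof (cases "i < n"; cases "j < n")
      assume *: "\<not> i < n" "j < n"
      then have "i = n" using ij by simp
      then show ?thesis using * gram2[of j] sym[of j n] by (simp add: U_def mult.commute)
    next
      assume "\<not> i < n" "\<not> j < n"
      then have "i = n" "j = n" using ij by simp_all
      then show ?thesis using gram3 s2 by (simp add: U_def d_def)
    next
      assume *: "i < n" "\<not> j < n"
      then have "j = n" using ij by simp
      then show ?thesis using * gram2[of i] by (simp add: U_def)
    qed (use gram1 in \<open>simp_all add: U_def\<close>)
    finally show "(transpose_mat U * U) $$ (i, j) = A $$ (i, j)" .
  qed (use Suc.prems U in auto)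
  moreover have "upper_triangular U"
    using upper_triangular_entry[OF U1D(1,2)] by (intro upper_triangularI) (auto simp: U_def)
  moreover have "0 \<le> \<sigma> j * U $$ (j, j)" if "j < Suc n" for j
  proof (cases "j < n")
    case False
    then have "j = n" using that by simp
    then show ?thesis using assms(3)[of n] pos by (auto simp: U_def s_def)
  qed (use U1D(3) in \<open>simp add: U_def\<close>)
  ultimately have "chol_factor \<sigma> A U" using U Suc.prems by (auto simp: chol_factor_def)
  then show ?case by blast
qed

lemma chol_factor_chol:
  assumes "A \<in> carrier_mat n n" "pos_def A" "\<And>j. \<sigma> j \<in> {1, -1}"
  shows "chol_factor \<sigma> A (chol \<sigma> A)"
proof -
  obtain U where U: "chol_factor \<sigma> A U" using chol_factor_exists[of A n \<sigma>] assms by blast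
  show ?thesis
    unfolding chol_def
  proof (rule theI[of "chol_factor \<sigma> A", OF U])
    show "V = U" if "chol_factor \<sigma> A V" for V
      by (rule chol_factor_unique[OF that U assms])
  qed
qed

text \<open>On \<open>v\<close> the form is that of \<open>P\<close> at H^T v plus that of
  \<open>R\<close> at \<open>v\<close>. The first is only nonnegative, since H^T v may vanish;
  strict positivity comes from \<open>R\<close>. Applied to the innovation covariance.\<close>

lemma pos_def_congruence_plus:
  assumes P: "P \<in> carrier_mat n n" "pos_def P" and R: "R \<in> carrier_mat m m" "pos_def R"
    and H: "H \<in> carrier_mat m n"
  shows "pos_def (H * P * transpose_mat H + R)"
  unfolding pos_def_def
proof (intro conjI ballI impI)
  have t: "transpose_mat P = P" "transpose_mat R = R" using P R by (auto simp: pos_def_def)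
  show "transpose_mat (H * P * transpose_mat H + R) = H * P * transpose_mat H + R"
    using P(1) R(1) H transpose_mult[of "H * P" m n "H\<^sup>T" m] transpose_mult[of H m n P n]
    by (subst transpose_add[of _ m m]) (auto simp: t)
  fix v :: "real Matrix.vec" assume v: "v \<in> carrier_vec (dim_row (H * P * transpose_mat H + R))"
    "v \<noteq> 0\<^sub>v (dim_row (H * P * transpose_mat H + R))"
  then have vm: "v \<in> carrier_vec m" "v \<noteq> 0\<^sub>v m" using R by auto
  let ?y = "transpose_mat H *\<^sub>v v"
  have y: "?y \<in> carrier_vec n" using H vm by auto
  have "(H * P * transpose_mat H + R) *\<^sub>v v = (H * P * transpose_mat H) *\<^sub>v v + R *\<^sub>v v"
    using P R H vm by (intro add_mult_distrib_mat_vec[of _ m m]) auto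
  also have "(H * P * transpose_mat H) *\<^sub>v v = H *\<^sub>v (P *\<^sub>v ?y)"
    using P R H vm y by (simp add: assoc_mult_mat_vec[of _ m n _ m] assoc_mult_mat_vec[of _ m n _ n])
  finally have "v \<bullet> ((H * P * transpose_mat H + R) *\<^sub>v v) = v \<bullet> (H *\<^sub>v (P *\<^sub>v ?y)) + v \<bullet> (R *\<^sub>v v)"
    using P R H vm y by (simp add: scalar_prod_add_distrib[of _ m])
  also have "v \<bullet> (H *\<^sub>v (P *\<^sub>v ?y)) = ?y \<bullet> (P *\<^sub>v ?y)"
    using transpose_vec_mult_scalar[OF H, of "P *\<^sub>v ?y" v] P vm y by simp
  finally show "0 < v \<bullet> ((H * P * transpose_mat H + R) *\<^sub>v v)"
    using pos_defD(2)[OF P(2,1) y] pos_defD(1)[OF R(2,1) vm] by simp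
qed (use R in auto)

section \<open>Block matrices\<close>

lemma dim_append_cols [simp]:
  "dim_row (A @\<^sub>c B) = dim_row A" "dim_col (A @\<^sub>c B) = dim_col A + dim_col B"
  by (simp_all add: append_cols_def)

lemma dim_append_rows [simp]:
  "dim_row (A @\<^sub>r B) = dim_row A + dim_row B" "dim_col (A @\<^sub>r B) = dim_col A"
  by (simp_all add: append_rows_def)

lemma append_cols_carrier:
  "A \<in> carrier_mat r c1 \<Longrightarrow> B \<in> carrier_mat r c2 \<Longrightarrow> A @\<^sub>c B \<in> carrier_mat r (c1 + c2)"
  by (intro carrier_matI) auto

lemma index_append_cols:
  "i < dim_row A \<Longrightarrow> j < dim_col A + dim_col B \<Longrightarrow>
    (A @\<^sub>c B) $$ (i, j) = (if j < dim_col A then A $$ (i, j) else B $$ (i, j - dim_col A))"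
  by (simp add: append_cols_def)

lemma index_append_rows:
  "i < dim_row A + dim_row B \<Longrightarrow> j < dim_col A \<Longrightarrow>
    (A @\<^sub>r B) $$ (i, j) = (if i < dim_row A then A $$ (i, j) else B $$ (i - dim_row A, j))"
  by (simp add: append_rows_def)

lemma append_cols_inject:
  assumes "A \<in> carrier_mat r c1" "A' \<in> carrier_mat r c1" "B \<in> carrier_mat r c2" "B' \<in> carrier_mat r c2"
    and eq: "A @\<^sub>c B = A' @\<^sub>c B'"
  shows "A = A'" "B = B'"
proof -
  show "A = A'"
  proof (rule eq_matI)
    fix i j assume "i < dim_row A'" "j < dim_col A'"
    then show "A $$ (i, j) = A' $$ (i, j)"
      using assms(1-4) arg_cong[OF eq, of "\<lambda>M. M $$ (i, j)"] by (auto simp: index_append_cols)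
  qed (use assms in auto)
  show "B = B'"
  proof (rule eq_matI)
    fix i j assume "i < dim_row B'" "j < dim_col B'"
    then show "B $$ (i, j) = B' $$ (i, j)"
      using assms(1-4) arg_cong[OF eq, of "\<lambda>M. M $$ (i, c1 + j)"] by (auto simp: index_append_cols)
  qed (use assms in auto)
qed

lemma append_rows_append_cols:
  assumes "A \<in> carrier_mat r1 c1" "B \<in> carrier_mat r1 c2" "C \<in> carrier_mat r2 c1" "D \<in> carrier_mat r2 c2"
  shows "(A @\<^sub>c B) @\<^sub>r (C @\<^sub>c D) = (A @\<^sub>r C) @\<^sub>c (B @\<^sub>r D)"
  using assms by (intro eq_matI) (auto simp: index_append_cols index_append_rows)

lemma append_rows_append_cols3:
  assumes "A \<in> carrier_mat r1 c1" "A' \<in> carrier_mat r1 c2" "B \<in> carrier_mat r2 c1" "B' \<in> carrier_mat r2 c2"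
    "C \<in> carrier_mat r3 c1" "C' \<in> carrier_mat r3 c2"
  shows "(A @\<^sub>c A') @\<^sub>r (B @\<^sub>c B') @\<^sub>r (C @\<^sub>c C') = (A @\<^sub>r B @\<^sub>r C) @\<^sub>c (A' @\<^sub>r B' @\<^sub>r C')"
  using append_rows_append_cols[OF assms(3-6)]
    append_rows_append_cols[OF assms(1,2) carrier_append_rows[OF assms(3,5)] carrier_append_rows[OF assms(4,6)]]
  by simp

lemma mult_append_cols:
  fixes A B C :: "real mat"
  assumes "A \<in> carrier_mat r n" "B \<in> carrier_mat n c1" "C \<in> carrier_mat n c2"
  shows "A * (B @\<^sub>c C) = (A * B) @\<^sub>c (A * C)"
proof (rule eq_matI)
  fix i j assume "i < dim_row ((A * B) @\<^sub>c (A * C))" "j < dim_col ((A * B) @\<^sub>c (A * C))"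
  then have ij: "i < r" "j < c1 + c2" using assms by auto
  have "(A * (B @\<^sub>c C)) $$ (i, j) = (\<Sum>k<n. A $$ (i, k) * (B @\<^sub>c C) $$ (k, j))"
    by (rule index_mult_mat_sum[OF assms(1) append_cols_carrier[OF assms(2,3)] ij])
  also have "\<dots> = ((A * B) @\<^sub>c (A * C)) $$ (i, j)"
    using assms ij by (auto simp: index_append_cols index_mult_mat_sum[OF assms(1,2)]
        index_mult_mat_sum[OF assms(1,3)] simp del: index_mult_mat(1))
  finally show "(A * (B @\<^sub>c C)) $$ (i, j) = ((A * B) @\<^sub>c (A * C)) $$ (i, j)" .
qed (use assms in auto)

lemma sum_lessThan_add_split:
  fixes f :: "nat \<Rightarrow> real"
  shows "(\<Sum>k<a + b. f k) = (\<Sum>k<a. f k) + (\<Sum>k<b. f (a + k))"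
  by (induction b) (auto simp: algebra_simps)

lemma transpose_append_rows_mult:
  fixes A B C D :: "real mat"
  assumes A: "A \<in> carrier_mat r1 c" and B: "B \<in> carrier_mat r2 c"
    and C: "C \<in> carrier_mat r1 d" and D: "D \<in> carrier_mat r2 d"
  shows "transpose_mat (A @\<^sub>r B) * (C @\<^sub>r D) = transpose_mat A * C + transpose_mat B * D"
proof (rule eq_matI)
  fix i j assume "i < dim_row (A\<^sup>T * C + B\<^sup>T * D)" "j < dim_col (A\<^sup>T * C + B\<^sup>T * D)"
  then have ij: "i < c" "j < d" using assms by auto
  have "((A @\<^sub>r B)\<^sup>T * (C @\<^sub>r D)) $$ (i, j) = (\<Sum>k<r1 + r2. (A @\<^sub>r B)\<^sup>T $$ (i, k) * (C @\<^sub>r D) $$ (k, j))"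
    by (rule index_mult_mat_sum) (use assms ij in auto)
  also have "\<dots> = (\<Sum>k<r1. A\<^sup>T $$ (i, k) * C $$ (k, j)) + (\<Sum>k<r2. B\<^sup>T $$ (i, k) * D $$ (k, j))"
    unfolding sum_lessThan_add_split using assms ij by (auto simp: index_append_rows)
  also have "\<dots> = (A\<^sup>T * C) $$ (i, j) + (B\<^sup>T * D) $$ (i, j)"
    using assms ij by (simp add: index_mult_mat_sum[of _ c r1 C d] index_mult_mat_sum[of _ c r2 D d]
        del: index_mult_mat(1))
  finally show "((A @\<^sub>r B)\<^sup>T * (C @\<^sub>r D)) $$ (i, j) = (A\<^sup>T * C + B\<^sup>T * D) $$ (i, j)"
    using assms ij by simp
qed (use assms in auto)

lemma four_block_mat_append:
  assumes "A \<in> carrier_mat r1 c1" "B \<in> carrier_mat r1 c2" "C \<in> carrier_mat r2 c1" "D \<in> carrier_mat r2 c2"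
  shows "four_block_mat A B C D = (A @\<^sub>c B) @\<^sub>r (C @\<^sub>c D)"
  using assms by (intro eq_matI) (auto simp: index_append_cols index_append_rows)

lemma mult_append_rows:
  fixes A B C :: "real mat"
  assumes "A \<in> carrier_mat r1 n" "B \<in> carrier_mat r2 n" "C \<in> carrier_mat n c"
  shows "(A @\<^sub>r B) * C = A * C @\<^sub>r B * C"
proof (rule eq_matI)
  fix i j assume "i < dim_row (A * C @\<^sub>r B * C)" "j < dim_col (A * C @\<^sub>r B * C)"
  then have ij: "i < r1 + r2" "j < c" using assms by auto
  have "((A @\<^sub>r B) * C) $$ (i, j) = (\<Sum>k<n. (A @\<^sub>r B) $$ (i, k) * C $$ (k, j))"
    by (rule index_mult_mat_sum[OF carrier_append_rows[OF assms(1,2)] assms(3) ij])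
  also have "\<dots> = (A * C @\<^sub>r B * C) $$ (i, j)"
    using assms ij by (auto simp: index_append_rows index_mult_mat_sum[OF assms(1,3)]
        index_mult_mat_sum[OF assms(2,3)] simp del: index_mult_mat(1))
  finally show "((A @\<^sub>r B) * C) $$ (i, j) = (A * C @\<^sub>r B * C) $$ (i, j)" .
qed (use assms in auto)

lemma transpose_append_cols:
  assumes "A \<in> carrier_mat r c1" "B \<in> carrier_mat r c2"
  shows "transpose_mat (A @\<^sub>c B) = transpose_mat A @\<^sub>r transpose_mat B"
  using assms by (intro eq_matI) (auto simp: index_append_cols index_append_rows)

lemma transpose_append_cols_mult:
  fixes A B C :: "real mat"
  assumes "A \<in> carrier_mat r c1" "B \<in> carrier_mat r c2" "C \<in> carrier_mat r c3"
  shows "transpose_mat (A @\<^sub>c B) * C = transpose_mat A * C @\<^sub>r transpose_mat B * C"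
  using assms by (simp add: transpose_append_cols[of A r c1 B c2] mult_append_rows[of _ c1 r _ c2])

text \<open>Allows a Gram identity for matrices glued from two block columns to be checked on three
  blocks, the fourth being a transpose.\<close>

lemma gram_append_cols:
  fixes A B :: "real mat"
  assumes A: "A \<in> carrier_mat r c1" and B: "B \<in> carrier_mat r c2"
  shows "transpose_mat (A @\<^sub>c B) * (A @\<^sub>c B) = four_block_mat (transpose_mat A * A) (transpose_mat A * B)
    (transpose_mat (transpose_mat A * B)) (transpose_mat B * B)"
proof -
  have t: "(A\<^sup>T * B)\<^sup>T = B\<^sup>T * A" using A B by (simp add: transpose_mult[of "A\<^sup>T" c1 r B c2])
  have "(A @\<^sub>c B)\<^sup>T * (A @\<^sub>c B) = (A\<^sup>T * A @\<^sub>c A\<^sup>T * B) @\<^sub>r (B\<^sup>T * A @\<^sub>c B\<^sup>T * B)"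
    unfolding transpose_append_cols_mult[OF A B append_cols_carrier[OF A B]]
    using A B by (simp add: mult_append_cols[of _ _ r _ c1 _ c2])
  then show ?thesis
    unfolding t using A B by (subst four_block_mat_append[of _ c1 c1 _ c2 _ c2]) auto
qed

lemma transpose_append_rows3_mult:
  fixes A B C A' B' C' :: "real mat"
  assumes "A \<in> carrier_mat r1 c" "B \<in> carrier_mat r2 c" "C \<in> carrier_mat r3 c"
    "A' \<in> carrier_mat r1 d" "B' \<in> carrier_mat r2 d" "C' \<in> carrier_mat r3 d"
  shows "transpose_mat (A @\<^sub>r B @\<^sub>r C) * (A' @\<^sub>r B' @\<^sub>r C')
    = transpose_mat A * A' + (transpose_mat B * B' + transpose_mat C * C')"
  using transpose_append_rows_mult[OF assms(1) carrier_append_rows[OF assms(2,3)] assms(4) carrier_append_rows[OF assms(5,6)]]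
    transpose_append_rows_mult[OF assms(2,3,5,6)] by simp

section \<open>Regrouping and splitting arrays with three block rows\<close>

lemma append_rows_assoc:
  assumes "A \<in> carrier_mat r1 c" "B \<in> carrier_mat r2 c" "C \<in> carrier_mat r3 c"
  shows "A @\<^sub>r B @\<^sub>r C = (A @\<^sub>r B) @\<^sub>r C"
  using assms by (intro eq_matI) (auto simp: index_append_rows)

lemma append_cols_stack3:
  assumes "A \<in> carrier_mat r1 c1" "B \<in> carrier_mat r1 c2" "C \<in> carrier_mat r2 c1" "D \<in> carrier_mat r2 c2"
    "F \<in> carrier_mat r3 c1" "G \<in> carrier_mat r3 c2"
  shows "(A @\<^sub>r C @\<^sub>r F) @\<^sub>c (B @\<^sub>r D @\<^sub>r G) = four_block_mat A B C D @\<^sub>r (F @\<^sub>c G)"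
  unfolding append_rows_append_cols3[OF assms, symmetric] four_block_mat_append[OF assms(1-4)]
  using append_cols_carrier[OF assms(1,2)] append_cols_carrier[OF assms(3,4)] append_cols_carrier[OF assms(5,6)]
  by (rule append_rows_assoc)

text \<open>The array equation is laid out by rows, whereas left multiplication acts on each block
  column separately. This peels off the leftmost block column and leaves an equation of the same
  form for the rest.\<close>

lemma array_split:
  fixes Ok :: "real mat"
  assumes Ok: "Ok \<in> carrier_mat (h1 + (h2 + h3)) (h1 + (h2 + h3))"
    and l: "a \<in> carrier_mat h1 w" "b \<in> carrier_mat h2 w" "c \<in> carrier_mat h3 w"
      "a' \<in> carrier_mat h1 w" "b' \<in> carrier_mat h2 w" "c' \<in> carrier_mat h3 w"
    and r: "ra \<in> carrier_mat h1 v" "rb \<in> carrier_mat h2 v" "rc \<in> carrier_mat h3 v"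
      "ra' \<in> carrier_mat h1 v" "rb' \<in> carrier_mat h2 v" "rc' \<in> carrier_mat h3 v"
    and eq: "Ok * ((a @\<^sub>c ra) @\<^sub>r (b @\<^sub>c rb) @\<^sub>r (c @\<^sub>c rc)) = (a' @\<^sub>c ra') @\<^sub>r (b' @\<^sub>c rb') @\<^sub>r (c' @\<^sub>c rc')"
  shows "Ok * (a @\<^sub>r b @\<^sub>r c) = a' @\<^sub>r b' @\<^sub>r c'" and "Ok * (ra @\<^sub>r rb @\<^sub>r rc) = ra' @\<^sub>r rb' @\<^sub>r rc'"
proof -
  let ?s = "h1 + (h2 + h3)"
  have 1: "a @\<^sub>r b @\<^sub>r c \<in> carrier_mat ?s w" "ra @\<^sub>r rb @\<^sub>r rc \<in> carrier_mat ?s v"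
      "a' @\<^sub>r b' @\<^sub>r c' \<in> carrier_mat ?s w" "ra' @\<^sub>r rb' @\<^sub>r rc' \<in> carrier_mat ?s v"
    by (rule carrier_append_rows l r)+
  have "Ok * (a @\<^sub>r b @\<^sub>r c) @\<^sub>c Ok * (ra @\<^sub>r rb @\<^sub>r rc) = (a' @\<^sub>r b' @\<^sub>r c') @\<^sub>c (ra' @\<^sub>r rb' @\<^sub>r rc')"
    using eq unfolding append_rows_append_cols3[OF l(1) r(1) l(2) r(2) l(3) r(3)]
      append_rows_append_cols3[OF l(4) r(4) l(5) r(5) l(6) r(6)] mult_append_cols[OF Ok 1(1,2)] .
  note inj = append_cols_inject[OF mult_carrier_mat[OF Ok 1(1)] 1(3) mult_carrier_mat[OF Ok 1(2)] 1(4) this]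
  show "Ok * (a @\<^sub>r b @\<^sub>r c) = a' @\<^sub>r b' @\<^sub>r c'" "Ok * (ra @\<^sub>r rb @\<^sub>r rc) = ra' @\<^sub>r rb' @\<^sub>r rc'"
    by (rule inj)+
qed

lemma array_split6:
  fixes Ok :: "real mat"
  assumes Ok: "Ok \<in> carrier_mat (h1 + (h2 + h3)) (h1 + (h2 + h3))"
    and a: "a1 \<in> carrier_mat h1 w1" "a2 \<in> carrier_mat h1 w2" "a3 \<in> carrier_mat h1 w3"
      "a4 \<in> carrier_mat h1 w4" "a5 \<in> carrier_mat h1 w5" "a6 \<in> carrier_mat h1 w6"
    and b: "b1 \<in> carrier_mat h2 w1" "b2 \<in> carrier_mat h2 w2" "b3 \<in> carrier_mat h2 w3"
      "b4 \<in> carrier_mat h2 w4" "b5 \<in> carrier_mat h2 w5" "b6 \<in> carrier_mat h2 w6"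
    and c: "c1 \<in> carrier_mat h3 w1" "c2 \<in> carrier_mat h3 w2" "c3 \<in> carrier_mat h3 w3"
      "c4 \<in> carrier_mat h3 w4" "c5 \<in> carrier_mat h3 w5" "c6 \<in> carrier_mat h3 w6"
    and a': "a1' \<in> carrier_mat h1 w1" "a2' \<in> carrier_mat h1 w2" "a3' \<in> carrier_mat h1 w3"
      "a4' \<in> carrier_mat h1 w4" "a5' \<in> carrier_mat h1 w5" "a6' \<in> carrier_mat h1 w6"
    and b': "b1' \<in> carrier_mat h2 w1" "b2' \<in> carrier_mat h2 w2" "b3' \<in> carrier_mat h2 w3"
      "b4' \<in> carrier_mat h2 w4" "b5' \<in> carrier_mat h2 w5" "b6' \<in> carrier_mat h2 w6"
    and c': "c1' \<in> carrier_mat h3 w1" "c2' \<in> carrier_mat h3 w2" "c3' \<in> carrier_mat h3 w3"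
      "c4' \<in> carrier_mat h3 w4" "c5' \<in> carrier_mat h3 w5" "c6' \<in> carrier_mat h3 w6"
    and eq: "Ok * ((a1 @\<^sub>c a2 @\<^sub>c a3 @\<^sub>c a4 @\<^sub>c a5 @\<^sub>c a6) @\<^sub>r (b1 @\<^sub>c b2 @\<^sub>c b3 @\<^sub>c b4 @\<^sub>c b5 @\<^sub>c b6) @\<^sub>r
        (c1 @\<^sub>c c2 @\<^sub>c c3 @\<^sub>c c4 @\<^sub>c c5 @\<^sub>c c6))
      = (a1' @\<^sub>c a2' @\<^sub>c a3' @\<^sub>c a4' @\<^sub>c a5' @\<^sub>c a6') @\<^sub>r (b1' @\<^sub>c b2' @\<^sub>c b3' @\<^sub>c b4' @\<^sub>c b5' @\<^sub>c b6') @\<^sub>r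
        (c1' @\<^sub>c c2' @\<^sub>c c3' @\<^sub>c c4' @\<^sub>c c5' @\<^sub>c c6')"
  shows "Ok * (a1 @\<^sub>r b1 @\<^sub>r c1) = a1' @\<^sub>r b1' @\<^sub>r c1'" "Ok * (a2 @\<^sub>r b2 @\<^sub>r c2) = a2' @\<^sub>r b2' @\<^sub>r c2'"
    "Ok * (a3 @\<^sub>r b3 @\<^sub>r c3) = a3' @\<^sub>r b3' @\<^sub>r c3'" "Ok * (a4 @\<^sub>r b4 @\<^sub>r c4) = a4' @\<^sub>r b4' @\<^sub>r c4'"
    "Ok * (a5 @\<^sub>r b5 @\<^sub>r c5) = a5' @\<^sub>r b5' @\<^sub>r c5'" "Ok * (a6 @\<^sub>r b6 @\<^sub>r c6) = a6' @\<^sub>r b6' @\<^sub>r c6'"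
proof -
  note ac = append_cols_carrier
  note t2 = ac[OF a(5,6)] ac[OF b(5,6)] ac[OF c(5,6)] ac[OF a'(5,6)] ac[OF b'(5,6)] ac[OF c'(5,6)]
  note t3 = ac[OF a(4) t2(1)] ac[OF b(4) t2(2)] ac[OF c(4) t2(3)] ac[OF a'(4) t2(4)] ac[OF b'(4) t2(5)] ac[OF c'(4) t2(6)]
  note t4 = ac[OF a(3) t3(1)] ac[OF b(3) t3(2)] ac[OF c(3) t3(3)] ac[OF a'(3) t3(4)] ac[OF b'(3) t3(5)] ac[OF c'(3) t3(6)]
  note t5 = ac[OF a(2) t4(1)] ac[OF b(2) t4(2)] ac[OF c(2) t4(3)] ac[OF a'(2) t4(4)] ac[OF b'(2) t4(5)] ac[OF c'(2) t4(6)]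
  note s1 = array_split[OF Ok a(1) b(1) c(1) a'(1) b'(1) c'(1) t5 eq]
  note s2 = array_split[OF Ok a(2) b(2) c(2) a'(2) b'(2) c'(2) t4 s1(2)]
  note s3 = array_split[OF Ok a(3) b(3) c(3) a'(3) b'(3) c'(3) t3 s2(2)]
  note s4 = array_split[OF Ok a(4) b(4) c(4) a'(4) b'(4) c'(4) t2 s3(2)]
  note s5 = array_split[OF Ok a(5) b(5) c(5) a'(5) b'(5) c'(5) a(6) b(6) c(6) a'(6) b'(6) c'(6) s4(2)]
  show "Ok * (a1 @\<^sub>r b1 @\<^sub>r c1) = a1' @\<^sub>r b1' @\<^sub>r c1'" "Ok * (a2 @\<^sub>r b2 @\<^sub>r c2) = a2' @\<^sub>r b2' @\<^sub>r c2'"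
    "Ok * (a3 @\<^sub>r b3 @\<^sub>r c3) = a3' @\<^sub>r b3' @\<^sub>r c3'" "Ok * (a4 @\<^sub>r b4 @\<^sub>r c4) = a4' @\<^sub>r b4' @\<^sub>r c4'"
    "Ok * (a5 @\<^sub>r b5 @\<^sub>r c5) = a5' @\<^sub>r b5' @\<^sub>r c5'" "Ok * (a6 @\<^sub>r b6 @\<^sub>r c6) = a6' @\<^sub>r b6' @\<^sub>r c6'"
    by (rule s1(1) s2(1) s3(1) s4(1) s5)+
qed

text \<open>Identifies the explicit block matrix of step II with the inverse of the whole triangular
  post-array block, so that the abstract results about \<open>minv J\<close> apply.\<close>

lemma minv_block_upper_triangular:
  assumes E: "E \<in> carrier_mat m m" "Determinant.det E \<noteq> 0" and P: "P \<in> carrier_mat n n" "Determinant.det P \<noteq> 0"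
    and K: "K \<in> carrier_mat m n"
  shows "minv (four_block_mat E K (0\<^sub>m n m) P)
    = four_block_mat (minv E) (- (minv E * K * minv P)) (0\<^sub>m n m) (minv P)"
proof (rule minv_eqI)
  note V = minv_carrier[OF E] minv_carrier[OF P]
  have "E * (minv E * K * minv P) = E * minv E * K * minv P"
    using E P K V by (simp add: assoc_mult_mat[of _ m m _ n _ n] assoc_mult_mat[of _ m m _ m _ n])
  also have "\<dots> = K * minv P" using K by (simp add: mult_minv[OF E])
  finally have "E * - (minv E * K * minv P) + K * minv P = 0\<^sub>m m n"
    using E P K V by (intro eq_matI) (auto simp del: index_mult_mat(1))
  moreover have "- 0\<^sub>m n n = (0\<^sub>m n n :: real mat)" by (intro eq_matI) auto
  ultimately show "four_block_mat E K (0\<^sub>m n m) P *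
      four_block_mat (minv E) (- (minv E * K * minv P)) (0\<^sub>m n m) (minv P) = 1\<^sub>m (m + n)"
    using E P K V by (subst mult_four_block_mat[of _ m m _ n _ n _ _ m _ n]) (auto simp: mult_minv[OF E] mult_minv[OF P])
qed (use E P K minv_carrier[OF E] minv_carrier[OF P] in \<open>auto intro!: four_block_carrier_mat\<close>)

section \<open>Vectors as one-column matrices, so that a single matrix calculus serves for
  both\<close>

lemma colmat_carrier: "v \<in> carrier_vec n \<Longrightarrow> colmat v \<in> carrier_mat n 1"
  by (auto simp: colmat_def)

lemma dim_colmat [simp]: "dim_row (colmat v) = dim_vec v" "dim_col (colmat v) = 1"
  by (simp_all add: colmat_def)

lemma index_colmat [simp]: "i < dim_vec v \<Longrightarrow> colmat v $$ (i, 0) = v $ i"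
  by (simp add: colmat_def mat_of_cols_Cons_index_0)

lemma colmat_inject: "colmat v = colmat w \<longleftrightarrow> v = w"
proof
  assume eq: "colmat v = colmat w"
  have d: "dim_vec v = dim_vec w" using arg_cong[OF eq, of dim_row] by simp
  show "v = w"
  proof (rule eq_vecI)
    fix i assume "i < dim_vec w"
    then show "v $ i = w $ i" using arg_cong[OF eq, of "\<lambda>M. M $$ (i, 0)"] d by simp
  qed (use d in auto)
qed auto

lemma colmat_mult_vec: "dim_col A = dim_vec v \<Longrightarrow> colmat (A *\<^sub>v v) = A * colmat v"
  by (intro eq_matI) (auto simp: scalar_prod_def intro!: sum.cong)

lemma colmat_add: "dim_vec v = dim_vec w \<Longrightarrow> colmat (v + w) = colmat v + colmat w"
  by (intro eq_matI) auto

lemma colmat_minus: "dim_vec v = dim_vec w \<Longrightarrow> colmat (v - w) = colmat v - colmat w"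
  by (intro eq_matI) auto

lemma colmat_uminus: "colmat (- v) = - colmat v"
  by (intro eq_matI) auto

lemma colmat_append: "colmat (v @\<^sub>v w) = colmat v @\<^sub>r colmat w"
  by (intro eq_matI) (auto simp: index_append_rows)

section \<open>Differentiating a triangular factorization\<close>

lemma orth_mat_gram:
  assumes "Ok \<in> carrier_mat s s" "orth_mat Ok" "X \<in> carrier_mat s a" "Y \<in> carrier_mat s b"
  shows "transpose_mat (Ok * X) * (Ok * Y) = transpose_mat X * Y"
proof -
  have "(Ok * X)\<^sup>T * (Ok * Y) = (X\<^sup>T * Ok\<^sup>T) * (Ok * Y)"
    using assms by (simp add: transpose_mult[of Ok s s X a])
  also have "\<dots> = X\<^sup>T * (Ok\<^sup>T * (Ok * Y))"
    using assms by (intro assoc_mult_mat[of _ a s _ s _ b]) auto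
  also have "Ok\<^sup>T * (Ok * Y) = Ok\<^sup>T * Ok * Y"
    using assms by (intro assoc_mult_mat[of _ s s _ s _ b, symmetric]) auto
  also have "\<dots> = Y" using assms by (simp add: orth_mat_def)
  finally show ?thesis .
qed

text \<open>Compare entries: on the diagonal \<open>Z\<close> and \<open>A\<close> agree, and above
  it the whole sum of the two mirrored entries of \<open>A\<close> falls to \<open>Z\<close>. The
  difference is therefore skew-symmetric; the second claim is stated for transposes because that is
  how it enters the equation for \<open>c\<close>.\<close>

lemma upper_triangular_of_symmetric_part:
  assumes Z: "Z \<in> carrier_mat r r" and A: "A \<in> carrier_mat r r" and ut: "upper_triangular Z"
    and eq: "transpose_mat Z + Z = transpose_mat A + A"
  shows "Z = transpose_mat (str_lower A) + diag_part A + str_upper A"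
    and "transpose_mat A - transpose_mat Z = transpose_mat (str_lower A) - str_lower A"
proof -
  have e: "Z $$ (j, i) + Z $$ (i, j) = A $$ (j, i) + A $$ (i, j)" if "i < r" "j < r" for i j
    using arg_cong[OF eq, of "\<lambda>M. M $$ (i, j)"] Z A that by simp
  have z: "Z $$ (i, j) = 0" if "j < i" "i < r" for i j
    using upper_triangular_entry[OF Z ut that] .
  have "Z $$ (i, j) = (transpose_mat (str_lower A) + diag_part A + str_upper A) $$ (i, j) \<and>
     (transpose_mat A - transpose_mat Z) $$ (i, j) = (transpose_mat (str_lower A) - str_lower A) $$ (i, j)"
    if ij: "i < r" "j < r" for i j
    using e[OF ij] z[of i j] z[of j i] ij Z A
    by (cases i j rule: linorder_cases) (auto simp: str_lower_def str_upper_def diag_part_def)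
  then show "Z = transpose_mat (str_lower A) + diag_part A + str_upper A"
    and "transpose_mat A - transpose_mat Z = transpose_mat (str_lower A) - str_lower A"
    using Z A by (auto intro!: eq_matI simp: str_lower_def str_upper_def diag_part_def)
qed

text \<open>Used with X the derivative of \<open>J\<close> and with X the top part of the rotated
  derivative of \<open>M\<close>: equality of the two differentiated Gram matrices becomes equality
  of the symmetric parts of X J^{-1}.\<close>

lemma congruence_by_inverse:
  assumes J: "J \<in> carrier_mat r r" and d: "Determinant.det J \<noteq> 0" and X: "X \<in> carrier_mat r r"
  shows "transpose_mat (minv J) * (transpose_mat X * J + transpose_mat J * X) * minv J
    = transpose_mat (X * minv J) + X * minv J"
proof -
  let ?I = "minv J"
  note I = minv_carrier[OF J d]
  have "?I\<^sup>T * (X\<^sup>T * J + J\<^sup>T * X) * ?I = ?I\<^sup>T * (X\<^sup>T * J) * ?I + ?I\<^sup>T * (J\<^sup>T * X) * ?I"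
    using I J X by (simp add: mult_add_distrib_mat[of _ r r _ r] add_mult_distrib_mat[of _ r r _ _ r])
  also have "?I\<^sup>T * (X\<^sup>T * J) * ?I = ?I\<^sup>T * (X\<^sup>T * (J * ?I))"
    using I J X by (simp add: assoc_mult_mat[of _ r r _ r _ r])
  also have "\<dots> = (X * ?I)\<^sup>T"
    using I X by (simp add: mult_minv[OF J d] transpose_mult[of X r r _ r])
  also have "?I\<^sup>T * (J\<^sup>T * X) * ?I = (?I\<^sup>T * J\<^sup>T) * X * ?I"
    using I J X by (simp add: assoc_mult_mat[of _ r r _ r _ r])
  also have "\<dots> = X * ?I" using X by (simp add: transpose_minv_mult[OF J d])
  finally show ?thesis .
qed

text \<open>With \<open>Z = J' J\<^sup>-\<^sup>1\<close> and \<open>A = A\<^sub>1 J\<^sup>-\<^sup>1\<close>, the differentiated Gram identity says that \<open>Z\<close> and \<open>A\<close> have the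
  same symmetric part; since \<open>Z\<close> is upper triangular, this determines \<open>Z\<close>.\<close>

lemma triangular_factor_derivative:
  assumes J: "J \<in> carrier_mat r r" "upper_triangular J" and d: "Determinant.det J \<noteq> 0"
    and J': "J' \<in> carrier_mat r r" "upper_triangular J'" and A1: "A1 \<in> carrier_mat r r"
    and gram: "transpose_mat J' * J + transpose_mat J * J' = transpose_mat A1 * J + transpose_mat J * A1"
  defines "A \<equiv> A1 * minv J"
  shows "J' = (transpose_mat (str_lower A) + diag_part A + str_upper A) * J"
    and "transpose_mat A1 - transpose_mat J' = transpose_mat J * (transpose_mat (str_lower A) - str_lower A)"
proof -
  note I = minv_carrier[OF J(1) d]
  define Z where "Z = J' * minv J"
  have Z: "Z \<in> carrier_mat r r" and A: "A \<in> carrier_mat r r" using I J' A1 by (auto simp: Z_def A_def)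
  have ZJ: "Z * J = J'" and AJ: "A * J = A1"
    using J I J' A1 by (simp_all add: Z_def A_def assoc_mult_mat[of _ r r _ r _ r] minv_mult[OF J(1) d])
  have "upper_triangular Z"
    unfolding Z_def by (rule upper_triangular_mult[OF J'(1) I J'(2) upper_triangular_minv[OF J d]])
  moreover have "transpose_mat Z + Z = transpose_mat A + A"
    unfolding Z_def A_def using congruence_by_inverse[OF J(1) d J'(1)] congruence_by_inverse[OF J(1) d A1]
    by (simp add: gram)
  ultimately have Zeq: "Z = transpose_mat (str_lower A) + diag_part A + str_upper A"
    and skew: "transpose_mat A - transpose_mat Z = transpose_mat (str_lower A) - str_lower A"
    using upper_triangular_of_symmetric_part[OF Z A] by blast+
  show "J' = (transpose_mat (str_lower A) + diag_part A + str_upper A) * J"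
    using ZJ Zeq by simp
  have "transpose_mat J * (transpose_mat (str_lower A) - str_lower A) = J\<^sup>T * A\<^sup>T - J\<^sup>T * Z\<^sup>T"
    unfolding skew[symmetric] using J Z A by (intro mult_minus_distrib_mat[of _ r r _ r]) auto
  also have "\<dots> = (A * J)\<^sup>T - (Z * J)\<^sup>T"
    using J Z A by (simp add: transpose_mult[of _ r r _ r])
  finally show "transpose_mat A1 - transpose_mat J' = transpose_mat J * (transpose_mat (str_lower A) - str_lower A)"
    by (simp add: AJ ZJ)
qed

text \<open>The last hypothesis is the derivative of J^T c = M^T b after rotation: \<open>A1\<close>
  and \<open>A2\<close> are the top and bottom of the rotated derivative of \<open>M\<close>, \<mu>
  is the top of the rotated derivative of \<open>b\<close>, and \<gamma> the bottom of the rotated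
  \<open>b\<close>. Solving for J^T c' leaves (A1 - J')^T c, from which \<open>S\<close> extracts a
  factor J^T, so that J^T can be cancelled throughout.\<close>

lemma triangular_system_derivative:
  assumes J: "J \<in> carrier_mat r r" and d: "Determinant.det J \<noteq> 0"
    and J': "J' \<in> carrier_mat r r" and A1: "A1 \<in> carrier_mat r r" and A2: "A2 \<in> carrier_mat q r"
    and c: "c \<in> carrier_mat r w" "c' \<in> carrier_mat r w" "\<mu> \<in> carrier_mat r w" and \<gamma>: "\<gamma> \<in> carrier_mat q w"
    and S: "S \<in> carrier_mat r r" "transpose_mat A1 - transpose_mat J' = transpose_mat J * S"
    and eq: "transpose_mat J' * c + transpose_mat J * c'
      = (transpose_mat A1 * c + transpose_mat A2 * \<gamma>) + transpose_mat J * \<mu>"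
  shows "c' = S * c + transpose_mat (minv J) * (transpose_mat A2 * \<gamma>) + \<mu>"
proof (rule mult_left_cancel_inv[of "J\<^sup>T" r "(minv J)\<^sup>T"])
  note I = minv_carrier[OF J d]
  let ?g = "A2\<^sup>T * \<gamma>"
  have g: "?g \<in> carrier_mat r w" using A2 \<gamma> by auto
  have 1: "J\<^sup>T * c' = (A1\<^sup>T * c + ?g) + J\<^sup>T * \<mu> - J'\<^sup>T * c"
  proof (rule eq_matI)
    fix i j assume "i < dim_row ((A1\<^sup>T * c + ?g) + J\<^sup>T * \<mu> - J'\<^sup>T * c)" "j < dim_col ((A1\<^sup>T * c + ?g) + J\<^sup>T * \<mu> - J'\<^sup>T * c)"
    then have ij: "i < r" "j < w" using J' c by auto
    show "(J\<^sup>T * c') $$ (i, j) = ((A1\<^sup>T * c + ?g) + J\<^sup>T * \<mu> - J'\<^sup>T * c) $$ (i, j)"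
      using arg_cong[OF eq, of "\<lambda>M. M $$ (i, j)"] ij J J' A1 A2 \<gamma> g c
      by (simp del: index_mult_mat(1))
  qed (use J J' c in auto)
  have 2: "J\<^sup>T * S * c = A1\<^sup>T * c - J'\<^sup>T * c"
    unfolding S(2)[symmetric] using A1 J' c by (intro minus_mult_distrib_mat[of _ r r _ _ w]) auto
  have 3: "J\<^sup>T * ((minv J)\<^sup>T * ?g) = ?g"
    using assoc_mult_mat[of "J\<^sup>T" r r "(minv J)\<^sup>T" r ?g w] transpose_minv_mult(1)[OF J d] I J g
      left_mult_one_mat[OF g] by (metis transpose_carrier_mat)
  have "J\<^sup>T * (S * c + (minv J)\<^sup>T * ?g + \<mu>) = J\<^sup>T * (S * c) + J\<^sup>T * ((minv J)\<^sup>T * ?g) + J\<^sup>T * \<mu>"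
    using J S(1) I g c by (simp add: mult_add_distrib_mat[of _ r r _ w])
  also have "\<dots> = (A1\<^sup>T * c - J'\<^sup>T * c) + ?g + J\<^sup>T * \<mu>"
    using J S(1) c by (simp add: 2[symmetric] 3 assoc_mult_mat[of _ r r _ r _ w])
  also have "\<dots> = J\<^sup>T * c'"
    unfolding 1 using J J' A1 A2 \<gamma> g c by (intro eq_matI) (auto simp del: index_mult_mat(1))
  finally show "J\<^sup>T * c' = J\<^sup>T * (S * c + (minv J)\<^sup>T * ?g + \<mu>)" by simp
  show "(minv J)\<^sup>T * J\<^sup>T = 1\<^sub>m r" by (rule transpose_minv_mult(2)[OF J d])
qed (use J minv_carrier[OF J d] S c A2 \<gamma> in auto)

section \<open>Calculus of matrix-valued functions\<close>

lemma differentiable_cong_eventually: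
  assumes "f differentiable (at x)" "\<forall>\<^sub>F y in nhds x. f y = g y"
  shows "g differentiable (at x)"
proof -
  obtain f' where "(f has_derivative f') (at x)" using assms(1) by (auto simp: differentiable_def)
  then have "(g has_derivative f') (at x)"
    by (rule has_derivative_transform_eventually)
      (use assms(2) eventually_nhds_x_imp_x[OF assms(2)] in \<open>auto simp: eventually_at_filter elim: eventually_mono\<close>)
  then show ?thesis by (auto simp: differentiable_def)
qed

lemma differentiable_cong_open:
  assumes "f differentiable (at x)" "open \<Omega>" "x \<in> \<Omega>" "\<And>y. y \<in> \<Omega> \<Longrightarrow> f y = g y"
  shows "g differentiable (at x)"
  using assms by (intro differentiable_cong_eventually[OF assms(1)]) (auto simp: eventually_nhds)

lemma differentiable_prod_finite:
  fixes f :: "'i \<Rightarrow> 'a::real_normed_vector \<Rightarrow> real"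
  assumes "finite I" "\<And>i. i \<in> I \<Longrightarrow> f i differentiable (at x)"
  shows "(\<lambda>y. \<Prod>i\<in>I. f i y) differentiable (at x)"
  using assms by (induction I rule: finite_induct) auto

lemma differentiable_sqrt:
  fixes f :: "'a::real_normed_vector \<Rightarrow> real"
  assumes "f differentiable (at x)" "0 < f x"
  shows "(\<lambda>y. sqrt (f y)) differentiable (at x)"
  using assms DERIV_real_sqrt[OF assms(2)]
  by (intro differentiable_compose[of sqrt f]) (auto simp: real_differentiable_def)

text \<open>For negative x this uses ln (- x) = ln x. It is needed because diagonal entries of a
  root are negative where \<sigma> is -1.\<close>

lemma DERIV_ln_nonzero:
  fixes x :: real
  assumes "x \<noteq> 0"
  shows "(ln has_real_derivative 1 / x) (at x)"
proof (cases "0 < x")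
  case False
  then have "((\<lambda>y. ln (- y)) has_real_derivative 1 / x) (at x)"
    using assms by (auto intro!: derivative_eq_intros)
  then show ?thesis by (simp add: ln_minus)
qed (rule DERIV_ln_divide)

section \<open>Partial derivatives of functions known only on an open set\<close>

lemma eventually_line:
  fixes \<theta> :: "real ^ 'p::finite"
  assumes "open \<Omega>" "\<theta> \<in> \<Omega>"
  shows "\<forall>\<^sub>F t in nhds 0. \<theta> + t *\<^sub>R axis i 1 \<in> \<Omega>"
proof -
  have "open ((\<lambda>t. \<theta> + t *\<^sub>R axis i 1) -` \<Omega>)"
    by (intro open_vimage assms continuous_intros)
  then show ?thesis using assms(2) by (auto simp: eventually_nhds intro!: exI[of _ "(\<lambda>t. \<theta> + t *\<^sub>R axis i 1) -` \<Omega>"])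
qed

lemma has_partial_deriv:
  fixes f :: "real ^ 'p::finite \<Rightarrow> real"
  assumes "f differentiable (at \<theta>)"
  shows "((\<lambda>t. f (\<theta> + t *\<^sub>R axis i 1)) has_real_derivative partial_deriv i f \<theta>) (at 0)"
  unfolding partial_deriv_def DERIV_deriv_iff_real_differentiable
  by (rule differentiable_compose[of f]) (use assms in auto)

text \<open>Nothing is assumed about the system outside \<Omega>, so a closed form \<open>g\<close>
  is available only on \<Omega>. Since \<Omega> is open, the line through \<theta> stays in it for
  small t, and that suffices for the derivative at 0.\<close>

lemma partial_deriv_eqI:
  fixes f :: "real ^ 'p::finite \<Rightarrow> real"
  assumes "open \<Omega>" "\<theta> \<in> \<Omega>" "\<And>\<theta>'. \<theta>' \<in> \<Omega> \<Longrightarrow> f \<theta>' = g \<theta>'"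
    and "((\<lambda>t. g (\<theta> + t *\<^sub>R axis i 1)) has_real_derivative D) (at 0)"
  shows "partial_deriv i f \<theta> = D"
proof -
  have "partial_deriv i f \<theta> = deriv (\<lambda>t. g (\<theta> + t *\<^sub>R axis i 1)) 0"
    unfolding partial_deriv_def using eventually_line[OF assms(1,2), of i]
    by (intro deriv_cong_ev) (auto elim!: eventually_mono simp: assms(3))
  then show ?thesis using DERIV_imp_deriv[OF assms(4)] by simp
qed

text \<open>Dimensions and differentiability are bundled on all of \<Omega>: a formula for an entry
  of a product can be differentiated at \<theta> only if the dimensions are right in a neighbourhood
  of \<theta>.\<close>

definition mat_diff_on :: "(real ^ 'p::finite) set \<Rightarrow> nat \<Rightarrow> nat \<Rightarrow> (real ^ 'p \<Rightarrow> real mat) \<Rightarrow> bool" where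
  "mat_diff_on \<Omega> r c A \<longleftrightarrow> (\<forall>\<theta>\<in>\<Omega>. A \<theta> \<in> carrier_mat r c \<and> mat_diff A \<theta>)"

lemma mat_diff_onD:
  assumes "mat_diff_on \<Omega> r c A" "\<theta> \<in> \<Omega>"
  shows "A \<theta> \<in> carrier_mat r c" "mat_diff A \<theta>"
    and "\<And>a b. a < r \<Longrightarrow> b < c \<Longrightarrow> (\<lambda>\<theta>'. A \<theta>' $$ (a, b)) differentiable (at \<theta>)"
    and "dim_row (A \<theta>) = r" "dim_col (A \<theta>) = c"
proof -
  show *: "A \<theta> \<in> carrier_mat r c" "mat_diff A \<theta>" using assms by (simp_all add: mat_diff_on_def)
  then show "dim_row (A \<theta>) = r" "dim_col (A \<theta>) = c" by simp_all
  then show "(\<lambda>\<theta>'. A \<theta>' $$ (a, b)) differentiable (at \<theta>)" if "a < r" "b < c" for a b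
    using *(2) that unfolding mat_diff_def by blast
qed

lemma mat_diff_onI:
  assumes "open \<Omega>" "\<And>\<theta>. \<theta> \<in> \<Omega> \<Longrightarrow> A \<theta> \<in> carrier_mat r c"
    and "\<And>\<theta> a b. \<theta> \<in> \<Omega> \<Longrightarrow> a < r \<Longrightarrow> b < c \<Longrightarrow> A \<theta> $$ (a, b) = f a b \<theta>"
    and "\<And>\<theta> a b. \<theta> \<in> \<Omega> \<Longrightarrow> a < r \<Longrightarrow> b < c \<Longrightarrow> f a b differentiable (at \<theta>)"
  shows "mat_diff_on \<Omega> r c A"
  unfolding mat_diff_on_def mat_diff_def
proof (intro ballI conjI allI impI)
  fix \<theta> a b assume \<theta>: "\<theta> \<in> \<Omega>" and "a < dim_row (A \<theta>)" "b < dim_col (A \<theta>)"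
  then have ab: "a < r" "b < c" using assms(2)[OF \<theta>] by auto
  show "(\<lambda>\<theta>'. A \<theta>' $$ (a, b)) differentiable (at \<theta>)"
    by (rule differentiable_cong_open[OF assms(4)[OF \<theta> ab] assms(1) \<theta>]) (simp add: assms(3) ab)
qed (use assms(2) in auto)

lemma mat_pd_carrier: "mat_diff_on \<Omega> r c A \<Longrightarrow> \<theta> \<in> \<Omega> \<Longrightarrow> mat_pd i A \<theta> \<in> carrier_mat r c"
  by (auto simp: mat_pd_def mat_diff_on_def)

lemma mat_pd_eqI:
  assumes "open \<Omega>" "\<theta> \<in> \<Omega>" "\<And>\<theta>. \<theta> \<in> \<Omega> \<Longrightarrow> A \<theta> \<in> carrier_mat r c" "D \<in> carrier_mat r c"
    and "\<And>\<theta> a b. \<theta> \<in> \<Omega> \<Longrightarrow> a < r \<Longrightarrow> b < c \<Longrightarrow> A \<theta> $$ (a, b) = f a b \<theta>"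
    and "\<And>a b. a < r \<Longrightarrow> b < c \<Longrightarrow>
      ((\<lambda>t. f a b (\<theta> + t *\<^sub>R axis i 1)) has_real_derivative D $$ (a, b)) (at 0)"
  shows "mat_pd i A \<theta> = D"
proof (rule eq_matI)
  fix a b assume "a < dim_row D" "b < dim_col D"
  then have ab: "a < r" "b < c" using assms(4) by auto
  have "partial_deriv i (\<lambda>\<theta>'. A \<theta>' $$ (a, b)) \<theta> = D $$ (a, b)"
    using assms(5,6) ab by (intro partial_deriv_eqI[OF assms(1,2), of _ "f a b"]) auto
  then show "mat_pd i A \<theta> $$ (a, b) = D $$ (a, b)"
    using assms(3)[OF assms(2)] ab by (simp add: mat_pd_def)
qed (use assms(3)[OF assms(2)] assms(4) in \<open>auto simp: mat_pd_def\<close>)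

lemma has_mat_pd:
  assumes "mat_diff_on \<Omega> r c A" "\<theta> \<in> \<Omega>" "a < r" "b < c"
  shows "((\<lambda>t. A (\<theta> + t *\<^sub>R axis i 1) $$ (a, b)) has_real_derivative mat_pd i A \<theta> $$ (a, b)) (at 0)"
  using has_partial_deriv[OF mat_diff_onD(3)[OF assms], of i] mat_diff_onD(1)[OF assms(1,2)] assms(3,4)
  by (simp add: mat_pd_def)

lemma mat_diff_on_cong:
  assumes "open \<Omega>" "mat_diff_on \<Omega> r c A" "\<And>\<theta>. \<theta> \<in> \<Omega> \<Longrightarrow> B \<theta> = A \<theta>"
  shows "mat_diff_on \<Omega> r c B"
  using mat_diff_onD[OF assms(2)] assms(3)
  by (intro mat_diff_onI[OF assms(1), of _ _ _ "\<lambda>a b \<theta>. A \<theta> $$ (a, b)"]) auto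

lemma mat_pd_cong:
  assumes "open \<Omega>" "mat_diff_on \<Omega> r c A" "\<theta> \<in> \<Omega>" "\<And>\<theta>. \<theta> \<in> \<Omega> \<Longrightarrow> B \<theta> = A \<theta>"
  shows "mat_pd i B \<theta> = mat_pd i A \<theta>"
  using mat_diff_onD[OF assms(2)] assms(3,4) has_mat_pd[OF assms(2,3)]
  by (intro mat_pd_eqI[OF assms(1), of _ _ r c _ "\<lambda>a b \<theta>. A \<theta> $$ (a, b)"]) (auto intro: mat_pd_carrier[OF assms(2,3)])

lemma mat_diff_on_const: "C \<in> carrier_mat r c \<Longrightarrow> mat_diff_on \<Omega> r c (\<lambda>_. C)"
  by (auto simp: mat_diff_on_def mat_diff_def)

lemma mat_pd_zero: "mat_pd i (\<lambda>_. 0\<^sub>m r c) \<theta> = 0\<^sub>m r c"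
  by (rule mat_pd_eqI[of UNIV _ _ r c _ "\<lambda>_ _ _. 0"]) auto

text \<open>Dimensions are fixed on \<Omega>, but differentiability is asked at the one point
  \<theta>. This form serves the root of Q_k, which is known to be differentiable only where Q_k is
  positive definite.\<close>

lemma mat_diff_mult:
  assumes "open \<Omega>" and A: "\<And>\<theta>. \<theta> \<in> \<Omega> \<Longrightarrow> A \<theta> \<in> carrier_mat r n" and B: "\<And>\<theta>. \<theta> \<in> \<Omega> \<Longrightarrow> B \<theta> \<in> carrier_mat n c"
    and \<theta>: "\<theta> \<in> \<Omega>" and d: "mat_diff A \<theta>" "mat_diff B \<theta>"
  shows "mat_diff (\<lambda>\<theta>. A \<theta> * B \<theta>) \<theta>"
  unfolding mat_diff_def
proof (intro allI impI)
  fix a b assume "a < dim_row (A \<theta> * B \<theta>)" "b < dim_col (A \<theta> * B \<theta>)"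
  then have ab: "a < r" "b < c" using A[OF \<theta>] B[OF \<theta>] by auto
  have "(\<lambda>\<theta>. A \<theta> $$ (a, k)) differentiable (at \<theta>)" "(\<lambda>\<theta>. B \<theta> $$ (k, b)) differentiable (at \<theta>)" if "k < n" for k
    using d A[OF \<theta>] B[OF \<theta>] ab that by (auto simp: mat_diff_def)
  then have "(\<lambda>\<theta>. \<Sum>k<n. A \<theta> $$ (a, k) * B \<theta> $$ (k, b)) differentiable (at \<theta>)"
    by (intro differentiable_sum ballI differentiable_mult) auto
  then show "(\<lambda>\<theta>. (A \<theta> * B \<theta>) $$ (a, b)) differentiable (at \<theta>)"
    by (rule differentiable_cong_open[OF _ assms(1) \<theta>]) (rule index_mult_mat_sum[OF A B ab, symmetric])
qed

lemma mat_diff_on_mult: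
  assumes "open \<Omega>" and A: "mat_diff_on \<Omega> r n A" and B: "mat_diff_on \<Omega> n c B"
  shows "mat_diff_on \<Omega> r c (\<lambda>\<theta>. A \<theta> * B \<theta>)"
  unfolding mat_diff_on_def
  by (intro ballI conjI mat_diff_mult[OF assms(1) mat_diff_onD(1)[OF A] mat_diff_onD(1)[OF B]]
      mult_carrier_mat[OF mat_diff_onD(1)[OF A] mat_diff_onD(1)[OF B]] mat_diff_onD(2)[OF A] mat_diff_onD(2)[OF B])

lemma mat_pd_mult:
  assumes "open \<Omega>" and A: "mat_diff_on \<Omega> r n A" and B: "mat_diff_on \<Omega> n c B" and \<theta>: "\<theta> \<in> \<Omega>"
  shows "mat_pd i (\<lambda>\<theta>. A \<theta> * B \<theta>) \<theta> = mat_pd i A \<theta> * B \<theta> + A \<theta> * mat_pd i B \<theta>"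
proof (rule mat_pd_eqI[OF assms(1) \<theta>, of _ r c _ "\<lambda>a b \<theta>. \<Sum>k<n. A \<theta> $$ (a, k) * B \<theta> $$ (k, b)"])
  note AD = mat_diff_onD[OF A] and BD = mat_diff_onD[OF B]
  note pd = mat_pd_carrier[OF A \<theta>, of i] mat_pd_carrier[OF B \<theta>, of i]
  show "mat_pd i A \<theta> * B \<theta> + A \<theta> * mat_pd i B \<theta> \<in> carrier_mat r c"
    using AD(1)[OF \<theta>] BD(1)[OF \<theta>] pd by auto
  show "A \<theta> * B \<theta> \<in> carrier_mat r c" if "\<theta> \<in> \<Omega>" for \<theta>
    using AD(1)[OF that] BD(1)[OF that] by simp
  show "(A \<theta> * B \<theta>) $$ (a, b) = (\<Sum>k<n. A \<theta> $$ (a, k) * B \<theta> $$ (k, b))"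
    if "\<theta> \<in> \<Omega>" "a < r" "b < c" for \<theta> a b
    by (rule index_mult_mat_sum[OF AD(1)[OF that(1)] BD(1)[OF that(1)] that(2,3)])
  fix a b assume ab: "a < r" "b < c"
  have "((\<lambda>t. \<Sum>k<n. A (\<theta> + t *\<^sub>R axis i 1) $$ (a, k) * B (\<theta> + t *\<^sub>R axis i 1) $$ (k, b)) has_real_derivative
    (\<Sum>k<n. mat_pd i A \<theta> $$ (a, k) * B (\<theta> + 0 *\<^sub>R axis i 1) $$ (k, b)
       + mat_pd i B \<theta> $$ (k, b) * A (\<theta> + 0 *\<^sub>R axis i 1) $$ (a, k))) (at 0)"
    using ab by (intro DERIV_sum DERIV_mult has_mat_pd[OF A \<theta>] has_mat_pd[OF B \<theta>]) auto
  also have "(\<Sum>k<n. mat_pd i A \<theta> $$ (a, k) * B (\<theta> + 0 *\<^sub>R axis i 1) $$ (k, b)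
       + mat_pd i B \<theta> $$ (k, b) * A (\<theta> + 0 *\<^sub>R axis i 1) $$ (a, k))
     = (mat_pd i A \<theta> * B \<theta> + A \<theta> * mat_pd i B \<theta>) $$ (a, b)"
    using ab AD(1)[OF \<theta>] BD(1)[OF \<theta>] pd index_mult_mat_sum[OF pd(1) BD(1)[OF \<theta>] ab]
      index_mult_mat_sum[OF AD(1)[OF \<theta>] pd(2) ab]
    by (simp add: sum.distrib mult.commute del: index_mult_mat(1))
  finally show "((\<lambda>t. \<Sum>k<n. A (\<theta> + t *\<^sub>R axis i 1) $$ (a, k) * B (\<theta> + t *\<^sub>R axis i 1) $$ (k, b)) has_real_derivative
     (mat_pd i A \<theta> * B \<theta> + A \<theta> * mat_pd i B \<theta>) $$ (a, b)) (at 0)" .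
qed

lemma mat_diff_on_transpose:
  assumes "open \<Omega>" and A: "mat_diff_on \<Omega> r c A"
  shows "mat_diff_on \<Omega> c r (\<lambda>\<theta>. transpose_mat (A \<theta>))"
  using mat_diff_onD[OF A] assms(1)
  by (intro mat_diff_onI[of _ _ _ _ "\<lambda>a b \<theta>. A \<theta> $$ (b, a)"]) (auto intro!: carrier_matI)

lemma mat_pd_transpose:
  assumes "open \<Omega>" and A: "mat_diff_on \<Omega> r c A" and \<theta>: "\<theta> \<in> \<Omega>"
  shows "mat_pd i (\<lambda>\<theta>. transpose_mat (A \<theta>)) \<theta> = transpose_mat (mat_pd i A \<theta>)"
  using mat_diff_onD[OF A] has_mat_pd[OF A \<theta>, of _ _ i] \<theta> mat_pd_carrier[OF A \<theta>, of i]
  by (intro mat_pd_eqI[OF assms(1) \<theta>, of _ c r _ "\<lambda>a b \<theta>. A \<theta> $$ (b, a)"]) (auto intro!: carrier_matI)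

lemma mat_diff_on_add:
  assumes "open \<Omega>" and A: "mat_diff_on \<Omega> r c A" and B: "mat_diff_on \<Omega> r c B"
  shows "mat_diff_on \<Omega> r c (\<lambda>\<theta>. A \<theta> + B \<theta>)"
  using mat_diff_onD[OF A] mat_diff_onD[OF B] assms(1)
  by (intro mat_diff_onI[of _ _ _ _ "\<lambda>a b \<theta>. A \<theta> $$ (a, b) + B \<theta> $$ (a, b)"]) (auto intro!: carrier_matI)

lemma mat_diff_on_minus:
  assumes "open \<Omega>" and A: "mat_diff_on \<Omega> r c A" and B: "mat_diff_on \<Omega> r c B"
  shows "mat_diff_on \<Omega> r c (\<lambda>\<theta>. A \<theta> - B \<theta>)"
  using mat_diff_onD[OF A] mat_diff_onD[OF B] assms(1)
  by (intro mat_diff_onI[of _ _ _ _ "\<lambda>a b \<theta>. A \<theta> $$ (a, b) - B \<theta> $$ (a, b)"]) (auto intro!: carrier_matI)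

lemma mat_diff_on_uminus:
  assumes "open \<Omega>" and A: "mat_diff_on \<Omega> r c A"
  shows "mat_diff_on \<Omega> r c (\<lambda>\<theta>. - A \<theta>)"
  using mat_diff_onD[OF A] assms(1)
  by (intro mat_diff_onI[of _ _ _ _ "\<lambda>a b \<theta>. - A \<theta> $$ (a, b)"]) (auto intro!: carrier_matI)

lemma mat_pd_uminus:
  assumes "open \<Omega>" and A: "mat_diff_on \<Omega> r c A" and \<theta>: "\<theta> \<in> \<Omega>"
  shows "mat_pd i (\<lambda>\<theta>. - A \<theta>) \<theta> = - mat_pd i A \<theta>"
  using mat_diff_onD[OF A] has_mat_pd[OF A \<theta>, of _ _ i] \<theta> mat_pd_carrier[OF A \<theta>, of i]
  by (intro mat_pd_eqI[OF assms(1) \<theta>, of _ r c _ "\<lambda>a b \<theta>. - A \<theta> $$ (a, b)"]) (auto intro!: DERIV_minus carrier_matI)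

lemma mat_diff_on_append_cols:
  assumes "open \<Omega>" and A: "mat_diff_on \<Omega> r c1 A" and B: "mat_diff_on \<Omega> r c2 B"
  shows "mat_diff_on \<Omega> r (c1 + c2) (\<lambda>\<theta>. A \<theta> @\<^sub>c B \<theta>)"
proof (rule mat_diff_onI[OF assms(1)])
  fix \<theta> a b assume "\<theta> \<in> \<Omega>" "a < r" "b < c1 + c2"
  then show "(A \<theta> @\<^sub>c B \<theta>) $$ (a, b) = (if b < c1 then A \<theta> $$ (a, b) else B \<theta> $$ (a, b - c1))"
    and "(\<lambda>\<theta>. if b < c1 then A \<theta> $$ (a, b) else B \<theta> $$ (a, b - c1)) differentiable (at \<theta>)"
    using mat_diff_onD(3-5)[OF A] mat_diff_onD(3-5)[OF B]
    by (auto simp: index_append_cols cong: if_cong) (cases "b < c1"; simp)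
qed (use mat_diff_onD(1)[OF A] mat_diff_onD(1)[OF B] append_cols_carrier in blast)

lemma mat_pd_append_cols:
  assumes "open \<Omega>" and A: "mat_diff_on \<Omega> r c1 A" and B: "mat_diff_on \<Omega> r c2 B" and \<theta>: "\<theta> \<in> \<Omega>"
  shows "mat_pd i (\<lambda>\<theta>. A \<theta> @\<^sub>c B \<theta>) \<theta> = mat_pd i A \<theta> @\<^sub>c mat_pd i B \<theta>"
proof (rule mat_pd_eqI[OF assms(1) \<theta>])
  note pd = mat_pd_carrier[OF A \<theta>, of i] mat_pd_carrier[OF B \<theta>, of i]
  show "mat_pd i A \<theta> @\<^sub>c mat_pd i B \<theta> \<in> carrier_mat r (c1 + c2)"
    using append_cols_carrier[OF pd] .
  show "(A \<theta> @\<^sub>c B \<theta>) $$ (a, b) = (if b < c1 then A \<theta> $$ (a, b) else B \<theta> $$ (a, b - c1))"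
    if "\<theta> \<in> \<Omega>" "a < r" "b < c1 + c2" for \<theta> a b
    using mat_diff_onD(4,5)[OF A that(1)] mat_diff_onD(4,5)[OF B that(1)] that by (auto simp: index_append_cols)
  show "((\<lambda>t. if b < c1 then A (\<theta> + t *\<^sub>R axis i 1) $$ (a, b) else B (\<theta> + t *\<^sub>R axis i 1) $$ (a, b - c1))
      has_real_derivative (mat_pd i A \<theta> @\<^sub>c mat_pd i B \<theta>) $$ (a, b)) (at 0)"
    if "a < r" "b < c1 + c2" for a b
    using that pd has_mat_pd[OF A \<theta>, of a b i] has_mat_pd[OF B \<theta>, of a "b - c1" i]
    by (auto simp: index_append_cols)
qed (use mat_diff_onD(1)[OF A] mat_diff_onD(1)[OF B] append_cols_carrier in blast)

lemma mat_diff_on_append_rows: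
  assumes "open \<Omega>" and A: "mat_diff_on \<Omega> r1 c A" and B: "mat_diff_on \<Omega> r2 c B"
  shows "mat_diff_on \<Omega> (r1 + r2) c (\<lambda>\<theta>. A \<theta> @\<^sub>r B \<theta>)"
proof (rule mat_diff_onI[OF assms(1)])
  fix \<theta> a b assume "\<theta> \<in> \<Omega>" "a < r1 + r2" "b < c"
  then show "(A \<theta> @\<^sub>r B \<theta>) $$ (a, b) = (if a < r1 then A \<theta> $$ (a, b) else B \<theta> $$ (a - r1, b))"
    and "(\<lambda>\<theta>. if a < r1 then A \<theta> $$ (a, b) else B \<theta> $$ (a - r1, b)) differentiable (at \<theta>)"
    using mat_diff_onD(3-5)[OF A] mat_diff_onD(3-5)[OF B]
    by (auto simp: index_append_rows cong: if_cong) (cases "a < r1"; simp)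
qed (use mat_diff_onD(1)[OF A] mat_diff_onD(1)[OF B] carrier_append_rows in blast)

lemma mat_pd_append_rows:
  assumes "open \<Omega>" and A: "mat_diff_on \<Omega> r1 c A" and B: "mat_diff_on \<Omega> r2 c B" and \<theta>: "\<theta> \<in> \<Omega>"
  shows "mat_pd i (\<lambda>\<theta>. A \<theta> @\<^sub>r B \<theta>) \<theta> = mat_pd i A \<theta> @\<^sub>r mat_pd i B \<theta>"
proof (rule mat_pd_eqI[OF assms(1) \<theta>])
  note pd = mat_pd_carrier[OF A \<theta>, of i] mat_pd_carrier[OF B \<theta>, of i]
  show "mat_pd i A \<theta> @\<^sub>r mat_pd i B \<theta> \<in> carrier_mat (r1 + r2) c"
    using carrier_append_rows[OF pd] .
  show "(A \<theta> @\<^sub>r B \<theta>) $$ (a, b) = (if a < r1 then A \<theta> $$ (a, b) else B \<theta> $$ (a - r1, b))"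
    if "\<theta> \<in> \<Omega>" "a < r1 + r2" "b < c" for \<theta> a b
    using mat_diff_onD(4,5)[OF A that(1)] mat_diff_onD(4,5)[OF B that(1)] that by (auto simp: index_append_rows)
  show "((\<lambda>t. if a < r1 then A (\<theta> + t *\<^sub>R axis i 1) $$ (a, b) else B (\<theta> + t *\<^sub>R axis i 1) $$ (a - r1, b))
      has_real_derivative (mat_pd i A \<theta> @\<^sub>r mat_pd i B \<theta>) $$ (a, b)) (at 0)"
    if "a < r1 + r2" "b < c" for a b
    using that pd has_mat_pd[OF A \<theta>, of a b i] has_mat_pd[OF B \<theta>, of "a - r1" b i]
    by (auto simp: index_append_rows)
qed (use mat_diff_onD(1)[OF A] mat_diff_onD(1)[OF B] carrier_append_rows in blast)

section \<open>Determinants, inverses and Cholesky factors as functions of the parameter\<close>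

lemma differentiable_det:
  assumes "open \<Omega>" and A: "mat_diff_on \<Omega> n n A" and \<theta>: "\<theta> \<in> \<Omega>"
  shows "(\<lambda>\<theta>. Determinant.det (A \<theta>)) differentiable (at \<theta>)"
proof (rule differentiable_cong_open[OF _ assms(1) \<theta>])
  show "(\<lambda>\<theta>. \<Sum>p\<in>{p. p permutes {0..<n}}. signof p * (\<Prod>i = 0..<n. A \<theta> $$ (i, p i))) differentiable (at \<theta>)"
    using permutes_in_image mat_diff_onD(3)[OF A \<theta>]
    by (intro differentiable_sum ballI differentiable_mult differentiable_prod_finite)
      (fastforce simp: finite_permutations)+
  show "(\<Sum>p\<in>{p. p permutes {0..<n}}. signof p * (\<Prod>i = 0..<n. A \<theta> $$ (i, p i))) = Determinant.det (A \<theta>)"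
    if "\<theta> \<in> \<Omega>" for \<theta>
    using det_def'[OF mat_diff_onD(1)[OF A that]] by simp
qed

lemma mat_diff_on_mat_delete:
  assumes "open \<Omega>" and A: "mat_diff_on \<Omega> n n A" and "k < n" "l < n"
  shows "mat_diff_on \<Omega> (n - 1) (n - 1) (\<lambda>\<theta>. mat_delete (A \<theta>) k l)"
proof (rule mat_diff_onI[OF assms(1)])
  note AD = mat_diff_onD[OF A]
  show "mat_delete (A \<theta>) k l \<in> carrier_mat (n - 1) (n - 1)" if "\<theta> \<in> \<Omega>" for \<theta>
    using AD(1)[OF that] by (auto simp: mat_delete_def)
  fix \<theta> a b assume *: "\<theta> \<in> \<Omega>" "a < n - 1" "b < n - 1"
  let ?i = "if a < k then a else Suc a" and ?j = "if b < l then b else Suc b"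
  show "mat_delete (A \<theta>) k l $$ (a, b) = A \<theta> $$ (?i, ?j)"
    using * AD(1)[OF *(1)] by (simp add: mat_delete_def)
  have "?i < n" "?j < n" using * by auto
  then show "(\<lambda>\<theta>. A \<theta> $$ (?i, ?j)) differentiable (at \<theta>)" using AD(3)[OF *(1)] by blast
qed

text \<open>Each entry is a cofactor divided by the determinant, and determinants are polynomials in
  the entries. The indices are swapped because the adjugate is the transposed cofactor
  matrix.\<close>

lemma mat_diff_on_minv:
  assumes "open \<Omega>" and A: "mat_diff_on \<Omega> n n A" and d: "\<And>\<theta>. \<theta> \<in> \<Omega> \<Longrightarrow> Determinant.det (A \<theta>) \<noteq> 0"
  shows "mat_diff_on \<Omega> n n (\<lambda>\<theta>. minv (A \<theta>))"
proof (rule mat_diff_onI[OF assms(1)])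
  note AD = mat_diff_onD[OF A]
  show "minv (A \<theta>) \<in> carrier_mat n n" if "\<theta> \<in> \<Omega>" for \<theta>
    using minv_carrier[OF AD(1) d] that by simp
  fix \<theta> a b assume \<theta>: "\<theta> \<in> \<Omega>" and ab: "a < n" "b < n"
  show "minv (A \<theta>) $$ (a, b) = cofactor (A \<theta>) b a / Determinant.det (A \<theta>)"
    using ab AD(1)[OF \<theta>] by (simp add: minv_eq_adj_mat[OF AD(1)[OF \<theta>] d[OF \<theta>]] adj_mat_def)
  show "(\<lambda>\<theta>. cofactor (A \<theta>) b a / Determinant.det (A \<theta>)) differentiable (at \<theta>)"
    unfolding cofactor_def
    using differentiable_det[OF assms(1) mat_diff_on_mat_delete[OF assms(1) A ab(2,1)] \<theta>]
      differentiable_det[OF assms(1) A \<theta>] d[OF \<theta>] by simp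
qed

text \<open>The rows of a Cholesky factor are given one after the other by explicit formulas.  A zero on
  the diagonal can only occur away from \<open>\<theta>\<close>, so that positive definiteness is needed at \<open>\<theta>\<close> alone.\<close>

lemma mat_diff_chol_factor:
  fixes A U :: "real ^ 'p::finite \<Rightarrow> real mat"
  assumes "open \<Omega>" and A: "\<And>\<theta>. \<theta> \<in> \<Omega> \<Longrightarrow> A \<theta> \<in> carrier_mat n n"
    and U: "\<And>\<theta>. \<theta> \<in> \<Omega> \<Longrightarrow> chol_factor \<sigma> (A \<theta>) (U \<theta>)"
    and \<theta>: "\<theta> \<in> \<Omega>" and "mat_diff A \<theta>" "pos_def (A \<theta>)" and \<sigma>: "\<And>j. \<sigma> j \<in> {1, -1}"
  shows "mat_diff U \<theta>"
proof -
  note UD = chol_factorD[OF U A]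
  have dA: "(\<lambda>\<theta>. A \<theta> $$ (i, j)) differentiable (at \<theta>)" if "i < n" "j < n" for i j
    using assms(5) A[OF \<theta>] that by (auto simp: mat_diff_def)
  have "(\<lambda>\<theta>. U \<theta> $$ (i, j)) differentiable (at \<theta>)" if "i < n" "j < n" for i j
    using that
  proof (induction i arbitrary: j rule: less_induct)
    case (less i)
    define T where "T = (\<lambda>j \<theta>. A \<theta> $$ (i, j) - (\<Sum>k<i. U \<theta> $$ (k, i) * U \<theta> $$ (k, j)))"
    have T: "T j differentiable (at \<theta>)" if "j < n" for j
      unfolding T_def using less that dA by (intro differentiable_diff differentiable_sum ballI differentiable_mult) auto
    have nz: "U \<theta> $$ (i, i) \<noteq> 0"
      using chol_factor_diag_nonzero[OF U[OF \<theta>] A[OF \<theta>] assms(6) less.prems(1)] .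
    \<comment> \<open>\<open>T i\<close> at \<theta> is the square of the pivot, so
      \<open>sqrt\<close> is met away from its singularity at 0.\<close>
    have "0 < T i \<theta>"
      unfolding T_def using chol_factor_entry[OF U[OF \<theta>] A[OF \<theta>] order_refl less.prems(1)] nz
      by (metis not_real_square_gt_zero)
    then have "(\<lambda>\<theta>. \<sigma> i * sqrt (T i \<theta>)) differentiable (at \<theta>)"
      using T[OF less.prems(1)] by (intro differentiable_mult differentiable_sqrt) auto
    then have d: "(\<lambda>\<theta>. U \<theta> $$ (i, i)) differentiable (at \<theta>)"
      by (rule differentiable_cong_open[OF _ assms(1) \<theta>])
        (simp add: T_def chol_factor_diag[OF U A less.prems(1) \<sigma>])
    show ?case
    proof (cases "i \<le> j")
      case True
      have "isCont (\<lambda>\<theta>. U \<theta> $$ (i, i)) \<theta>"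
        using d by (rule differentiable_imp_continuous_within)
      then have "\<forall>\<^sub>F \<theta>' in nhds \<theta>. U \<theta>' $$ (i, i) \<noteq> 0"
        using nz by (simp add: isCont_def tendsto_imp_eventually_ne eventually_nhds_conv_at)
      moreover have "\<forall>\<^sub>F \<theta>' in nhds \<theta>. \<theta>' \<in> \<Omega>" using assms(1) \<theta> by (auto simp: eventually_nhds)
      ultimately have "\<forall>\<^sub>F \<theta>' in nhds \<theta>. T j \<theta>' / U \<theta>' $$ (i, i) = U \<theta>' $$ (i, j)"
      proof eventually_elim
        case (elim \<theta>')
        then show ?case using chol_factor_entry[OF U A True less.prems(2)] by (simp add: T_def field_simps)
      qed
      then show ?thesis
        by (rule differentiable_cong_eventually[OF differentiable_divide[OF T[OF less.prems(2)] d nz]])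
    next
      case False
      then have "(\<lambda>\<theta>. 0::real) differentiable (at \<theta>)" "\<And>\<theta>. \<theta> \<in> \<Omega> \<Longrightarrow> 0 = U \<theta> $$ (i, j)"
        using upper_triangular_entry[OF UD(1,2)] less.prems by auto
      then show ?thesis by (rule differentiable_cong_open[OF _ assms(1) \<theta>])
    qed
  qed
  then show ?thesis using UD(1)[OF \<theta> \<theta>] by (auto simp: mat_diff_def)
qed

lemma mat_diff_on_chol:
  fixes A :: "real ^ 'p::finite \<Rightarrow> real mat"
  assumes "open \<Omega>" and A: "mat_diff_on \<Omega> n n A" and pd: "\<And>\<theta>. \<theta> \<in> \<Omega> \<Longrightarrow> pos_def (A \<theta>)"
    and \<sigma>: "\<And>j. \<sigma> j \<in> {1, -1}"
  shows "mat_diff_on \<Omega> n n (\<lambda>\<theta>. chol \<sigma> (A \<theta>))"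
  unfolding mat_diff_on_def
proof (intro ballI conjI)
  note AD = mat_diff_onD[OF A]
  have U: "chol_factor \<sigma> (A \<theta>) (chol \<sigma> (A \<theta>))" if "\<theta> \<in> \<Omega>" for \<theta>
    by (rule chol_factor_chol[OF AD(1)[OF that] pd[OF that] \<sigma>])
  fix \<theta> assume \<theta>: "\<theta> \<in> \<Omega>"
  show "chol \<sigma> (A \<theta>) \<in> carrier_mat n n" using chol_factorD(1)[OF U[OF \<theta>] AD(1)[OF \<theta>]] .
  show "mat_diff (\<lambda>\<theta>. chol \<sigma> (A \<theta>)) \<theta>"
    using mat_diff_chol_factor[OF assms(1) AD(1) U \<theta> AD(2)[OF \<theta>] pd[OF \<theta>] \<sigma>] .
qed

section \<open>Derivatives of vectors, block matrices and triangular matrices\<close>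

lemma vec_diff_iff_colmat:
  assumes "open \<Omega>" "\<theta> \<in> \<Omega>" "\<And>\<theta>. \<theta> \<in> \<Omega> \<Longrightarrow> v \<theta> \<in> carrier_vec n"
  shows "vec_diff v \<theta> \<longleftrightarrow> mat_diff (\<lambda>\<theta>. colmat (v \<theta>)) \<theta>"
proof -
  have e: "colmat (v \<theta>) $$ (a, 0) = v \<theta> $ a" if "\<theta> \<in> \<Omega>" "a < n" for \<theta> a
    using assms(3)[OF that(1)] that(2) by simp
  have "(\<lambda>\<theta>. v \<theta> $ a) differentiable (at \<theta>) \<longleftrightarrow> (\<lambda>\<theta>. colmat (v \<theta>) $$ (a, 0)) differentiable (at \<theta>)"
    if "a < n" for a
    using differentiable_cong_open[OF _ assms(1,2), of "\<lambda>\<theta>. v \<theta> $ a" "\<lambda>\<theta>. colmat (v \<theta>) $$ (a, 0)"]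
      differentiable_cong_open[OF _ assms(1,2), of "\<lambda>\<theta>. colmat (v \<theta>) $$ (a, 0)" "\<lambda>\<theta>. v \<theta> $ a"]
      e[OF _ that] by auto
  then show ?thesis using assms(3)[OF assms(2)] by (auto simp: vec_diff_def mat_diff_def)
qed

lemma dim_vec_pd [simp]: "dim_vec (vec_pd i v \<theta>) = dim_vec (v \<theta>)"
  by (simp add: vec_pd_def)

lemma colmat_vec_pd:
  assumes "open \<Omega>" "\<theta> \<in> \<Omega>" "\<And>\<theta>. \<theta> \<in> \<Omega> \<Longrightarrow> v \<theta> \<in> carrier_vec n"
    and v: "mat_diff_on \<Omega> n 1 (\<lambda>\<theta>. colmat (v \<theta>))"
  shows "colmat (vec_pd i v \<theta>) = mat_pd i (\<lambda>\<theta>. colmat (v \<theta>)) \<theta>"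
proof (rule eq_matI)
  fix a b assume "a < dim_row (mat_pd i (\<lambda>\<theta>. colmat (v \<theta>)) \<theta>)" "b < dim_col (mat_pd i (\<lambda>\<theta>. colmat (v \<theta>)) \<theta>)"
  then have ab: "a < n" "b = 0" using assms(3)[OF assms(2)] by (auto simp: mat_pd_def)
  have e: "v \<theta> $ a = colmat (v \<theta>) $$ (a, 0)" if "\<theta> \<in> \<Omega>" for \<theta>
    using assms(3)[OF that] ab by simp
  have "partial_deriv i (\<lambda>\<theta>. v \<theta> $ a) \<theta> = mat_pd i (\<lambda>\<theta>. colmat (v \<theta>)) \<theta> $$ (a, 0)"
    by (rule partial_deriv_eqI[OF assms(1,2) e has_mat_pd[OF v assms(2) ab(1)]]) auto
  then show "colmat (vec_pd i v \<theta>) $$ (a, b) = mat_pd i (\<lambda>\<theta>. colmat (v \<theta>)) \<theta> $$ (a, b)"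
    using ab assms(3)[OF assms(2)] by (simp add: vec_pd_def)
qed (use assms(3)[OF assms(2)] in \<open>auto simp: vec_pd_def mat_pd_def\<close>)

lemma mat_diff_on_four_block:
  assumes "open \<Omega>" "mat_diff_on \<Omega> r1 c1 A" "mat_diff_on \<Omega> r1 c2 B" "mat_diff_on \<Omega> r2 c1 C" "mat_diff_on \<Omega> r2 c2 D"
  shows "mat_diff_on \<Omega> (r1 + r2) (c1 + c2) (\<lambda>\<theta>. four_block_mat (A \<theta>) (B \<theta>) (C \<theta>) (D \<theta>))"
    and "\<theta> \<in> \<Omega> \<Longrightarrow> mat_pd i (\<lambda>\<theta>. four_block_mat (A \<theta>) (B \<theta>) (C \<theta>) (D \<theta>)) \<theta>
      = four_block_mat (mat_pd i A \<theta>) (mat_pd i B \<theta>) (mat_pd i C \<theta>) (mat_pd i D \<theta>)"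
proof -
  note row1 = mat_diff_on_append_cols[OF assms(1-3)] and row2 = mat_diff_on_append_cols[OF assms(1,4,5)]
  note rows = mat_diff_on_append_rows[OF assms(1) row1 row2]
  have eq: "four_block_mat (A \<theta>) (B \<theta>) (C \<theta>) (D \<theta>) = (A \<theta> @\<^sub>c B \<theta>) @\<^sub>r (C \<theta> @\<^sub>c D \<theta>)" if "\<theta> \<in> \<Omega>" for \<theta>
    by (rule four_block_mat_append[OF assms(2-5)[THEN mat_diff_onD(1), OF that]])
  show "mat_diff_on \<Omega> (r1 + r2) (c1 + c2) (\<lambda>\<theta>. four_block_mat (A \<theta>) (B \<theta>) (C \<theta>) (D \<theta>))"
    by (rule mat_diff_on_cong[OF assms(1) rows eq])
  assume \<theta>: "\<theta> \<in> \<Omega>"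
  have "mat_pd i (\<lambda>\<theta>. four_block_mat (A \<theta>) (B \<theta>) (C \<theta>) (D \<theta>)) \<theta>
     = mat_pd i (\<lambda>\<theta>. (A \<theta> @\<^sub>c B \<theta>) @\<^sub>r (C \<theta> @\<^sub>c D \<theta>)) \<theta>"
    by (rule mat_pd_cong[OF assms(1) rows \<theta> eq])
  also have "\<dots> = (mat_pd i A \<theta> @\<^sub>c mat_pd i B \<theta>) @\<^sub>r (mat_pd i C \<theta> @\<^sub>c mat_pd i D \<theta>)"
    by (simp only: mat_pd_append_rows[OF assms(1) row1 row2 \<theta>]
      mat_pd_append_cols[OF assms(1-3) \<theta>] mat_pd_append_cols[OF assms(1,4,5) \<theta>])
  finally show "mat_pd i (\<lambda>\<theta>. four_block_mat (A \<theta>) (B \<theta>) (C \<theta>) (D \<theta>)) \<theta>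
      = four_block_mat (mat_pd i A \<theta>) (mat_pd i B \<theta>) (mat_pd i C \<theta>) (mat_pd i D \<theta>)"
    using four_block_mat_append[OF assms(2-5)[THEN mat_pd_carrier, OF \<theta>]] by simp
qed

text \<open>Entries below the diagonal vanish on all of \<Omega>, hence so do their derivatives.
  This is what makes J' J^{-1} triangular.\<close>

lemma upper_triangular_mat_pd:
  assumes "open \<Omega>" "mat_diff_on \<Omega> n n J" "\<theta> \<in> \<Omega>" "\<And>\<theta>. \<theta> \<in> \<Omega> \<Longrightarrow> upper_triangular (J \<theta>)"
  shows "upper_triangular (mat_pd i J \<theta>)"
proof (rule upper_triangularI)
  fix a b assume ab: "b < a" "a < dim_row (mat_pd i J \<theta>)"
  then have a: "a < n" using mat_pd_carrier[OF assms(2,3), of i] by auto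
  have "partial_deriv i (\<lambda>\<theta>. J \<theta> $$ (a, b)) \<theta> = 0"
    using upper_triangular_entry[OF mat_diff_onD(1)[OF assms(2)] assms(4) ab(1) a]
    by (intro partial_deriv_eqI[OF assms(1,3), of _ "\<lambda>_. 0"]) auto
  then show "mat_pd i J \<theta> $$ (a, b) = 0"
    using a ab mat_diff_onD(4,5)[OF assms(2,3)] by (simp add: mat_pd_def)
qed

text \<open>The rotation \<open>Ok\<close> belongs to the single point \<open>\<theta>\<close> and is never differentiated: only the Gram
  identities are, and these hold on all of \<open>\<Omega>\<close>.\<close>

lemma array_derivative:
  fixes M b J c :: "real ^ 'p::finite \<Rightarrow> real mat"
  assumes op: "open \<Omega>" and M: "mat_diff_on \<Omega> s r M" and b: "mat_diff_on \<Omega> s w b"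
    and J: "mat_diff_on \<Omega> r r J" and c: "mat_diff_on \<Omega> r w c"
    and utJ: "\<And>\<theta>. \<theta> \<in> \<Omega> \<Longrightarrow> upper_triangular (J \<theta>)"
    and gram: "\<And>\<theta>. \<theta> \<in> \<Omega> \<Longrightarrow> transpose_mat (J \<theta>) * J \<theta> = transpose_mat (M \<theta>) * M \<theta>"
    and rhs: "\<And>\<theta>. \<theta> \<in> \<Omega> \<Longrightarrow> transpose_mat (J \<theta>) * c \<theta> = transpose_mat (M \<theta>) * b \<theta>"
    and \<theta>: "\<theta> \<in> \<Omega>" and d: "Determinant.det (J \<theta>) \<noteq> 0"
    and Ok: "Ok \<in> carrier_mat s s" "orth_mat Ok"
    and A1: "A1 \<in> carrier_mat r r" and A2: "A2 \<in> carrier_mat q r"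
    and \<mu>: "\<mu> \<in> carrier_mat r w" and \<gamma>: "\<gamma> \<in> carrier_mat q w" and \<tau>: "\<tau> \<in> carrier_mat q w"
    and eqs: "Ok * M \<theta> = J \<theta> @\<^sub>r 0\<^sub>m q r" "Ok * mat_pd i M \<theta> = A1 @\<^sub>r A2"
      "Ok * b \<theta> = c \<theta> @\<^sub>r \<gamma>" "Ok * mat_pd i b \<theta> = \<mu> @\<^sub>r \<tau>"
  defines "A \<equiv> A1 * minv (J \<theta>)"
  shows "mat_pd i J \<theta> = (transpose_mat (str_lower A) + diag_part A + str_upper A) * J \<theta>"
    and "mat_pd i c \<theta> = (transpose_mat (str_lower A) - str_lower A) * c \<theta>
      + transpose_mat (minv (J \<theta>)) * (transpose_mat A2 * \<gamma>) + \<mu>"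
proof -
  note Mc = mat_diff_onD(1)[OF M \<theta>] mat_pd_carrier[OF M \<theta>, of i]
    and bc = mat_diff_onD(1)[OF b \<theta>] mat_pd_carrier[OF b \<theta>, of i]
    and Jc = mat_diff_onD(1)[OF J \<theta>] mat_pd_carrier[OF J \<theta>, of i]
    and cc = mat_diff_onD(1)[OF c \<theta>] mat_pd_carrier[OF c \<theta>, of i]
  have product_rule: "mat_pd i (\<lambda>\<theta>. transpose_mat (X \<theta>) * Y \<theta>) \<theta>
      = transpose_mat (mat_pd i X \<theta>) * Y \<theta> + transpose_mat (X \<theta>) * mat_pd i Y \<theta>"
    if X: "mat_diff_on \<Omega> k l X" and Y: "mat_diff_on \<Omega> k l' Y" for X Y k l l'
    using mat_pd_mult[OF op mat_diff_on_transpose[OF op X] Y \<theta>] mat_pd_transpose[OF op X \<theta>] by simp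
  have "transpose_mat (mat_pd i J \<theta>) * J \<theta> + transpose_mat (J \<theta>) * mat_pd i J \<theta>
      = transpose_mat (mat_pd i M \<theta>) * M \<theta> + transpose_mat (M \<theta>) * mat_pd i M \<theta>"
    using mat_pd_cong[OF op mat_diff_on_mult[OF op mat_diff_on_transpose[OF op M] M] \<theta> gram, of i]
    by (simp add: product_rule[OF J J] product_rule[OF M M])
  \<comment> \<open>Insert \<open>Ok\<close> into both products. The bottom block \<open>A2\<close>
    meets the zero block of \<open>Ok * M \<theta>\<close> and drops out.\<close>
  also have "\<dots> = transpose_mat A1 * J \<theta> + transpose_mat (J \<theta>) * A1"
    using orth_mat_gram[OF Ok Mc(2,1)] orth_mat_gram[OF Ok Mc(1,2)] A1 A2 Jc
      transpose_append_rows_mult[OF A1 A2 Jc(1), of "0\<^sub>m q r"]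
      transpose_append_rows_mult[OF Jc(1) _ A1 A2, of "0\<^sub>m q r"]
    by (simp add: eqs)
  finally have gram': "transpose_mat (mat_pd i J \<theta>) * J \<theta> + transpose_mat (J \<theta>) * mat_pd i J \<theta>
      = transpose_mat A1 * J \<theta> + transpose_mat (J \<theta>) * A1" .
  note fact = triangular_factor_derivative[OF Jc(1) utJ[OF \<theta>] d Jc(2) upper_triangular_mat_pd[OF op J \<theta> utJ] A1 gram']
  show "mat_pd i J \<theta> = (transpose_mat (str_lower A) + diag_part A + str_upper A) * J \<theta>"
    unfolding A_def by (rule fact(1))
  have "transpose_mat (mat_pd i J \<theta>) * c \<theta> + transpose_mat (J \<theta>) * mat_pd i c \<theta>
      = transpose_mat (mat_pd i M \<theta>) * b \<theta> + transpose_mat (M \<theta>) * mat_pd i b \<theta>"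
    using mat_pd_cong[OF op mat_diff_on_mult[OF op mat_diff_on_transpose[OF op M] b] \<theta> rhs, of i]
    by (simp add: product_rule[OF J c] product_rule[OF M b])
  \<comment> \<open>Now \<open>A2\<close> meets \<gamma> and survives, whereas \<tau> meets the zero
    block of \<open>Ok * M \<theta>\<close>.\<close>
  also have "\<dots> = (transpose_mat A1 * c \<theta> + transpose_mat A2 * \<gamma>) + transpose_mat (J \<theta>) * \<mu>"
    using orth_mat_gram[OF Ok Mc(2) bc(1)] orth_mat_gram[OF Ok Mc(1) bc(2)] A1 A2 Jc \<mu> \<tau>
      transpose_append_rows_mult[OF A1 A2 cc(1) \<gamma>]
      transpose_append_rows_mult[OF Jc(1) _ \<mu> \<tau>, of "0\<^sub>m q r"]
    by (simp add: eqs)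
  finally have eq: "transpose_mat (mat_pd i J \<theta>) * c \<theta> + transpose_mat (J \<theta>) * mat_pd i c \<theta>
      = (transpose_mat A1 * c \<theta> + transpose_mat A2 * \<gamma>) + transpose_mat (J \<theta>) * \<mu>" .
  have A: "A \<in> carrier_mat r r" using A1 minv_carrier[OF Jc(1) d] by (simp add: A_def)
  then have "transpose_mat (str_lower A) - str_lower A \<in> carrier_mat r r"
    by (auto simp: str_lower_def)
  from triangular_system_derivative[OF Jc(1) d Jc(2) A1 A2 cc \<mu> \<gamma> this _ eq] fact(2)
  show "mat_pd i c \<theta> = (transpose_mat (str_lower A) - str_lower A) * c \<theta>
      + transpose_mat (minv (J \<theta>)) * (transpose_mat A2 * \<gamma>) + \<mu>"
    by (simp add: A_def)
qed

section \<open>The filter\<close>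

text \<open>The standing hypotheses of the theorem. Indices of P_k run to \<open>Suc N\<close>
  because the last step, k = N, still outputs P_{N+1}^{1/2}. The root of Q_k is a given function
  \<open>Qh\<close>, since for singular Q_k the covariance and the signs do not determine
  it.\<close>

locale kalman_system =
  fixes S :: "(real ^ 'p::finite) system" and \<Omega> :: "(real ^ 'p) set"
    and n m q N :: nat
    and Qh :: "nat \<Rightarrow> real ^ 'p \<Rightarrow> real mat"
    and \<sigma>R \<sigma>Q \<sigma>P \<sigma>E :: "nat \<Rightarrow> nat \<Rightarrow> real"
  assumes dom: "open \<Omega>"
    and dims: "\<And>k \<theta>. k \<in> {1..N} \<Longrightarrow> \<theta> \<in> \<Omega> \<Longrightarrow>
        sF S k \<theta> \<in> carrier_mat n n \<and> sG S k \<theta> \<in> carrier_mat n q \<and> sH S k \<theta> \<in> carrier_mat m n \<and>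
        sQ S k \<theta> \<in> carrier_mat q q \<and> sR S k \<theta> \<in> carrier_mat m m"
    and dims0: "\<And>\<theta>. \<theta> \<in> \<Omega> \<Longrightarrow> sPi0 S \<theta> \<in> carrier_mat n n \<and> sx0 S \<theta> \<in> carrier_vec n"
    and dimz: "\<And>k. k \<in> {1..N} \<Longrightarrow> sz S k \<in> carrier_vec m"
    and diff: "\<And>k \<theta>. k \<in> {1..N} \<Longrightarrow> \<theta> \<in> \<Omega> \<Longrightarrow>
        mat_diff (sF S k) \<theta> \<and> mat_diff (sG S k) \<theta> \<and> mat_diff (sH S k) \<theta> \<and>
        mat_diff (sQ S k) \<theta> \<and> mat_diff (sR S k) \<theta>"
    and diff0: "\<And>\<theta>. \<theta> \<in> \<Omega> \<Longrightarrow> mat_diff (sPi0 S) \<theta> \<and> vec_diff (sx0 S) \<theta>"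
    and signs: "\<And>k j. {\<sigma>R k j, \<sigma>Q k j, \<sigma>P k j, \<sigma>E k j} \<subseteq> {1, -1}"
    and R_pos: "\<And>k \<theta>. k \<in> {1..N} \<Longrightarrow> \<theta> \<in> \<Omega> \<Longrightarrow> pos_def (sR S k \<theta>)"
    and P_pos: "\<And>k \<theta>. k \<in> {1..Suc N} \<Longrightarrow> \<theta> \<in> \<Omega> \<Longrightarrow> pos_def (kf_P S k \<theta>)"
    and Q_root: "\<And>k \<theta>. k \<in> {1..N} \<Longrightarrow> \<theta> \<in> \<Omega> \<Longrightarrow> chol_factor (\<sigma>Q k) (sQ S k \<theta>) (Qh k \<theta>)"
    and Q_diff: "\<And>k \<theta>. k \<in> {1..N} \<Longrightarrow> \<theta> \<in> \<Omega> \<Longrightarrow> \<not> pos_def (sQ S k \<theta>) \<Longrightarrow>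
        mat_diff (\<lambda>\<theta>'. Qh k \<theta>' * transpose_mat (sG S k \<theta>')) \<theta>"
begin

section \<open>The Kalman recursion as a function of the parameter\<close>

lemma sign_cases: "\<sigma>R k j \<in> {1, -1}" "\<sigma>Q k j \<in> {1, -1}" "\<sigma>P k j \<in> {1, -1}" "\<sigma>E k j \<in> {1, -1}"
  using signs[of k j] by auto

lemma system_diff:
  assumes "k \<in> {1..N}"
  shows "mat_diff_on \<Omega> n n (sF S k)" "mat_diff_on \<Omega> n q (sG S k)" "mat_diff_on \<Omega> m n (sH S k)"
    "mat_diff_on \<Omega> q q (sQ S k)" "mat_diff_on \<Omega> m m (sR S k)"
  using dims[OF assms] diff[OF assms] by (simp_all add: mat_diff_on_def)

text \<open>F_k P_k H_k^T, the part common to both gains: times R_{e,k}^{-1} it is the Kalman gain,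
  times R_{e,k}^{-1/2} the normalized gain. Its transpose is the off-diagonal block of the Gram
  matrix of the array.\<close>

definition cross :: "nat \<Rightarrow> real ^ 'p \<Rightarrow> real mat" where
  "cross k \<theta> = sF S k \<theta> * kf_P S k \<theta> * transpose_mat (sH S k \<theta>)"

lemma kf_P_Suc:
  "1 \<le> k \<Longrightarrow> kf_P S (Suc k) \<theta> = sF S k \<theta> * kf_P S k \<theta> * transpose_mat (sF S k \<theta>)
     + sG S k \<theta> * sQ S k \<theta> * transpose_mat (sG S k \<theta>)
     - cross k \<theta> * minv (innov_cov S k \<theta>) * innov_cov S k \<theta> * transpose_mat (cross k \<theta> * minv (innov_cov S k \<theta>))"
  by (simp add: Let_def cross_def innov_cov_def)

lemma kf_x_Suc:
  "1 \<le> k \<Longrightarrow> kf_x S (Suc k) \<theta> = sF S k \<theta> *\<^sub>v kf_x S k \<theta>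
     + (cross k \<theta> * minv (innov_cov S k \<theta>)) *\<^sub>v innov S k \<theta>"
  by (simp add: Let_def cross_def innov_def)

lemma innov_cov_pos_def:
  assumes "k \<in> {1..N}" "\<theta> \<in> \<Omega>" "kf_P S k \<theta> \<in> carrier_mat n n"
  shows "pos_def (innov_cov S k \<theta>)"
  unfolding innov_cov_def using assms dims[OF assms(1,2)] P_pos[of k \<theta>] R_pos[OF assms(1,2)]
  by (intro pos_def_congruence_plus[of _ n _ m]) auto

lemma innov_cov_diff:
  assumes "k \<in> {1..N}" "mat_diff_on \<Omega> n n (kf_P S k)"
  shows "mat_diff_on \<Omega> m m (innov_cov S k)"
  unfolding innov_cov_def
  by (rule dom assms(2) system_diff[OF assms(1)] mat_diff_on_add mat_diff_on_mult mat_diff_on_transpose)+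

lemma minv_innov_cov_diff:
  assumes "k \<in> {1..N}" "mat_diff_on \<Omega> n n (kf_P S k)"
  shows "mat_diff_on \<Omega> m m (\<lambda>\<theta>. minv (innov_cov S k \<theta>))"
proof (rule mat_diff_on_minv[OF dom innov_cov_diff[OF assms]])
  show "Determinant.det (innov_cov S k \<theta>) \<noteq> 0" if "\<theta> \<in> \<Omega>" for \<theta>
    by (rule det_pos_def_nonzero[OF innov_cov_pos_def mat_diff_onD(1)[OF innov_cov_diff]])
      (rule assms that mat_diff_onD(1))+
qed

lemma cross_diff:
  assumes "k \<in> {1..N}" "mat_diff_on \<Omega> n n (kf_P S k)"
  shows "mat_diff_on \<Omega> n m (cross k)"
  unfolding cross_def
  by (rule dom assms(2) system_diff[OF assms(1)] mat_diff_on_mult mat_diff_on_transpose)+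

text \<open>Sums, products and inverses of differentiable matrices stay differentiable, the
  innovation covariance being invertible because it is positive definite. Covariance and estimate go
  through one induction, as the recursion for the estimate uses the gain built from the
  covariance.\<close>

lemma kf_diff:
  assumes "k \<in> {1..Suc N}"
  shows "mat_diff_on \<Omega> n n (kf_P S k) \<and> (\<forall>\<theta>\<in>\<Omega>. kf_x S k \<theta> \<in> carrier_vec n) \<and>
    mat_diff_on \<Omega> n 1 (\<lambda>\<theta>. colmat (kf_x S k \<theta>))"
  using assms
proof (induction k)
  case (Suc k)
  show ?case
  proof (cases "k = 0")
    \<comment> \<open>Here the index is 1, where the filter starts from the data of the initial
      state; this is the actual base case.\<close>
    case True
    have "mat_diff_on \<Omega> n 1 (\<lambda>\<theta>. colmat (sx0 S \<theta>))"
      using dims0 diff0 vec_diff_iff_colmat[OF dom, of _ "sx0 S" n]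
      by (auto simp: mat_diff_on_def intro!: colmat_carrier)
    moreover have "mat_diff_on \<Omega> n n (sPi0 S)" using dims0 diff0 by (simp add: mat_diff_on_def)
    moreover have "kf_P S (Suc k) = sPi0 S" "kf_x S (Suc k) = sx0 S" using True by (auto intro!: ext)
    ultimately show ?thesis using dims0 by simp
  next
    case False
    then have k: "k \<in> {1..N}" using Suc.prems by auto
    have P: "mat_diff_on \<Omega> n n (kf_P S k)" and x: "\<And>\<theta>. \<theta> \<in> \<Omega> \<Longrightarrow> kf_x S k \<theta> \<in> carrier_vec n"
      and xd: "mat_diff_on \<Omega> n 1 (\<lambda>\<theta>. colmat (kf_x S k \<theta>))"
      using Suc k by auto
    note parts = dom system_diff[OF k] P cross_diff[OF k P] innov_cov_diff[OF k P]
      minv_innov_cov_diff[OF k P]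
    have "mat_diff_on \<Omega> n n (\<lambda>\<theta>. sF S k \<theta> * kf_P S k \<theta> * transpose_mat (sF S k \<theta>)
     + sG S k \<theta> * sQ S k \<theta> * transpose_mat (sG S k \<theta>)
     - cross k \<theta> * minv (innov_cov S k \<theta>) * innov_cov S k \<theta> * transpose_mat (cross k \<theta> * minv (innov_cov S k \<theta>)))"
      by (rule parts mat_diff_on_minus mat_diff_on_add mat_diff_on_mult mat_diff_on_transpose)+
    then have 1: "mat_diff_on \<Omega> n n (kf_P S (Suc k))"
      by (rule mat_diff_on_cong[OF dom]) (use k kf_P_Suc in auto)
    have z: "mat_diff_on \<Omega> m 1 (\<lambda>_. colmat (sz S k))"
      by (rule mat_diff_on_const[OF colmat_carrier[OF dimz[OF k]]])
    have xn: "kf_x S (Suc k) \<theta> \<in> carrier_vec n" if "\<theta> \<in> \<Omega>" for \<theta>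
      unfolding kf_x_Suc[OF conjunct1[OF k[unfolded atLeastAtMost_iff]]]
      using dims[OF k that] x[OF that] dimz[OF k] mat_diff_onD(1)[OF cross_diff[OF k P] that]
        mat_diff_onD(1)[OF minv_innov_cov_diff[OF k P] that] by (auto simp: innov_def)
    have "colmat (kf_x S (Suc k) \<theta>) = sF S k \<theta> * colmat (kf_x S k \<theta>)
      + cross k \<theta> * minv (innov_cov S k \<theta>) * (colmat (sz S k) - sH S k \<theta> * colmat (kf_x S k \<theta>))" if "\<theta> \<in> \<Omega>" for \<theta>
      unfolding kf_x_Suc[OF conjunct1[OF k[unfolded atLeastAtMost_iff]]]
      using dims[OF k that] x[OF that] dimz[OF k] mat_diff_onD(1)[OF cross_diff[OF k P] that]
        mat_diff_onD(1)[OF minv_innov_cov_diff[OF k P] that]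
      by (auto simp: colmat_add colmat_mult_vec innov_def colmat_minus)
    then have "mat_diff_on \<Omega> n 1 (\<lambda>\<theta>. colmat (kf_x S (Suc k) \<theta>))"
      by (intro mat_diff_on_cong[OF dom mat_diff_on_add[OF dom mat_diff_on_mult[OF dom system_diff(1)[OF k] xd]
        mat_diff_on_mult[OF dom mat_diff_on_mult[OF dom cross_diff[OF k P] minv_innov_cov_diff[OF k P]]
          mat_diff_on_minus[OF dom z mat_diff_on_mult[OF dom system_diff(3)[OF k] xd]]]]])
    then show ?thesis using 1 xn by blast
  qed
qed simp

lemma kf_P_diff: "k \<in> {1..Suc N} \<Longrightarrow> mat_diff_on \<Omega> n n (kf_P S k)"
  and kf_x_carrier: "k \<in> {1..Suc N} \<Longrightarrow> \<theta> \<in> \<Omega> \<Longrightarrow> kf_x S k \<theta> \<in> carrier_vec n"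
  and kf_x_diff: "k \<in> {1..Suc N} \<Longrightarrow> mat_diff_on \<Omega> n 1 (\<lambda>\<theta>. colmat (kf_x S k \<theta>))"
  using kf_diff by auto

lemma innov_cov_on:
  assumes "k \<in> {1..N}"
  shows "mat_diff_on \<Omega> m m (innov_cov S k)" "\<theta> \<in> \<Omega> \<Longrightarrow> pos_def (innov_cov S k \<theta>)"
  using innov_cov_diff[OF assms kf_P_diff] innov_cov_pos_def[OF assms _ mat_diff_onD(1)[OF kf_P_diff]] assms by auto

section \<open>Square roots of the covariances\<close>

lemma sqrtR_factor: "k \<in> {1..N} \<Longrightarrow> \<theta> \<in> \<Omega> \<Longrightarrow> chol_factor (\<sigma>R k) (sR S k \<theta>) (sqrtR \<sigma>R S k \<theta>)"
  unfolding sqrtR_def using dims R_pos by (intro chol_factor_chol[of _ m] sign_cases) auto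

lemma sqrtRe_factor: "k \<in> {1..N} \<Longrightarrow> \<theta> \<in> \<Omega> \<Longrightarrow> chol_factor (\<sigma>E k) (innov_cov S k \<theta>) (sqrtRe \<sigma>E S k \<theta>)"
  unfolding sqrtRe_def by (rule chol_factor_chol[OF mat_diff_onD(1)[OF innov_cov_on(1)] innov_cov_on(2) sign_cases(4)])

lemma sqrtP_factor: "k \<in> {1..Suc N} \<Longrightarrow> \<theta> \<in> \<Omega> \<Longrightarrow> chol_factor (\<sigma>P k) (kf_P S k \<theta>) (sqrtP \<sigma>P S k \<theta>)"
  unfolding sqrtP_def by (rule chol_factor_chol[OF mat_diff_onD(1)[OF kf_P_diff] P_pos sign_cases(3)])

lemma sqrtR_props:
  assumes "k \<in> {1..N}" "\<theta> \<in> \<Omega>"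
  shows "sqrtR \<sigma>R S k \<theta> \<in> carrier_mat m m" "Determinant.det (sqrtR \<sigma>R S k \<theta>) \<noteq> 0"
    "transpose_mat (sqrtR \<sigma>R S k \<theta>) * sqrtR \<sigma>R S k \<theta> = sR S k \<theta>"
  using chol_factorD[OF sqrtR_factor[OF assms]] chol_factor_det_nonzero[OF sqrtR_factor[OF assms]]
    dims[OF assms] R_pos[OF assms] by auto

lemma sqrtRe_props:
  assumes "k \<in> {1..N}" "\<theta> \<in> \<Omega>"
  shows "sqrtRe \<sigma>E S k \<theta> \<in> carrier_mat m m" "Determinant.det (sqrtRe \<sigma>E S k \<theta>) \<noteq> 0"
    "transpose_mat (sqrtRe \<sigma>E S k \<theta>) * sqrtRe \<sigma>E S k \<theta> = innov_cov S k \<theta>"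
    "upper_triangular (sqrtRe \<sigma>E S k \<theta>)"
proof -
  note Re = mat_diff_onD(1)[OF innov_cov_on(1)[OF assms(1)] assms(2)]
  show "sqrtRe \<sigma>E S k \<theta> \<in> carrier_mat m m" "transpose_mat (sqrtRe \<sigma>E S k \<theta>) * sqrtRe \<sigma>E S k \<theta> = innov_cov S k \<theta>"
    "upper_triangular (sqrtRe \<sigma>E S k \<theta>)"
    by (rule chol_factorD[OF sqrtRe_factor[OF assms] Re])+
  show "Determinant.det (sqrtRe \<sigma>E S k \<theta>) \<noteq> 0"
    by (rule chol_factor_det_nonzero[OF sqrtRe_factor[OF assms] Re innov_cov_on(2)[OF assms]])
qed

lemma sqrtP_props:
  assumes "k \<in> {1..Suc N}" "\<theta> \<in> \<Omega>"
  shows "sqrtP \<sigma>P S k \<theta> \<in> carrier_mat n n" "Determinant.det (sqrtP \<sigma>P S k \<theta>) \<noteq> 0"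
    "transpose_mat (sqrtP \<sigma>P S k \<theta>) * sqrtP \<sigma>P S k \<theta> = kf_P S k \<theta>"
    "upper_triangular (sqrtP \<sigma>P S k \<theta>)"
  using chol_factorD[OF sqrtP_factor[OF assms]] chol_factor_det_nonzero[OF sqrtP_factor[OF assms]]
    mat_diff_onD(1)[OF kf_P_diff[OF assms(1)] assms(2)] P_pos[OF assms] by auto

lemma Qh_props:
  assumes "k \<in> {1..N}" "\<theta> \<in> \<Omega>"
  shows "Qh k \<theta> \<in> carrier_mat q q" "transpose_mat (Qh k \<theta>) * Qh k \<theta> = sQ S k \<theta>"
  using chol_factorD[OF Q_root[OF assms]] dims[OF assms] by auto

lemma sqrt_diff:
  shows sqrtR_diff: "k \<in> {1..N} \<Longrightarrow> mat_diff_on \<Omega> m m (sqrtR \<sigma>R S k)"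
    and sqrtRe_diff: "k \<in> {1..N} \<Longrightarrow> mat_diff_on \<Omega> m m (sqrtRe \<sigma>E S k)"
    and sqrtP_diff: "k \<in> {1..Suc N} \<Longrightarrow> mat_diff_on \<Omega> n n (sqrtP \<sigma>P S k)"
proof -
  show "mat_diff_on \<Omega> m m (sqrtR \<sigma>R S k)" if k: "k \<in> {1..N}"
    unfolding sqrtR_def by (rule mat_diff_on_chol[OF dom system_diff(5)[OF k] R_pos[OF k] sign_cases(1)])
  show "mat_diff_on \<Omega> m m (sqrtRe \<sigma>E S k)" if k: "k \<in> {1..N}"
    unfolding sqrtRe_def by (rule mat_diff_on_chol[OF dom innov_cov_on[OF k] sign_cases(4)])
  show "mat_diff_on \<Omega> n n (sqrtP \<sigma>P S k)" if k: "k \<in> {1..Suc N}"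
    unfolding sqrtP_def by (rule mat_diff_on_chol[OF dom kf_P_diff[OF k] P_pos[OF k] sign_cases(3)])
qed

text \<open>Whether Q_k is positive definite may change from one parameter to another, so the two
  cases are separated at each point. Where it is, the Cholesky recursion applies to
  \<open>Qh k\<close>; elsewhere the product with G_k^T is differentiable by hypothesis.\<close>

lemma Qh_diff:
  assumes k: "k \<in> {1..N}"
  shows "mat_diff_on \<Omega> q n (\<lambda>\<theta>. Qh k \<theta> * transpose_mat (sG S k \<theta>))"
  unfolding mat_diff_on_def
proof (intro ballI conjI)
  fix \<theta> assume \<theta>: "\<theta> \<in> \<Omega>"
  note G = mat_diff_on_transpose[OF dom system_diff(2)[OF k]]
  show "Qh k \<theta> * transpose_mat (sG S k \<theta>) \<in> carrier_mat q n"
    using Qh_props(1)[OF k \<theta>] mat_diff_onD(1)[OF G \<theta>] by auto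
  show "mat_diff (\<lambda>\<theta>. Qh k \<theta> * transpose_mat (sG S k \<theta>)) \<theta>"
  proof (cases "pos_def (sQ S k \<theta>)")
    case True
    have "mat_diff (Qh k) \<theta>"
      by (rule mat_diff_chol_factor[OF dom mat_diff_onD(1)[OF system_diff(4)[OF k]] Q_root[OF k] \<theta>
            mat_diff_onD(2)[OF system_diff(4)[OF k] \<theta>] True sign_cases(2)])
    from mat_diff_mult[OF dom Qh_props(1)[OF k] mat_diff_onD(1)[OF G] \<theta> this mat_diff_onD(2)[OF G \<theta>]]
    show ?thesis .
  qed (use Q_diff[OF k \<theta>] in blast)
qed

section \<open>Normalized gain, measurement, state and innovation\<close>

lemma gain_bar_eq: "gain_bar \<sigma>E S k \<theta> = cross k \<theta> * minv (sqrtRe \<sigma>E S k \<theta>)"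
  by (simp add: gain_bar_def cross_def)

lemma cross_on: "k \<in> {1..N} \<Longrightarrow> mat_diff_on \<Omega> n m (cross k)"
  using cross_diff kf_P_diff by auto

lemma gain_bar_diff:
  assumes "k \<in> {1..N}"
  shows "mat_diff_on \<Omega> n m (gain_bar \<sigma>E S k)"
  using mat_diff_on_mult[OF dom cross_on[OF assms] mat_diff_on_minv[OF dom sqrtRe_diff[OF assms] sqrtRe_props(2)[OF assms]]]
  unfolding gain_bar_eq[symmetric] .

lemma bar_carrier:
  shows meas_bar_carrier: "k \<in> {1..N} \<Longrightarrow> \<theta> \<in> \<Omega> \<Longrightarrow> meas_bar \<sigma>R S k \<theta> \<in> carrier_vec m"
    and state_bar_carrier: "k \<in> {1..Suc N} \<Longrightarrow> \<theta> \<in> \<Omega> \<Longrightarrow> state_bar \<sigma>P S k \<theta> \<in> carrier_vec n"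
    and innov_carrier: "k \<in> {1..N} \<Longrightarrow> \<theta> \<in> \<Omega> \<Longrightarrow> innov S k \<theta> \<in> carrier_vec m"
    and innov_bar_carrier: "k \<in> {1..N} \<Longrightarrow> \<theta> \<in> \<Omega> \<Longrightarrow> innov_bar \<sigma>E S k \<theta> \<in> carrier_vec m"
proof -
  show "meas_bar \<sigma>R S k \<theta> \<in> carrier_vec m" if "k \<in> {1..N}" "\<theta> \<in> \<Omega>"
    unfolding meas_bar_def using minv_carrier[OF sqrtR_props(1,2)[OF that]] dimz[OF that(1)]
    by (metis mult_mat_vec_carrier transpose_carrier_mat)
  show "state_bar \<sigma>P S k \<theta> \<in> carrier_vec n" if "k \<in> {1..Suc N}" "\<theta> \<in> \<Omega>"
    unfolding state_bar_def using minv_carrier[OF sqrtP_props(1,2)[OF that]] kf_x_carrier[OF that]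
    by (metis mult_mat_vec_carrier transpose_carrier_mat)
  show *: "innov S k \<theta> \<in> carrier_vec m" if "k \<in> {1..N}" "\<theta> \<in> \<Omega>"
    unfolding innov_def using dims[OF that] kf_x_carrier[of k \<theta>] dimz[OF that(1)] that by auto
  show "innov_bar \<sigma>E S k \<theta> \<in> carrier_vec m" if "k \<in> {1..N}" "\<theta> \<in> \<Omega>"
    unfolding innov_bar_def using minv_carrier[OF sqrtRe_props(1,2)[OF that]] *[OF that]
    by (metis mult_mat_vec_carrier transpose_carrier_mat)
qed

lemma colmat_bar:
  shows colmat_meas_bar: "k \<in> {1..N} \<Longrightarrow> \<theta> \<in> \<Omega> \<Longrightarrow>
      colmat (meas_bar \<sigma>R S k \<theta>) = transpose_mat (minv (sqrtR \<sigma>R S k \<theta>)) * colmat (sz S k)"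
    and colmat_state_bar: "k \<in> {1..Suc N} \<Longrightarrow> \<theta> \<in> \<Omega> \<Longrightarrow>
      colmat (state_bar \<sigma>P S k \<theta>) = transpose_mat (minv (sqrtP \<sigma>P S k \<theta>)) * colmat (kf_x S k \<theta>)"
    and colmat_innov: "k \<in> {1..N} \<Longrightarrow> \<theta> \<in> \<Omega> \<Longrightarrow>
      colmat (innov S k \<theta>) = colmat (sz S k) - sH S k \<theta> * colmat (kf_x S k \<theta>)"
    and colmat_innov_bar: "k \<in> {1..N} \<Longrightarrow> \<theta> \<in> \<Omega> \<Longrightarrow>
      colmat (innov_bar \<sigma>E S k \<theta>) = transpose_mat (minv (sqrtRe \<sigma>E S k \<theta>)) * colmat (innov S k \<theta>)"
proof -
  show "colmat (meas_bar \<sigma>R S k \<theta>) = transpose_mat (minv (sqrtR \<sigma>R S k \<theta>)) * colmat (sz S k)"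
    if "k \<in> {1..N}" "\<theta> \<in> \<Omega>"
    unfolding meas_bar_def using minv_carrier[OF sqrtR_props(1,2)[OF that]] dimz[OF that(1)]
    by (intro colmat_mult_vec) auto
  show "colmat (state_bar \<sigma>P S k \<theta>) = transpose_mat (minv (sqrtP \<sigma>P S k \<theta>)) * colmat (kf_x S k \<theta>)"
    if "k \<in> {1..Suc N}" "\<theta> \<in> \<Omega>"
    unfolding state_bar_def using minv_carrier[OF sqrtP_props(1,2)[OF that]] kf_x_carrier[OF that]
    by (intro colmat_mult_vec) auto
  show "colmat (innov S k \<theta>) = colmat (sz S k) - sH S k \<theta> * colmat (kf_x S k \<theta>)"
    if "k \<in> {1..N}" "\<theta> \<in> \<Omega>"
    unfolding innov_def using dims[OF that] kf_x_carrier[of k \<theta>] dimz[OF that(1)] that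
    by (auto simp: colmat_minus colmat_mult_vec)
  show "colmat (innov_bar \<sigma>E S k \<theta>) = transpose_mat (minv (sqrtRe \<sigma>E S k \<theta>)) * colmat (innov S k \<theta>)"
    if "k \<in> {1..N}" "\<theta> \<in> \<Omega>"
    unfolding innov_bar_def using minv_carrier[OF sqrtRe_props(1,2)[OF that]] innov_carrier[OF that]
    by (intro colmat_mult_vec) auto
qed

lemma bar_diff:
  shows meas_bar_diff: "k \<in> {1..N} \<Longrightarrow> mat_diff_on \<Omega> m 1 (\<lambda>\<theta>. colmat (meas_bar \<sigma>R S k \<theta>))"
    and state_bar_diff: "k \<in> {1..Suc N} \<Longrightarrow> mat_diff_on \<Omega> n 1 (\<lambda>\<theta>. colmat (state_bar \<sigma>P S k \<theta>))"
    and innov_bar_diff: "k \<in> {1..N} \<Longrightarrow> mat_diff_on \<Omega> m 1 (\<lambda>\<theta>. colmat (innov_bar \<sigma>E S k \<theta>))"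
proof -
  have inv: "mat_diff_on \<Omega> r r (\<lambda>\<theta>. transpose_mat (minv (A \<theta>)))"
    if "mat_diff_on \<Omega> r r A" "\<And>\<theta>. \<theta> \<in> \<Omega> \<Longrightarrow> Determinant.det (A \<theta>) \<noteq> 0" for A r
    using that by (intro mat_diff_on_transpose mat_diff_on_minv dom)
  have z: "mat_diff_on \<Omega> m 1 (\<lambda>_. colmat (sz S k))" if "k \<in> {1..N}"
    by (rule mat_diff_on_const[OF colmat_carrier[OF dimz[OF that]]])
  show "mat_diff_on \<Omega> m 1 (\<lambda>\<theta>. colmat (meas_bar \<sigma>R S k \<theta>))" if k: "k \<in> {1..N}"
    by (rule mat_diff_on_cong[OF dom mat_diff_on_mult[OF dom inv[OF sqrtR_diff[OF k] sqrtR_props(2)[OF k]] z[OF k]]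
        colmat_meas_bar[OF k]])
  show "mat_diff_on \<Omega> n 1 (\<lambda>\<theta>. colmat (state_bar \<sigma>P S k \<theta>))" if k: "k \<in> {1..Suc N}"
    by (rule mat_diff_on_cong[OF dom mat_diff_on_mult[OF dom inv[OF sqrtP_diff[OF k] sqrtP_props(2)[OF k]] kf_x_diff[OF k]]
        colmat_state_bar[OF k]])
  show "mat_diff_on \<Omega> m 1 (\<lambda>\<theta>. colmat (innov_bar \<sigma>E S k \<theta>))" if k: "k \<in> {1..N}"
  proof -
    have "mat_diff_on \<Omega> n 1 (\<lambda>\<theta>. colmat (kf_x S k \<theta>))" using kf_x_diff k by auto
    from mat_diff_on_minus[OF dom z[OF k] mat_diff_on_mult[OF dom system_diff(3)[OF k] this]]
    have "mat_diff_on \<Omega> m 1 (\<lambda>\<theta>. colmat (innov S k \<theta>))"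
      by (rule mat_diff_on_cong[OF dom _ colmat_innov[OF k]])
    from mat_diff_on_mult[OF dom inv[OF sqrtRe_diff[OF k] sqrtRe_props(2)[OF k]] this]
    show ?thesis by (rule mat_diff_on_cong[OF dom _ colmat_innov_bar[OF k]])
  qed
qed

text \<open>\<open>pre1\<close>, \<open>pre2\<close>, \<open>pre3\<close> are the block columns of the pre-array; \<open>post\<close> and \<open>post3\<close> below are
  the blocks \<open>J\<close> and \<open>c\<close> of the post-array.\<close>

definition pre1 :: "nat \<Rightarrow> real ^ 'p \<Rightarrow> real mat" where
  "pre1 k \<theta> = sqrtR \<sigma>R S k \<theta> @\<^sub>r sqrtP \<sigma>P S k \<theta> * transpose_mat (sH S k \<theta>) @\<^sub>r 0\<^sub>m q m"

definition pre2 :: "nat \<Rightarrow> real ^ 'p \<Rightarrow> real mat" where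
  "pre2 k \<theta> = 0\<^sub>m m n @\<^sub>r sqrtP \<sigma>P S k \<theta> * transpose_mat (sF S k \<theta>) @\<^sub>r Qh k \<theta> * transpose_mat (sG S k \<theta>)"

definition pre3 :: "nat \<Rightarrow> real ^ 'p \<Rightarrow> real mat" where
  "pre3 k \<theta> = colmat (- meas_bar \<sigma>R S k \<theta>) @\<^sub>r colmat (state_bar \<sigma>P S k \<theta>) @\<^sub>r 0\<^sub>m q 1"

text \<open>In inner products of block columns every root meets its own transpose or its own
  inverse, so that only quantities of the ordinary Kalman filter remain. These five values are one
  side of the Gram identities.\<close>

lemma pre_gram:
  assumes k: "k \<in> {1..N}" and \<theta>: "\<theta> \<in> \<Omega>"
  shows "transpose_mat (pre1 k \<theta>) * pre1 k \<theta> = innov_cov S k \<theta>"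
    and "transpose_mat (pre1 k \<theta>) * pre2 k \<theta> = transpose_mat (cross k \<theta>)"
    and "transpose_mat (pre2 k \<theta>) * pre2 k \<theta>
      = sF S k \<theta> * kf_P S k \<theta> * transpose_mat (sF S k \<theta>) + sG S k \<theta> * sQ S k \<theta> * transpose_mat (sG S k \<theta>)"
    and "transpose_mat (pre1 k \<theta>) * pre3 k \<theta> = - colmat (innov S k \<theta>)"
    and "transpose_mat (pre2 k \<theta>) * pre3 k \<theta> = sF S k \<theta> * colmat (kf_x S k \<theta>)"
proof -
  have k': "k \<in> {1..Suc N}" using k by auto
  let ?R = "sqrtR \<sigma>R S k \<theta>" and ?P = "sqrtP \<sigma>P S k \<theta>" and ?H = "sH S k \<theta>" and ?F = "sF S k \<theta>"
    and ?G = "sG S k \<theta>" and ?Q = "Qh k \<theta>" and ?x = "colmat (state_bar \<sigma>P S k \<theta>)"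
    and ?z = "colmat (- meas_bar \<sigma>R S k \<theta>)"
  note D = dims[OF k \<theta>] and R = sqrtR_props[OF k \<theta>] and P = sqrtP_props[OF k' \<theta>] and Q = Qh_props[OF k \<theta>]
  have F: "?F \<in> carrier_mat n n" "?F\<^sup>T \<in> carrier_mat n n" and G: "?G \<in> carrier_mat n q" "?G\<^sup>T \<in> carrier_mat q n"
    and H: "?H \<in> carrier_mat m n" "?H\<^sup>T \<in> carrier_mat n m" using D by auto
  have PH: "?P * ?H\<^sup>T \<in> carrier_mat n m" and PF: "?P * ?F\<^sup>T \<in> carrier_mat n n" and QG: "?Q * ?G\<^sup>T \<in> carrier_mat q n"
    using F G H P Q by auto
  have Pc: "kf_P S k \<theta> \<in> carrier_mat n n" and Pt: "(kf_P S k \<theta>)\<^sup>T = kf_P S k \<theta>"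
    using mat_diff_onD(1)[OF kf_P_diff[OF k'] \<theta>] P_pos[OF k' \<theta>] by (auto simp: pos_def_def)
  have x: "?x \<in> carrier_mat n 1" and z: "?z \<in> carrier_mat m 1"
    and x0: "colmat (kf_x S k \<theta>) \<in> carrier_mat n 1" and z0: "colmat (sz S k) \<in> carrier_mat m 1"
    using state_bar_carrier[OF k' \<theta>] meas_bar_carrier[OF k \<theta>] kf_x_carrier[OF k' \<theta>] dimz[OF k]
    by (auto intro!: colmat_carrier)
  \<comment> \<open>P_k^{T/2} cancels P_k^{-T/2}. Used with A = H_k for the innovation and with A =
    F_k for the propagated estimate.\<close>
  have X: "(?P * A\<^sup>T)\<^sup>T * ?x = A * colmat (kf_x S k \<theta>)" if A: "A \<in> carrier_mat r n" for A r
  proof -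
    note V = minv_carrier[OF P(1,2)]
    have "(?P * A\<^sup>T)\<^sup>T * ?x = A * ?P\<^sup>T * ((minv ?P)\<^sup>T * colmat (kf_x S k \<theta>))"
      using A P by (simp add: transpose_mult[of ?P n n "A\<^sup>T" r] colmat_state_bar[OF k' \<theta>])
    also have "\<dots> = A * (?P\<^sup>T * ((minv ?P)\<^sup>T * colmat (kf_x S k \<theta>)))"
      using A P V x0 by (intro assoc_mult_mat[of _ r n _ n _ 1]) auto
    also have "?P\<^sup>T * ((minv ?P)\<^sup>T * colmat (kf_x S k \<theta>)) = ?P\<^sup>T * (minv ?P)\<^sup>T * colmat (kf_x S k \<theta>)"
      using A P V x0 by (intro assoc_mult_mat[of _ n n _ n _ 1, symmetric]) auto
    finally show ?thesis by (simp add: transpose_minv_mult[OF P(1,2)] left_mult_one_mat[OF x0])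
  qed
  have Z: "?R\<^sup>T * ?z = - colmat (sz S k)"
  proof -
    have "?R\<^sup>T * ((minv ?R)\<^sup>T * colmat (sz S k)) = ?R\<^sup>T * (minv ?R)\<^sup>T * colmat (sz S k)"
      using R minv_carrier[OF R(1,2)] z0 by (intro assoc_mult_mat[of _ m m _ m _ 1, symmetric]) auto
    also have "\<dots> = colmat (sz S k)" by (simp add: transpose_minv_mult[OF R(1,2)] left_mult_one_mat[OF z0])
    finally show ?thesis
      using R minv_carrier[OF R(1,2)] z0 by (simp add: colmat_uminus colmat_meas_bar[OF k \<theta>])
  qed
  have "(pre1 k \<theta>)\<^sup>T * pre1 k \<theta> = ?R\<^sup>T * ?R + ((?P * ?H\<^sup>T)\<^sup>T * (?P * ?H\<^sup>T) + (0\<^sub>m q m)\<^sup>T * 0\<^sub>m q m)"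
    unfolding pre1_def by (rule transpose_append_rows3_mult[OF R(1) PH _ R(1) PH]) auto
  also have "\<dots> = sR S k \<theta> + ?H * kf_P S k \<theta> * ?H\<^sup>T"
    unfolding R(3) gram_of_products[OF P(1) H(2) H(2)] P(3) using H Pc by simp
  also have "\<dots> = innov_cov S k \<theta>"
    unfolding innov_cov_def using H Pc D by (intro comm_add_mat[of _ m m]) auto
  finally show "(pre1 k \<theta>)\<^sup>T * pre1 k \<theta> = innov_cov S k \<theta>" .
  have "(pre1 k \<theta>)\<^sup>T * pre2 k \<theta> = ?R\<^sup>T * 0\<^sub>m m n + ((?P * ?H\<^sup>T)\<^sup>T * (?P * ?F\<^sup>T) + (0\<^sub>m q m)\<^sup>T * (?Q * ?G\<^sup>T))"
    unfolding pre1_def pre2_def by (rule transpose_append_rows3_mult[OF R(1) PH _ _ PF QG]) auto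
  also have "\<dots> = ?H * kf_P S k \<theta> * ?F\<^sup>T"
    unfolding gram_of_products[OF P(1) H(2) F(2)] P(3) using H F Pc R left_mult_zero_mat[OF QG] by simp
  also have "\<dots> = (cross k \<theta>)\<^sup>T"
    unfolding cross_def transpose_mult[OF mult_carrier_mat[OF F(1) Pc] H(2)] transpose_mult[OF F(1) Pc] Pt
      transpose_transpose by (rule assoc_mult_mat[OF H(1) Pc F(2)])
  finally show "(pre1 k \<theta>)\<^sup>T * pre2 k \<theta> = (cross k \<theta>)\<^sup>T" .
  have FG: "?F * kf_P S k \<theta> * ?F\<^sup>T + ?G * sQ S k \<theta> * ?G\<^sup>T \<in> carrier_mat n n"
    using F G Pc by auto
  have "(pre2 k \<theta>)\<^sup>T * pre2 k \<theta> = (0\<^sub>m m n)\<^sup>T * 0\<^sub>m m n + ((?P * ?F\<^sup>T)\<^sup>T * (?P * ?F\<^sup>T) + (?Q * ?G\<^sup>T)\<^sup>T * (?Q * ?G\<^sup>T))"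
    unfolding pre2_def by (rule transpose_append_rows3_mult[OF _ PF QG _ PF QG]) auto
  also have "\<dots> = ?F * kf_P S k \<theta> * ?F\<^sup>T + ?G * sQ S k \<theta> * ?G\<^sup>T"
    unfolding gram_of_products[OF P(1) F(2) F(2)] gram_of_products[OF Q(1) G(2) G(2)] P(3) Q(2)
    using left_add_zero_mat[OF FG] by simp
  finally show "(pre2 k \<theta>)\<^sup>T * pre2 k \<theta> = ?F * kf_P S k \<theta> * ?F\<^sup>T + ?G * sQ S k \<theta> * ?G\<^sup>T" .
  have "(pre1 k \<theta>)\<^sup>T * pre3 k \<theta> = ?R\<^sup>T * ?z + ((?P * ?H\<^sup>T)\<^sup>T * ?x + (0\<^sub>m q m)\<^sup>T * 0\<^sub>m q 1)"
    unfolding pre1_def pre3_def by (rule transpose_append_rows3_mult[OF R(1) PH _ z x]) auto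
  also have "\<dots> = - colmat (innov S k \<theta>)"
    unfolding X[OF H(1)] Z colmat_innov[OF k \<theta>] using H x0 z0 by (intro eq_matI) (auto simp del: index_mult_mat(1))
  finally show "(pre1 k \<theta>)\<^sup>T * pre3 k \<theta> = - colmat (innov S k \<theta>)" .
  have "(pre2 k \<theta>)\<^sup>T * pre3 k \<theta> = (0\<^sub>m m n)\<^sup>T * ?z + ((?P * ?F\<^sup>T)\<^sup>T * ?x + (?Q * ?G\<^sup>T)\<^sup>T * 0\<^sub>m q 1)"
    unfolding pre2_def pre3_def by (rule transpose_append_rows3_mult[OF _ PF QG z x]) auto
  also have "\<dots> = ?F * colmat (kf_x S k \<theta>)"
    using left_mult_zero_mat[OF z] right_mult_zero_mat[of "(?Q * ?G\<^sup>T)\<^sup>T" n q] QG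
      right_add_zero_mat[of "?F * colmat (kf_x S k \<theta>)" n 1] left_add_zero_mat[of "?F * colmat (kf_x S k \<theta>)" n 1]
      mult_carrier_mat[OF F(1) x0] unfolding X[OF F(1)] by simp
  finally show "(pre2 k \<theta>)\<^sup>T * pre3 k \<theta> = ?F * colmat (kf_x S k \<theta>)" .
qed

text \<open>The same values computed from the post-array. The second is the Riccati recursion with
  the gain term moved to the other side; in the fourth, the correction by the gain contained in the
  new estimate cancels against \<open>K * e\<close>.\<close>

lemma post_gram:
  assumes k: "k \<in> {1..N}" and \<theta>: "\<theta> \<in> \<Omega>"
  defines "E \<equiv> sqrtRe \<sigma>E S k \<theta>" and "K \<equiv> gain_bar \<sigma>E S k \<theta>" and "P \<equiv> sqrtP \<sigma>P S (Suc k) \<theta>"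
    and "e \<equiv> colmat (- innov_bar \<sigma>E S k \<theta>)" and "x \<equiv> colmat (state_bar \<sigma>P S (Suc k) \<theta>)"
  shows "transpose_mat E * transpose_mat K = transpose_mat (cross k \<theta>)"
    and "K * transpose_mat K + transpose_mat P * P
      = sF S k \<theta> * kf_P S k \<theta> * transpose_mat (sF S k \<theta>) + sG S k \<theta> * sQ S k \<theta> * transpose_mat (sG S k \<theta>)"
    and "transpose_mat E * e = - colmat (innov S k \<theta>)"
    and "K * e + transpose_mat P * x = sF S k \<theta> * colmat (kf_x S k \<theta>)"
proof -
  have k': "k \<in> {1..Suc N}" "Suc k \<in> {1..Suc N}" "1 \<le> k" using k by auto
  let ?X = "cross k \<theta>" and ?V = "minv E" and ?Re = "innov_cov S k \<theta>" and ?F = "sF S k \<theta>" and ?G = "sG S k \<theta>"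
    and ?i = "colmat (innov S k \<theta>)"
  note D = dims[OF k \<theta>] and E = sqrtRe_props[OF k \<theta>, folded E_def] and P = sqrtP_props[OF k'(2) \<theta>, folded P_def]
  note V = minv_carrier[OF E(1,2)]
  have X: "?X \<in> carrier_mat n m" and Re: "?Re \<in> carrier_mat m m" and Pc: "kf_P S k \<theta> \<in> carrier_mat n n"
    using mat_diff_onD(1)[OF cross_on[OF k] \<theta>] mat_diff_onD(1)[OF innov_cov_on(1)[OF k] \<theta>]
      mat_diff_onD(1)[OF kf_P_diff[OF k'(1)] \<theta>] by auto
  have K: "K = ?X * ?V" "K \<in> carrier_mat n m" using X V by (auto simp: K_def E_def gain_bar_eq)
  have i: "?i \<in> carrier_mat m 1" using innov_carrier[OF k \<theta>] by (rule colmat_carrier)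
  have x0: "colmat (kf_x S k \<theta>) \<in> carrier_mat n 1" "colmat (kf_x S (Suc k) \<theta>) \<in> carrier_mat n 1"
    using kf_x_carrier[OF k'(1) \<theta>] kf_x_carrier[OF k'(2) \<theta>] by (auto intro!: colmat_carrier)
  have Reinv: "minv ?Re = ?V * ?V\<^sup>T" using minv_gram[OF E(1,2)] E(3) by simp
  have "K * E = ?X" using X V E by (simp add: K assoc_mult_mat[of _ n m _ m _ m] minv_mult[OF E(1,2)])
  then show "E\<^sup>T * K\<^sup>T = ?X\<^sup>T" using transpose_mult[OF K(2) E(1)] by simp
  have eb: "e = - (?V\<^sup>T * ?i)"
    unfolding e_def colmat_uminus colmat_innov_bar[OF k \<theta>] E_def ..
  have "E\<^sup>T * (?V\<^sup>T * ?i) = E\<^sup>T * ?V\<^sup>T * ?i"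
    using E V i by (intro assoc_mult_mat[of _ m m _ m _ 1, symmetric]) auto
  also have "\<dots> = ?i" by (simp add: transpose_minv_mult[OF E(1,2)] left_mult_one_mat[OF i])
  finally show "E\<^sup>T * e = - ?i"
    unfolding eb using E V i by simp
  have dRe: "Determinant.det ?Re \<noteq> 0" using det_pos_def_nonzero[OF innov_cov_on(2)[OF k \<theta>] Re] .
  \<comment> \<open>The Kalman gain. With R_{e,k}^{-1} = V V^T, where V is the inverse root, the
    subtracted term K_p R_e K_p^T of the Riccati recursion becomes \<open>K * K\<^sup>T\<close> for
    the normalized gain.\<close>
  let ?Kp = "?X * minv ?Re"
  have Kp: "?Kp \<in> carrier_mat n m" using X minv_carrier[OF Re dRe] by auto
  have "?Kp * ?Re = ?X"
    using X Re minv_carrier[OF Re dRe] by (simp add: assoc_mult_mat[of _ n m _ m _ m] minv_mult[OF Re dRe])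
  moreover have "?Kp\<^sup>T = ?V * (?V\<^sup>T * ?X\<^sup>T)"
    using X V by (simp add: Reinv transpose_mult[of ?X n m _ m] transpose_mult[of ?V m m _ m] assoc_mult_mat[of _ m m _ m _ n])
  moreover have "?X * (?V * (?V\<^sup>T * ?X\<^sup>T)) = K * K\<^sup>T"
    using X V by (simp add: K transpose_mult[of ?X n m _ m] assoc_mult_mat[of _ n m _ m _ n])
  ultimately have KRK: "?Kp * ?Re * ?Kp\<^sup>T = K * K\<^sup>T" by simp
  have "P\<^sup>T * P = ?F * kf_P S k \<theta> * ?F\<^sup>T + ?G * sQ S k \<theta> * ?G\<^sup>T - K * K\<^sup>T"
    unfolding P(3) kf_P_Suc[OF k'(3)] KRK ..
  then show "K * K\<^sup>T + P\<^sup>T * P = ?F * kf_P S k \<theta> * ?F\<^sup>T + ?G * sQ S k \<theta> * ?G\<^sup>T"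
    using D Pc K(2) by (intro eq_matI) (auto simp del: index_mult_mat(1))
  have "P\<^sup>T * x = P\<^sup>T * (minv P)\<^sup>T * colmat (kf_x S (Suc k) \<theta>)"
    unfolding x_def colmat_state_bar[OF k'(2) \<theta>] P_def[symmetric] using P minv_carrier[OF P(1,2)] x0
    by (intro assoc_mult_mat[of _ n n _ n _ 1, symmetric]) auto
  also have "\<dots> = colmat (kf_x S (Suc k) \<theta>)" unfolding transpose_minv_mult(1)[OF P(1,2)] by (rule left_mult_one_mat[OF x0(2)])
  also have "\<dots> = ?F * colmat (kf_x S k \<theta>) + ?Kp * ?i"
    unfolding kf_x_Suc[OF k'(3)] using D kf_x_carrier[OF k'(1) \<theta>] innov_carrier[OF k \<theta>] Kp
    by (subst colmat_add) (auto simp: colmat_mult_vec)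
  finally have Px: "P\<^sup>T * x = ?F * colmat (kf_x S k \<theta>) + ?Kp * ?i" .
  have "K * (?V\<^sup>T * ?i) = ?Kp * ?i"
    using X V i by (simp add: K Reinv assoc_mult_mat[of _ n m _ m _ 1] assoc_mult_mat[of _ m m _ m _ 1])
  then have Ke: "K * e = - (?Kp * ?i)" unfolding eb using K V i by simp
  have cancel: "- A + (B + A) = B" if "A \<in> carrier_mat n 1" "B \<in> carrier_mat n 1" for A B :: "real mat"
    using that by (intro eq_matI) auto
  show "K * e + P\<^sup>T * x = ?F * colmat (kf_x S k \<theta>)"
    unfolding Px Ke by (rule cancel) (use D x0 Kp i in \<open>auto intro: mult_carrier_mat\<close>)
qed

section \<open>Derivatives of the pre-array and the post-array\<close>

lemma pre_diff:
  assumes k: "k \<in> {1..N}"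
  shows "mat_diff_on \<Omega> m m (sqrtR \<sigma>R S k)"
    and "mat_diff_on \<Omega> n m (\<lambda>\<theta>. sqrtP \<sigma>P S k \<theta> * transpose_mat (sH S k \<theta>))"
    and "mat_diff_on \<Omega> n n (\<lambda>\<theta>. sqrtP \<sigma>P S k \<theta> * transpose_mat (sF S k \<theta>))"
    and "mat_diff_on \<Omega> q n (\<lambda>\<theta>. Qh k \<theta> * transpose_mat (sG S k \<theta>))"
    and "mat_diff_on \<Omega> m 1 (\<lambda>\<theta>. colmat (- meas_bar \<sigma>R S k \<theta>))"
    and "mat_diff_on \<Omega> n 1 (\<lambda>\<theta>. colmat (state_bar \<sigma>P S k \<theta>))"
proof -
  have k': "k \<in> {1..Suc N}" using k by auto
  show "mat_diff_on \<Omega> m m (sqrtR \<sigma>R S k)" by (rule sqrtR_diff[OF k])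
  show "mat_diff_on \<Omega> n m (\<lambda>\<theta>. sqrtP \<sigma>P S k \<theta> * transpose_mat (sH S k \<theta>))"
    by (rule mat_diff_on_mult[OF dom sqrtP_diff[OF k'] mat_diff_on_transpose[OF dom system_diff(3)[OF k]]])
  show "mat_diff_on \<Omega> n n (\<lambda>\<theta>. sqrtP \<sigma>P S k \<theta> * transpose_mat (sF S k \<theta>))"
    by (rule mat_diff_on_mult[OF dom sqrtP_diff[OF k'] mat_diff_on_transpose[OF dom system_diff(1)[OF k]]])
  show "mat_diff_on \<Omega> q n (\<lambda>\<theta>. Qh k \<theta> * transpose_mat (sG S k \<theta>))" by (rule Qh_diff[OF k])
  show "mat_diff_on \<Omega> m 1 (\<lambda>\<theta>. colmat (- meas_bar \<sigma>R S k \<theta>))"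
    unfolding colmat_uminus by (rule mat_diff_on_uminus[OF dom meas_bar_diff[OF k]])
  show "mat_diff_on \<Omega> n 1 (\<lambda>\<theta>. colmat (state_bar \<sigma>P S k \<theta>))" by (rule state_bar_diff[OF k'])
qed

lemma zero_diff: "mat_diff_on \<Omega> r c (\<lambda>_. 0\<^sub>m r c)"
  by (rule mat_diff_on_const) simp

lemma stack3_diff:
  assumes "mat_diff_on \<Omega> r1 c A" "mat_diff_on \<Omega> r2 c B" "mat_diff_on \<Omega> r3 c C"
  shows "mat_diff_on \<Omega> (r1 + (r2 + r3)) c (\<lambda>\<theta>. A \<theta> @\<^sub>r B \<theta> @\<^sub>r C \<theta>)"
    and "\<theta> \<in> \<Omega> \<Longrightarrow> mat_pd i (\<lambda>\<theta>. A \<theta> @\<^sub>r B \<theta> @\<^sub>r C \<theta>) \<theta> = mat_pd i A \<theta> @\<^sub>r mat_pd i B \<theta> @\<^sub>r mat_pd i C \<theta>"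
  using mat_diff_on_append_rows[OF dom assms(1) mat_diff_on_append_rows[OF dom assms(2,3)]]
    mat_pd_append_rows[OF dom assms(1) mat_diff_on_append_rows[OF dom assms(2,3)]] mat_pd_append_rows[OF dom assms(2,3)]
  by simp_all

lemma pre_array_diff:
  assumes k: "k \<in> {1..N}"
  shows "mat_diff_on \<Omega> (m + (n + q)) m (pre1 k)" "mat_diff_on \<Omega> (m + (n + q)) n (pre2 k)"
    "mat_diff_on \<Omega> (m + (n + q)) 1 (pre3 k)"
    and "\<theta> \<in> \<Omega> \<Longrightarrow> mat_pd i (pre1 k) \<theta> = mat_pd i (sqrtR \<sigma>R S k) \<theta> @\<^sub>r
      mat_pd i (\<lambda>\<theta>. sqrtP \<sigma>P S k \<theta> * transpose_mat (sH S k \<theta>)) \<theta> @\<^sub>r 0\<^sub>m q m"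
    and "\<theta> \<in> \<Omega> \<Longrightarrow> mat_pd i (pre2 k) \<theta> = 0\<^sub>m m n @\<^sub>r
      mat_pd i (\<lambda>\<theta>. sqrtP \<sigma>P S k \<theta> * transpose_mat (sF S k \<theta>)) \<theta> @\<^sub>r
      mat_pd i (\<lambda>\<theta>. Qh k \<theta> * transpose_mat (sG S k \<theta>)) \<theta>"
    and "\<theta> \<in> \<Omega> \<Longrightarrow> mat_pd i (pre3 k) \<theta> = colmat (vec_pd i (\<lambda>\<theta>. - meas_bar \<sigma>R S k \<theta>) \<theta>) @\<^sub>r
      colmat (vec_pd i (state_bar \<sigma>P S k) \<theta>) @\<^sub>r 0\<^sub>m q 1"
proof -
  note D = pre_diff[OF k]
  have eqs: "pre1 k = (\<lambda>\<theta>. sqrtR \<sigma>R S k \<theta> @\<^sub>r sqrtP \<sigma>P S k \<theta> * transpose_mat (sH S k \<theta>) @\<^sub>r 0\<^sub>m q m)"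
    "pre2 k = (\<lambda>\<theta>. 0\<^sub>m m n @\<^sub>r sqrtP \<sigma>P S k \<theta> * transpose_mat (sF S k \<theta>) @\<^sub>r Qh k \<theta> * transpose_mat (sG S k \<theta>))"
    "pre3 k = (\<lambda>\<theta>. colmat (- meas_bar \<sigma>R S k \<theta>) @\<^sub>r colmat (state_bar \<sigma>P S k \<theta>) @\<^sub>r 0\<^sub>m q 1)"
    by (simp_all add: fun_eq_iff pre1_def pre2_def pre3_def)
  note s1 = stack3_diff[OF D(1,2) zero_diff] and s2 = stack3_diff[OF zero_diff D(3,4)]
    and s3 = stack3_diff[OF D(5,6) zero_diff]
  show "mat_diff_on \<Omega> (m + (n + q)) m (pre1 k)" "mat_diff_on \<Omega> (m + (n + q)) n (pre2 k)"
    "mat_diff_on \<Omega> (m + (n + q)) 1 (pre3 k)"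
    unfolding eqs by (rule s1(1) s2(1) s3(1))+
  assume \<theta>: "\<theta> \<in> \<Omega>"
  show "mat_pd i (pre1 k) \<theta> = mat_pd i (sqrtR \<sigma>R S k) \<theta> @\<^sub>r
      mat_pd i (\<lambda>\<theta>. sqrtP \<sigma>P S k \<theta> * transpose_mat (sH S k \<theta>)) \<theta> @\<^sub>r 0\<^sub>m q m"
    unfolding eqs s1(2)[OF \<theta>] mat_pd_zero ..
  show "mat_pd i (pre2 k) \<theta> = 0\<^sub>m m n @\<^sub>r
      mat_pd i (\<lambda>\<theta>. sqrtP \<sigma>P S k \<theta> * transpose_mat (sF S k \<theta>)) \<theta> @\<^sub>r
      mat_pd i (\<lambda>\<theta>. Qh k \<theta> * transpose_mat (sG S k \<theta>)) \<theta>"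
    unfolding eqs s2(2)[OF \<theta>] mat_pd_zero ..
  have c1: "- meas_bar \<sigma>R S k \<theta> \<in> carrier_vec m" if "\<theta> \<in> \<Omega>" for \<theta>
    using meas_bar_carrier[OF k that] by simp
  have c2: "state_bar \<sigma>P S k \<theta> \<in> carrier_vec n" if "\<theta> \<in> \<Omega>" for \<theta>
    using state_bar_carrier[OF _ that] k by simp
  have v1: "colmat (vec_pd i (\<lambda>\<theta>. - meas_bar \<sigma>R S k \<theta>) \<theta>) = mat_pd i (\<lambda>\<theta>. colmat (- meas_bar \<sigma>R S k \<theta>)) \<theta>"
    by (rule colmat_vec_pd[OF dom \<theta> _ D(5)]) (rule c1)
  have v2: "colmat (vec_pd i (state_bar \<sigma>P S k) \<theta>) = mat_pd i (\<lambda>\<theta>. colmat (state_bar \<sigma>P S k \<theta>)) \<theta>"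
    by (rule colmat_vec_pd[OF dom \<theta> _ D(6)]) (rule c2)
  show "mat_pd i (pre3 k) \<theta> = colmat (vec_pd i (\<lambda>\<theta>. - meas_bar \<sigma>R S k \<theta>) \<theta>) @\<^sub>r
      colmat (vec_pd i (state_bar \<sigma>P S k) \<theta>) @\<^sub>r 0\<^sub>m q 1"
    unfolding eqs s3(2)[OF \<theta>] mat_pd_zero v1 v2 ..
qed

definition post :: "nat \<Rightarrow> real ^ 'p \<Rightarrow> real mat" where
  "post k \<theta> = four_block_mat (sqrtRe \<sigma>E S k \<theta>) (transpose_mat (gain_bar \<sigma>E S k \<theta>)) (0\<^sub>m n m) (sqrtP \<sigma>P S (Suc k) \<theta>)"

definition post3 :: "nat \<Rightarrow> real ^ 'p \<Rightarrow> real mat" where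
  "post3 k \<theta> = colmat (- innov_bar \<sigma>E S k \<theta>) @\<^sub>r colmat (state_bar \<sigma>P S (Suc k) \<theta>)"

lemma post_blocks:
  assumes k: "k \<in> {1..N}"
  shows "mat_diff_on \<Omega> m m (sqrtRe \<sigma>E S k)" "mat_diff_on \<Omega> m n (\<lambda>\<theta>. transpose_mat (gain_bar \<sigma>E S k \<theta>))"
    "mat_diff_on \<Omega> n n (sqrtP \<sigma>P S (Suc k))" "mat_diff_on \<Omega> m 1 (\<lambda>\<theta>. colmat (- innov_bar \<sigma>E S k \<theta>))"
    "mat_diff_on \<Omega> n 1 (\<lambda>\<theta>. colmat (state_bar \<sigma>P S (Suc k) \<theta>))"
  using sqrtRe_diff[OF k] mat_diff_on_transpose[OF dom gain_bar_diff[OF k]] sqrtP_diff[of "Suc k"]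
    mat_diff_on_uminus[OF dom innov_bar_diff[OF k]] state_bar_diff[of "Suc k"] k
  by (simp_all add: colmat_uminus)

lemma post_diff:
  assumes k: "k \<in> {1..N}"
  shows "mat_diff_on \<Omega> (m + n) (m + n) (post k)" "mat_diff_on \<Omega> (m + n) 1 (post3 k)"
    and "\<theta> \<in> \<Omega> \<Longrightarrow> mat_pd i (post k) \<theta> = four_block_mat (mat_pd i (sqrtRe \<sigma>E S k) \<theta>)
      (mat_pd i (\<lambda>\<theta>. transpose_mat (gain_bar \<sigma>E S k \<theta>)) \<theta>) (0\<^sub>m n m) (mat_pd i (sqrtP \<sigma>P S (Suc k)) \<theta>)"
    and "\<theta> \<in> \<Omega> \<Longrightarrow> mat_pd i (post3 k) \<theta> =
      colmat (- vec_pd i (innov_bar \<sigma>E S k) \<theta> @\<^sub>v vec_pd i (state_bar \<sigma>P S (Suc k)) \<theta>)"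
proof -
  note D = post_blocks[OF k]
  have eqs: "post k = (\<lambda>\<theta>. four_block_mat (sqrtRe \<sigma>E S k \<theta>) (transpose_mat (gain_bar \<sigma>E S k \<theta>)) (0\<^sub>m n m) (sqrtP \<sigma>P S (Suc k) \<theta>))"
    "post3 k = (\<lambda>\<theta>. colmat (- innov_bar \<sigma>E S k \<theta>) @\<^sub>r colmat (state_bar \<sigma>P S (Suc k) \<theta>))"
    by (simp_all add: fun_eq_iff post_def post3_def)
  note d1 = mat_diff_on_four_block[OF dom D(1,2) zero_diff D(3)] and d2 = mat_diff_on_append_rows[OF dom D(4,5)]
  show "mat_diff_on \<Omega> (m + n) (m + n) (post k)" "mat_diff_on \<Omega> (m + n) 1 (post3 k)"
    unfolding eqs by (rule d1(1) d2)+
  assume \<theta>: "\<theta> \<in> \<Omega>"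
  show "mat_pd i (post k) \<theta> = four_block_mat (mat_pd i (sqrtRe \<sigma>E S k) \<theta>)
      (mat_pd i (\<lambda>\<theta>. transpose_mat (gain_bar \<sigma>E S k \<theta>)) \<theta>) (0\<^sub>m n m) (mat_pd i (sqrtP \<sigma>P S (Suc k)) \<theta>)"
    unfolding eqs d1(2)[OF \<theta>] mat_pd_zero ..
  have c: "state_bar \<sigma>P S (Suc k) \<theta> \<in> carrier_vec n" if "\<theta> \<in> \<Omega>" for \<theta>
    using state_bar_carrier[OF _ that] k by simp
  have "mat_pd i (\<lambda>\<theta>. colmat (- innov_bar \<sigma>E S k \<theta>)) \<theta> = - mat_pd i (\<lambda>\<theta>. colmat (innov_bar \<sigma>E S k \<theta>)) \<theta>"
    unfolding colmat_uminus by (rule mat_pd_uminus[OF dom innov_bar_diff[OF k] \<theta>])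
  also have "\<dots> = colmat (- vec_pd i (innov_bar \<sigma>E S k) \<theta>)"
    unfolding colmat_uminus by (subst colmat_vec_pd[OF dom \<theta> _ innov_bar_diff[OF k]]) (simp_all add: innov_bar_carrier[OF k])
  finally have v1: "mat_pd i (\<lambda>\<theta>. colmat (- innov_bar \<sigma>E S k \<theta>)) \<theta> = colmat (- vec_pd i (innov_bar \<sigma>E S k) \<theta>)" .
  have v2: "colmat (vec_pd i (state_bar \<sigma>P S (Suc k)) \<theta>) = mat_pd i (\<lambda>\<theta>. colmat (state_bar \<sigma>P S (Suc k) \<theta>)) \<theta>"
    by (rule colmat_vec_pd[OF dom \<theta> _ D(5)]) (rule c)
  show "mat_pd i (post3 k) \<theta> =
      colmat (- vec_pd i (innov_bar \<sigma>E S k) \<theta> @\<^sub>v vec_pd i (state_bar \<sigma>P S (Suc k)) \<theta>)"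
    unfolding eqs mat_pd_append_rows[OF dom D(4,5) \<theta>] colmat_append v1 v2 ..
qed

text \<open>Matching the inner products of pre-array and post-array block by block gives J^T J = M^T
  M and J^T c = M^T b. No rotation is mentioned, so these hold on all of \<Omega> and may be
  differentiated.\<close>

lemma post_props:
  assumes k: "k \<in> {1..N}" and \<theta>: "\<theta> \<in> \<Omega>"
  shows "upper_triangular (post k \<theta>)" "Determinant.det (post k \<theta>) \<noteq> 0"
    and "transpose_mat (post k \<theta>) * post k \<theta> = transpose_mat (pre1 k \<theta> @\<^sub>c pre2 k \<theta>) * (pre1 k \<theta> @\<^sub>c pre2 k \<theta>)"
    and "transpose_mat (post k \<theta>) * post3 k \<theta> = transpose_mat (pre1 k \<theta> @\<^sub>c pre2 k \<theta>) * pre3 k \<theta>"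
proof -
  let ?E = "sqrtRe \<sigma>E S k \<theta>" and ?K = "transpose_mat (gain_bar \<sigma>E S k \<theta>)" and ?P = "sqrtP \<sigma>P S (Suc k) \<theta>"
  have k': "Suc k \<in> {1..Suc N}" using k by auto
  note E = sqrtRe_props[OF k \<theta>] and P = sqrtP_props[OF k' \<theta>] and C = post_blocks[OF k, THEN mat_diff_onD(1), OF \<theta>]
  note A = pre_array_diff(1-3)[OF k, THEN mat_diff_onD(1), OF \<theta>]
  have z: "0\<^sub>m n m \<in> carrier_mat n m" by simp
  show "upper_triangular (post k \<theta>)"
    unfolding post_def by (rule upper_triangular_four_block[OF C(1,3) E(4) P(4)])
  show "Determinant.det (post k \<theta>) \<noteq> 0"
    unfolding post_def det_four_block_mat_lower_left_zero[OF C(1,2) refl C(3)] using E(2) P(2) by simp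
  have post: "post k \<theta> = (?E @\<^sub>r 0\<^sub>m n m) @\<^sub>c (?K @\<^sub>r ?P)"
    unfolding post_def four_block_mat_append[OF C(1,2) z C(3)] append_rows_append_cols[OF C(1,2) z C(3)] ..
  have c1: "?E @\<^sub>r 0\<^sub>m n m \<in> carrier_mat (m + n) m" "?K @\<^sub>r ?P \<in> carrier_mat (m + n) n"
    by (rule carrier_append_rows C z)+
  note G = post_gram[OF k \<theta>] and Q = pre_gram[OF k \<theta>]
  have g1: "(?E @\<^sub>r 0\<^sub>m n m)\<^sup>T * (?E @\<^sub>r 0\<^sub>m n m) = (pre1 k \<theta>)\<^sup>T * pre1 k \<theta>"
    unfolding transpose_append_rows_mult[OF C(1) z C(1) z] Q(1) using E(3) right_add_zero_mat[OF mat_diff_onD(1)[OF innov_cov_on(1)[OF k] \<theta>]] by simp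
  have g2: "(?E @\<^sub>r 0\<^sub>m n m)\<^sup>T * (?K @\<^sub>r ?P) = (pre1 k \<theta>)\<^sup>T * pre2 k \<theta>"
    unfolding transpose_append_rows_mult[OF C(1) z C(2,3)] Q(2) using G(1) C left_mult_zero_mat[OF C(3), of m]
      mat_diff_onD(1)[OF cross_on[OF k] \<theta>] by simp
  have g3: "(?K @\<^sub>r ?P)\<^sup>T * (?K @\<^sub>r ?P) = (pre2 k \<theta>)\<^sup>T * pre2 k \<theta>"
    unfolding transpose_append_rows_mult[OF C(2,3,2,3)] Q(3) using G(2) by simp
  show "transpose_mat (post k \<theta>) * post k \<theta> = transpose_mat (pre1 k \<theta> @\<^sub>c pre2 k \<theta>) * (pre1 k \<theta> @\<^sub>c pre2 k \<theta>)"
    unfolding post gram_append_cols[OF c1] gram_append_cols[OF A(1,2)] g1 g2 g3 ..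
  have p3: "post3 k \<theta> \<in> carrier_mat (m + n) 1" unfolding post3_def by (rule carrier_append_rows[OF C(4,5)])
  have i: "- colmat (innov S k \<theta>) \<in> carrier_mat m 1" using colmat_carrier[OF innov_carrier[OF k \<theta>]] by simp
  have h1: "(?E @\<^sub>r 0\<^sub>m n m)\<^sup>T * post3 k \<theta> = (pre1 k \<theta>)\<^sup>T * pre3 k \<theta>"
    unfolding post3_def transpose_append_rows_mult[OF C(1) z C(4,5)] Q(4) G(3)
    using left_mult_zero_mat[OF C(5), of m] right_add_zero_mat[OF i] by simp
  have h2: "(?K @\<^sub>r ?P)\<^sup>T * post3 k \<theta> = (pre2 k \<theta>)\<^sup>T * pre3 k \<theta>"
    unfolding post3_def transpose_append_rows_mult[OF C(2,3,4,5)] Q(5) using G(4) by simp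
  show "transpose_mat (post k \<theta>) * post3 k \<theta> = transpose_mat (pre1 k \<theta> @\<^sub>c pre2 k \<theta>) * pre3 k \<theta>"
    unfolding post transpose_append_cols_mult[OF c1 p3] transpose_append_cols_mult[OF A] h1 h2 ..
qed

text \<open>Since \<open>Ok\<close> preserves inner products of columns, each block of the
  post-array satisfies the Gram identities. Taken in the order E, Kt, P1, e, x1, each identity
  contains a single new unknown: \<open>E\<close> and \<open>P1\<close> are determined as Cholesky
  factors with the given signs, the others by cancelling an invertible root.\<close>

lemma array_values:
  assumes k: "k \<in> {1..N}" and \<theta>: "\<theta> \<in> \<Omega>"
    and Ok: "Ok \<in> carrier_mat (m + (n + q)) (m + (n + q))" "orth_mat Ok"
    and c: "E \<in> carrier_mat m m" "Kt \<in> carrier_mat m n" "e \<in> carrier_vec m" "P1 \<in> carrier_mat n n"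
      "x1 \<in> carrier_vec n" "\<gamma> \<in> carrier_vec q"
    and E: "upper_triangular E" "\<forall>j<m. 0 \<le> \<sigma>E k j * E $$ (j, j)"
    and P1: "upper_triangular P1" "\<forall>j<n. 0 \<le> \<sigma>P (Suc k) j * P1 $$ (j, j)"
    and eqs: "Ok * pre1 k \<theta> = E @\<^sub>r 0\<^sub>m n m @\<^sub>r 0\<^sub>m q m" "Ok * pre2 k \<theta> = Kt @\<^sub>r P1 @\<^sub>r 0\<^sub>m q n"
      "Ok * pre3 k \<theta> = colmat (- e) @\<^sub>r colmat x1 @\<^sub>r colmat \<gamma>"
  shows "E = sqrtRe \<sigma>E S k \<theta>" "Kt = transpose_mat (gain_bar \<sigma>E S k \<theta>)" "e = innov_bar \<sigma>E S k \<theta>"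
    "P1 = sqrtP \<sigma>P S (Suc k) \<theta>" "x1 = state_bar \<sigma>P S (Suc k) \<theta>"
proof -
  have k': "Suc k \<in> {1..Suc N}" using k by auto
  note A = pre_array_diff(1-3)[OF k, THEN mat_diff_onD(1), OF \<theta>]
  note C = post_blocks[OF k, THEN mat_diff_onD(1), OF \<theta>]
  note EP = sqrtRe_props[OF k \<theta>] and PP = sqrtP_props[OF k' \<theta>]
  note G = post_gram[OF k \<theta>] and Q = pre_gram[OF k \<theta>]
  have z: "0\<^sub>m n m \<in> carrier_mat n m" "0\<^sub>m q m \<in> carrier_mat q m" "0\<^sub>m q n \<in> carrier_mat q n" by simp_all
  have cv: "colmat (- e) \<in> carrier_mat m 1" "colmat x1 \<in> carrier_mat n 1" "colmat \<gamma> \<in> carrier_mat q 1"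
    using c by (auto intro!: colmat_carrier)
  note Re = mat_diff_onD(1)[OF innov_cov_on(1)[OF k] \<theta>]
  have "E\<^sup>T * E = innov_cov S k \<theta>"
    using orth_mat_gram[OF Ok A(1) A(1)] c(1) unfolding eqs transpose_append_rows3_mult[OF c(1) z(1,2) c(1) z(1,2)] Q(1)
    by simp
  then have "chol_factor (\<sigma>E k) (innov_cov S k \<theta>) E"
    using c(1) E Re by (auto simp: chol_factor_def)
  then show EE: "E = sqrtRe \<sigma>E S k \<theta>"
    by (rule chol_factor_unique[OF _ sqrtRe_factor[OF k \<theta>] Re innov_cov_on(2)[OF k \<theta>] sign_cases(4)])
  note tE = transpose_minv_mult[OF EP(1,2)] and vE = minv_carrier[OF EP(1,2)]
  have "E\<^sup>T * Kt = (cross k \<theta>)\<^sup>T"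
    using orth_mat_gram[OF Ok A(1,2)] c(1,2) left_mult_zero_mat[OF c(4), of m]
    unfolding eqs transpose_append_rows3_mult[OF c(1) z(1,2) c(2,4) z(3)] Q(2) by simp
  then show KK: "Kt = transpose_mat (gain_bar \<sigma>E S k \<theta>)"
    using EP vE tE C(2) c(2) G(1) unfolding EE
    by (intro mult_left_cancel_inv[of "(sqrtRe \<sigma>E S k \<theta>)\<^sup>T" m "(minv (sqrtRe \<sigma>E S k \<theta>))\<^sup>T" Kt n]) auto
  \<comment> \<open>\<open>Kt\<close> is already identified, so its contribution is common to both
    sides and is cancelled entry by entry below.\<close>
  have "Kt\<^sup>T * Kt + P1\<^sup>T * P1 = Kt\<^sup>T * Kt + kf_P S (Suc k) \<theta>"
  proof -
    have "Kt\<^sup>T * Kt + kf_P S (Suc k) \<theta> = (pre2 k \<theta>)\<^sup>T * pre2 k \<theta>"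
      unfolding Q(3) using G(2) unfolding PP(3) KK transpose_transpose .
    also have "\<dots> = Kt\<^sup>T * Kt + P1\<^sup>T * P1"
      using orth_mat_gram[OF Ok A(2,2)] c(2,4)
      unfolding eqs transpose_append_rows3_mult[OF c(2,4) z(3) c(2,4) z(3)] by simp
    finally show ?thesis by (rule sym)
  qed
  then have e: "(Kt\<^sup>T * Kt + P1\<^sup>T * P1) $$ (i, j) = (Kt\<^sup>T * Kt + kf_P S (Suc k) \<theta>) $$ (i, j)" for i j by simp
  note Pc = mat_diff_onD(1)[OF kf_P_diff[OF k'] \<theta>]
  have "P1\<^sup>T * P1 = kf_P S (Suc k) \<theta>"
  proof (rule eq_matI)
    fix i j assume "i < dim_row (kf_P S (Suc k) \<theta>)" "j < dim_col (kf_P S (Suc k) \<theta>)"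
    then show "(P1\<^sup>T * P1) $$ (i, j) = kf_P S (Suc k) \<theta> $$ (i, j)"
      using e[of i j] c(2,4) Pc by (simp del: index_mult_mat(1) kf_P.simps)
  qed (use c Pc in auto)
  then have "chol_factor (\<sigma>P (Suc k)) (kf_P S (Suc k) \<theta>) P1"
    using c(4) P1 Pc by (auto simp: chol_factor_def simp del: kf_P.simps)
  then show PP1: "P1 = sqrtP \<sigma>P S (Suc k) \<theta>"
    by (rule chol_factor_unique[OF _ sqrtP_factor[OF k' \<theta>] Pc P_pos[OF k' \<theta>] sign_cases(3)])
  have i: "E\<^sup>T * colmat (- e) \<in> carrier_mat m 1" using c cv by auto
  have "E\<^sup>T * colmat (- e) = - colmat (innov S k \<theta>)"
    using orth_mat_gram[OF Ok A(1,3)] left_mult_zero_mat[OF cv(2), of m] left_mult_zero_mat[OF cv(3), of m] right_add_zero_mat[OF i]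
    unfolding eqs transpose_append_rows3_mult[OF c(1) z(1,2) cv] Q(4) by simp
  then have eq: "(sqrtRe \<sigma>E S k \<theta>)\<^sup>T * colmat (- e) = (sqrtRe \<sigma>E S k \<theta>)\<^sup>T * colmat (- innov_bar \<sigma>E S k \<theta>)"
    unfolding EE G(3) .
  have "colmat (- e) = colmat (- innov_bar \<sigma>E S k \<theta>)"
    by (rule mult_left_cancel_inv[OF _ _ tE(2) cv(1) C(4) eq]) (simp_all add: EP(1) vE)
  then show ee: "e = innov_bar \<sigma>E S k \<theta>" by (simp add: colmat_inject)
  have p: "P1\<^sup>T * colmat x1 \<in> carrier_mat n 1" "Kt\<^sup>T * colmat (- e) \<in> carrier_mat n 1"
    "P1\<^sup>T * colmat (state_bar \<sigma>P S (Suc k) \<theta>) \<in> carrier_mat n 1" using c cv C(5) by auto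
  have "Kt\<^sup>T * colmat (- e) + P1\<^sup>T * colmat x1 = Kt\<^sup>T * colmat (- e) + P1\<^sup>T * colmat (state_bar \<sigma>P S (Suc k) \<theta>)"
  proof -
    have "Kt\<^sup>T * colmat (- e) + P1\<^sup>T * colmat (state_bar \<sigma>P S (Suc k) \<theta>) = (pre2 k \<theta>)\<^sup>T * pre3 k \<theta>"
      unfolding Q(5) using G(4) unfolding KK PP1 ee transpose_transpose .
    also have "\<dots> = Kt\<^sup>T * colmat (- e) + P1\<^sup>T * colmat x1"
      using orth_mat_gram[OF Ok A(2,3)] left_mult_zero_mat[OF cv(3), of n] right_add_zero_mat[OF p(1)]
      unfolding eqs transpose_append_rows3_mult[OF c(2,4) z(3) cv] by simp
    finally show ?thesis by (rule sym)
  qed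
  then have f: "(Kt\<^sup>T * colmat (- e) + P1\<^sup>T * colmat x1) $$ (i, j)
      = (Kt\<^sup>T * colmat (- e) + P1\<^sup>T * colmat (state_bar \<sigma>P S (Suc k) \<theta>)) $$ (i, j)" for i j by simp
  have "P1\<^sup>T * colmat x1 = P1\<^sup>T * colmat (state_bar \<sigma>P S (Suc k) \<theta>)"
  proof (rule eq_matI)
    fix i j assume "i < dim_row (P1\<^sup>T * colmat (state_bar \<sigma>P S (Suc k) \<theta>))" "j < dim_col (P1\<^sup>T * colmat (state_bar \<sigma>P S (Suc k) \<theta>))"
    then show "(P1\<^sup>T * colmat x1) $$ (i, j) = (P1\<^sup>T * colmat (state_bar \<sigma>P S (Suc k) \<theta>)) $$ (i, j)"
      using f[of i j] c(2,4) by (simp del: index_mult_mat(1))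
  qed simp_all
  then have eq: "(sqrtP \<sigma>P S (Suc k) \<theta>)\<^sup>T * colmat x1 = (sqrtP \<sigma>P S (Suc k) \<theta>)\<^sup>T * colmat (state_bar \<sigma>P S (Suc k) \<theta>)"
    unfolding PP1 .
  have "colmat x1 = colmat (state_bar \<sigma>P S (Suc k) \<theta>)"
    by (rule mult_left_cancel_inv[OF _ _ transpose_minv_mult(2)[OF PP(1,2)] cv(2) C(5) eq])
      (simp_all add: PP(1) minv_carrier[OF PP(1,2)])
  then show "x1 = state_bar \<sigma>P S (Suc k) \<theta>" by (simp add: colmat_inject)
qed

text \<open>One filter step. Block columns 1, 2, 3 identify the filter quantities; columns 4, 5, 6
  are the rotated derivatives of the first three and feed the abstract derivative formulas for
  \<open>J\<close> and \<open>c\<close>.\<close>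

lemma array_step:
  assumes k: "k \<in> {1..N}" and \<theta>: "\<theta> \<in> \<Omega>"
    and eq: "Ok *
       ((sqrtR \<sigma>R S k \<theta> @\<^sub>c 0\<^sub>m m n @\<^sub>c colmat (- meas_bar \<sigma>R S k \<theta>) @\<^sub>c
           mat_pd i (sqrtR \<sigma>R S k) \<theta> @\<^sub>c 0\<^sub>m m n @\<^sub>c colmat (vec_pd i (\<lambda>\<theta>'. - meas_bar \<sigma>R S k \<theta>') \<theta>))
        @\<^sub>r
        (sqrtP \<sigma>P S k \<theta> * transpose_mat (sH S k \<theta>) @\<^sub>c sqrtP \<sigma>P S k \<theta> * transpose_mat (sF S k \<theta>) @\<^sub>c
           colmat (state_bar \<sigma>P S k \<theta>) @\<^sub>c
           mat_pd i (\<lambda>\<theta>'. sqrtP \<sigma>P S k \<theta>' * transpose_mat (sH S k \<theta>')) \<theta> @\<^sub>c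
           mat_pd i (\<lambda>\<theta>'. sqrtP \<sigma>P S k \<theta>' * transpose_mat (sF S k \<theta>')) \<theta> @\<^sub>c
           colmat (vec_pd i (state_bar \<sigma>P S k) \<theta>))
        @\<^sub>r
        (0\<^sub>m q m @\<^sub>c Qh k \<theta> * transpose_mat (sG S k \<theta>) @\<^sub>c 0\<^sub>m q 1 @\<^sub>c
           0\<^sub>m q m @\<^sub>c mat_pd i (\<lambda>\<theta>'. Qh k \<theta>' * transpose_mat (sG S k \<theta>')) \<theta> @\<^sub>c 0\<^sub>m q 1))
       =
       ((E @\<^sub>c Kt @\<^sub>c colmat (- e) @\<^sub>c X @\<^sub>c Y @\<^sub>c colmat M)
        @\<^sub>r
        (0\<^sub>m n m @\<^sub>c P1 @\<^sub>c colmat x1 @\<^sub>c L @\<^sub>c V @\<^sub>c colmat W)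
        @\<^sub>r
        (0\<^sub>m q m @\<^sub>c 0\<^sub>m q n @\<^sub>c colmat \<gamma> @\<^sub>c B @\<^sub>c K @\<^sub>c colmat T))"
    and Ok: "Ok \<in> carrier_mat (m + n + q) (m + n + q)" "orth_mat Ok"
    and c: "E \<in> carrier_mat m m" "Kt \<in> carrier_mat m n" "e \<in> carrier_vec m" "P1 \<in> carrier_mat n n"
      "x1 \<in> carrier_vec n" "\<gamma> \<in> carrier_vec q"
    and d: "X \<in> carrier_mat m m" "Y \<in> carrier_mat m n" "M \<in> carrier_vec m"
      "L \<in> carrier_mat n m" "V \<in> carrier_mat n n" "W \<in> carrier_vec n"
      "B \<in> carrier_mat q m" "K \<in> carrier_mat q n" "T \<in> carrier_vec q"
    and E: "upper_triangular E" "\<forall>j<m. 0 \<le> \<sigma>E k j * E $$ (j, j)"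
    and P1: "upper_triangular P1" "\<forall>j<n. 0 \<le> \<sigma>P (Suc k) j * P1 $$ (j, j)"
  defines "J \<equiv> four_block_mat E Kt (0\<^sub>m n m) P1"
  defines "A \<equiv> four_block_mat X Y L V * four_block_mat (minv E) (- (minv E * Kt * minv P1)) (0\<^sub>m n m) (minv P1)"
  shows "E = sqrtRe \<sigma>E S k \<theta>" "Kt = transpose_mat (gain_bar \<sigma>E S k \<theta>)" "e = innov_bar \<sigma>E S k \<theta>"
    "P1 = sqrtP \<sigma>P S (Suc k) \<theta>" "x1 = state_bar \<sigma>P S (Suc k) \<theta>"
    and "four_block_mat (mat_pd i (sqrtRe \<sigma>E S k) \<theta>)
            (mat_pd i (\<lambda>\<theta>'. transpose_mat (gain_bar \<sigma>E S k \<theta>')) \<theta>)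
            (0\<^sub>m n m) (mat_pd i (sqrtP \<sigma>P S (Suc k)) \<theta>)
          = (transpose_mat (str_lower A) + diag_part A + str_upper A) * J"
    and "(- vec_pd i (innov_bar \<sigma>E S k) \<theta>) @\<^sub>v vec_pd i (state_bar \<sigma>P S (Suc k)) \<theta>
          = (transpose_mat (str_lower A) - str_lower A) *\<^sub>v ((- e) @\<^sub>v x1)
            + transpose_mat (minv J) *\<^sub>v ((transpose_mat B @\<^sub>r transpose_mat K) *\<^sub>v \<gamma>)
            + (M @\<^sub>v W)"
proof -
  let ?s = "m + (n + q)"
  have k': "Suc k \<in> {1..Suc N}" using k by auto
  have Ok': "Ok \<in> carrier_mat ?s ?s" using Ok(1) by (simp add: add.assoc)
  note D = pre_diff[OF k]
  note Dc = D[THEN mat_diff_onD(1), OF \<theta>] and Dp = D(1-4)[THEN mat_pd_carrier, OF \<theta>, of i]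
  have c2: "meas_bar \<sigma>R S k \<theta> \<in> carrier_vec m" "state_bar \<sigma>P S k \<theta> \<in> carrier_vec n"
    using meas_bar_carrier[OF k \<theta>] state_bar_carrier[OF _ \<theta>, of k] k by auto
  have vp: "colmat (vec_pd i (\<lambda>\<theta>'. - meas_bar \<sigma>R S k \<theta>') \<theta>) \<in> carrier_mat m 1"
    "colmat (vec_pd i (state_bar \<sigma>P S k) \<theta>) \<in> carrier_mat n 1"
    using c2 by (auto intro!: colmat_carrier simp: vec_pd_def)
  have cv: "colmat (- e) \<in> carrier_mat m 1" "colmat x1 \<in> carrier_mat n 1" "colmat \<gamma> \<in> carrier_mat q 1"
    "colmat M \<in> carrier_mat m 1" "colmat W \<in> carrier_mat n 1" "colmat T \<in> carrier_mat q 1"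
    using c d by (auto intro!: colmat_carrier)
  note z = zero_carrier_mat
  \<comment> \<open>The six separate block-column equations; columns 1 and 2, and likewise 4 and 5,
    are glued together again below to form \<open>M\<close> and its derivative.\<close>
  note cols = array_split6[OF Ok' Dc(1) z Dc(5) Dp(1) z vp(1) Dc(2,3,6) Dp(2,3) vp(2) z Dc(4) z z Dp(4) z
      c(1,2) cv(1) d(1,2) cv(4) z c(4) cv(2) d(4,5) cv(5) z z cv(3) d(7,8) cv(6) eq]
  have pre: "Ok * pre1 k \<theta> = E @\<^sub>r 0\<^sub>m n m @\<^sub>r 0\<^sub>m q m" "Ok * pre2 k \<theta> = Kt @\<^sub>r P1 @\<^sub>r 0\<^sub>m q n"
    "Ok * pre3 k \<theta> = colmat (- e) @\<^sub>r colmat x1 @\<^sub>r colmat \<gamma>"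
    unfolding pre1_def pre2_def pre3_def by (rule cols)+
  have pre': "Ok * mat_pd i (pre1 k) \<theta> = X @\<^sub>r L @\<^sub>r B" "Ok * mat_pd i (pre2 k) \<theta> = Y @\<^sub>r V @\<^sub>r K"
    "Ok * mat_pd i (pre3 k) \<theta> = colmat M @\<^sub>r colmat W @\<^sub>r colmat T"
    unfolding pre_array_diff(4-6)[OF k \<theta>] by (rule cols)+
  note vals = array_values[OF k \<theta> Ok' Ok(2) c E P1 pre]
  show "E = sqrtRe \<sigma>E S k \<theta>" "Kt = transpose_mat (gain_bar \<sigma>E S k \<theta>)" "e = innov_bar \<sigma>E S k \<theta>"
    "P1 = sqrtP \<sigma>P S (Suc k) \<theta>" "x1 = state_bar \<sigma>P S (Suc k) \<theta>" by (rule vals)+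
  have J: "J = post k \<theta>" unfolding J_def post_def vals ..
  have post3: "post3 k \<theta> = colmat (- e @\<^sub>v x1)" unfolding post3_def vals colmat_append ..
  note R = pre_array_diff(1-3)[OF k]
  note Rc = R[THEN mat_diff_onD(1), OF \<theta>] and Rp = R(1-3)[THEN mat_pd_carrier, OF \<theta>, of i]
  have A1: "four_block_mat X Y L V \<in> carrier_mat (m + n) (m + n)"
    by (rule four_block_carrier_mat[OF d(1,5)])
  have z2: "0\<^sub>m q m @\<^sub>c 0\<^sub>m q n = (0\<^sub>m q (m + n) :: real mat)"
    by (intro eq_matI) (auto simp: index_append_cols)
  have e1: "Ok * (pre1 k \<theta> @\<^sub>c pre2 k \<theta>) = post k \<theta> @\<^sub>r 0\<^sub>m q (m + n)"
    unfolding mult_append_cols[OF Ok' Rc(1,2)] pre append_cols_stack3[OF c(1,2) z c(4) z z] z2 J[symmetric] J_def ..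
  have e2: "Ok * mat_pd i (\<lambda>\<theta>. pre1 k \<theta> @\<^sub>c pre2 k \<theta>) \<theta> = four_block_mat X Y L V @\<^sub>r (B @\<^sub>c K)"
    unfolding mat_pd_append_cols[OF dom R(1,2) \<theta>] mult_append_cols[OF Ok' Rp(1,2)] pre'
      append_cols_stack3[OF d(1,2,4,5,7,8)] ..
  have e3: "Ok * pre3 k \<theta> = post3 k \<theta> @\<^sub>r colmat \<gamma>"
    unfolding pre post3 colmat_append by (rule append_rows_assoc[OF cv(1-3)])
  have e4: "Ok * mat_pd i (pre3 k) \<theta> = colmat (M @\<^sub>v W) @\<^sub>r colmat T"
    unfolding pre' colmat_append by (rule append_rows_assoc[OF cv(4-6)])
  have mu: "colmat (M @\<^sub>v W) \<in> carrier_mat (m + n) 1"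
    unfolding colmat_append by (rule carrier_append_rows[OF cv(4,5)])
  \<comment> \<open>The explicit block inverse in the definition of \<open>A\<close> is the inverse
    of the post-array block \<open>J\<close>.\<close>
  have A: "A = four_block_mat X Y L V * minv (post k \<theta>)"
    unfolding A_def post_def vals
    using minv_block_upper_triangular[OF sqrtRe_props(1,2)[OF k \<theta>] sqrtP_props(1,2)[OF k' \<theta>] c(2)[unfolded vals]] by simp
  note deriv = array_derivative[OF dom mat_diff_on_append_cols[OF dom R(1,2)] R(3) post_diff(1,2)[OF k]
      post_props(1)[OF k] post_props(3,4)[OF k] \<theta> post_props(2)[OF k \<theta>] Ok' Ok(2) A1 append_cols_carrier[OF d(7,8)]
      mu cv(3,6) e1 e2 e3 e4, folded A]
  show "four_block_mat (mat_pd i (sqrtRe \<sigma>E S k) \<theta>)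
            (mat_pd i (\<lambda>\<theta>'. transpose_mat (gain_bar \<sigma>E S k \<theta>')) \<theta>)
            (0\<^sub>m n m) (mat_pd i (sqrtP \<sigma>P S (Suc k)) \<theta>)
          = (transpose_mat (str_lower A) + diag_part A + str_upper A) * J"
    using deriv(1) unfolding post_diff(3)[OF k \<theta>] J .
  have Jc: "post k \<theta> \<in> carrier_mat (m + n) (m + n)" by (rule mat_diff_onD(1)[OF post_diff(1)[OF k] \<theta>])
  have vJ: "minv J \<in> carrier_mat (m + n) (m + n)" unfolding J by (rule minv_carrier[OF Jc post_props(2)[OF k \<theta>]])
  have Ac: "A \<in> carrier_mat (m + n) (m + n)" unfolding A using A1 vJ J by auto
  then have Sc: "transpose_mat (str_lower A) - str_lower A \<in> carrier_mat (m + n) (m + n)" by (auto simp: str_lower_def)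
  have BK: "transpose_mat B @\<^sub>r transpose_mat K \<in> carrier_mat (m + n) q"
    using d by (intro carrier_append_rows) auto
  \<comment> \<open>The derivative formula for \<open>c\<close> is about matrices, so the vector
    claim is compared in one-column form.\<close>
  have "colmat ((transpose_mat (str_lower A) - str_lower A) *\<^sub>v ((- e) @\<^sub>v x1)
            + transpose_mat (minv J) *\<^sub>v ((transpose_mat B @\<^sub>r transpose_mat K) *\<^sub>v \<gamma>) + (M @\<^sub>v W))
      = (transpose_mat (str_lower A) - str_lower A) * colmat ((- e) @\<^sub>v x1)
            + transpose_mat (minv J) * ((transpose_mat B @\<^sub>r transpose_mat K) * colmat \<gamma>) + colmat (M @\<^sub>v W)"
    using carrier_matD[OF Sc] carrier_matD[OF vJ] carrier_matD[OF BK] c(3,5,6) d(3,6)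
    by (subst colmat_add, simp, subst colmat_add, simp)
      (simp add: colmat_mult_vec del: index_minus_mat)
  also have "\<dots> = mat_pd i (post3 k) \<theta>"
    using deriv(2) unfolding transpose_append_cols[OF d(7,8)] post3 J ..
  finally show "(- vec_pd i (innov_bar \<sigma>E S k) \<theta>) @\<^sub>v vec_pd i (state_bar \<sigma>P S (Suc k)) \<theta>
          = (transpose_mat (str_lower A) - str_lower A) *\<^sub>v ((- e) @\<^sub>v x1)
            + transpose_mat (minv J) *\<^sub>v ((transpose_mat B @\<^sub>r transpose_mat K) *\<^sub>v \<gamma>) + (M @\<^sub>v W)"
    unfolding post_diff(4)[OF k \<theta>] colmat_inject by simp
qed

section \<open>The likelihood and its gradient in terms of square roots\<close>

lemma det_innov_cov: "k \<in> {1..N} \<Longrightarrow> \<theta> \<in> \<Omega> \<Longrightarrow>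
    Determinant.det (innov_cov S k \<theta>) = Determinant.det (sqrtRe \<sigma>E S k \<theta>) * Determinant.det (sqrtRe \<sigma>E S k \<theta>)"
  using det_mult[of "(sqrtRe \<sigma>E S k \<theta>)\<^sup>T" m "sqrtRe \<sigma>E S k \<theta>"] sqrtRe_props(1,3)[of k \<theta>]
    det_transpose[of "sqrtRe \<sigma>E S k \<theta>" m] by simp

text \<open>With V the inverse root, e^T (V V^T) e is the squared length of V^T e, the normalized
  innovation.\<close>

lemma innov_quadratic_form:
  assumes k: "k \<in> {1..N}" and \<theta>: "\<theta> \<in> \<Omega>"
  shows "innov S k \<theta> \<bullet> (minv (innov_cov S k \<theta>) *\<^sub>v innov S k \<theta>) = innov_bar \<sigma>E S k \<theta> \<bullet> innov_bar \<sigma>E S k \<theta>"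
proof -
  let ?V = "minv (sqrtRe \<sigma>E S k \<theta>)" and ?i = "innov S k \<theta>"
  note E = sqrtRe_props[OF k \<theta>] and i = innov_carrier[OF k \<theta>]
  note V = minv_carrier[OF E(1,2)]
  have "minv (innov_cov S k \<theta>) = ?V * ?V\<^sup>T" using minv_gram[OF E(1,2)] E(3) by simp
  then have "minv (innov_cov S k \<theta>) *\<^sub>v ?i = ?V *\<^sub>v (?V\<^sup>T *\<^sub>v ?i)"
    using V i by (simp add: assoc_mult_mat_vec[of _ m m _ m])
  moreover have "(?V\<^sup>T *\<^sub>v ?i) \<bullet> (?V\<^sup>T *\<^sub>v ?i) = ?i \<bullet> (?V *\<^sub>v (?V\<^sup>T *\<^sub>v ?i))"
    by (rule transpose_vec_mult_scalar[OF V _ i]) (use V i in \<open>metis mult_mat_vec_carrier transpose_carrier_mat\<close>)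
  ultimately show ?thesis by (simp add: innov_bar_def)
qed

lemma neg_loglik_sqrt:
  assumes "\<theta> \<in> \<Omega>"
  shows "neg_loglik S m N \<theta> = 1/2 * (\<Sum>k=1..N. real m * ln (2 * pi) + 2 * ln (Determinant.det (sqrtRe \<sigma>E S k \<theta>)) +
         innov_bar \<sigma>E S k \<theta> \<bullet> innov_bar \<sigma>E S k \<theta>)"
  unfolding neg_loglik_def
  using sqrtRe_props(2)[OF _ assms] det_innov_cov[OF _ assms] innov_quadratic_form[OF _ assms]
  by (intro arg_cong2[of _ _ _ _ "(*)"] refl sum.cong) (auto simp: ln_mult)

lemma sqrtRe_diag_nonzero:
  assumes "k \<in> {1..N}" "\<theta> \<in> \<Omega>" "j < m"
  shows "sqrtRe \<sigma>E S k \<theta> $$ (j, j) \<noteq> 0"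
  using sqrtRe_props[OF assms(1,2)] assms(3)
  by (auto simp: det_upper_triangular_prod[of "sqrtRe \<sigma>E S k \<theta>" m])

text \<open>The determinant of a triangular root is the product of its diagonal, so its logarithm is
  a sum over scalar entries. Differentiation then needs only the chain rule and no formula for the
  derivative of a determinant.\<close>

lemma neg_loglik_entries:
  assumes \<theta>: "\<theta> \<in> \<Omega>"
  shows "neg_loglik S m N \<theta> = 1/2 * (\<Sum>k\<in>{1..N}. real m * ln (2 * pi)
    + 2 * (\<Sum>j<m. ln (sqrtRe \<sigma>E S k \<theta> $$ (j, j)))
    + (\<Sum>j<m. colmat (innov_bar \<sigma>E S k \<theta>) $$ (j, 0) * colmat (innov_bar \<sigma>E S k \<theta>) $$ (j, 0)))"
  unfolding neg_loglik_sqrt[OF \<theta>]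
proof (intro arg_cong2[of _ _ _ _ "(*)"] refl sum.cong arg_cong2[of _ _ _ _ "(+)"])
  fix k assume k: "k \<in> {1..N}"
  note E = sqrtRe_props[OF k \<theta>]
  show "ln (Determinant.det (sqrtRe \<sigma>E S k \<theta>)) = (\<Sum>j<m. ln (sqrtRe \<sigma>E S k \<theta> $$ (j, j)))"
    unfolding det_upper_triangular_prod[OF E(1,4)]
    by (rule ln_prod) (simp_all add: sqrtRe_diag_nonzero[OF k \<theta>])
  show "innov_bar \<sigma>E S k \<theta> \<bullet> innov_bar \<sigma>E S k \<theta>
      = (\<Sum>j<m. colmat (innov_bar \<sigma>E S k \<theta>) $$ (j, 0) * colmat (innov_bar \<sigma>E S k \<theta>) $$ (j, 0))"
    using innov_bar_carrier[OF k \<theta>] by (auto simp: scalar_prod_def lessThan_atLeast0 intro!: sum.cong)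
qed

lemma neg_loglik_differentiable:
  assumes \<theta>: "\<theta> \<in> \<Omega>"
  shows "neg_loglik S m N differentiable (at \<theta>)"
proof (rule differentiable_cong_open[OF _ dom \<theta> neg_loglik_entries[symmetric]])
  have e: "(\<lambda>\<theta>. colmat (innov_bar \<sigma>E S k \<theta>) $$ (j, 0)) differentiable (at \<theta>)" if "k \<in> {1..N}" "j < m" for k j
    using mat_diff_onD(3)[OF innov_bar_diff[OF that(1)] \<theta> that(2)] by simp
  have E: "(\<lambda>\<theta>. ln (sqrtRe \<sigma>E S k \<theta> $$ (j, j))) differentiable (at \<theta>)" if "k \<in> {1..N}" "j < m" for k j
  proof (rule differentiable_compose[of ln])
    show "ln differentiable (at (sqrtRe \<sigma>E S k \<theta> $$ (j, j)))"
      using DERIV_ln_nonzero[OF sqrtRe_diag_nonzero[OF that(1) \<theta> that(2)]] real_differentiable_def by blast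
  qed (rule mat_diff_onD(3)[OF sqrtRe_diff[OF that(1)] \<theta> that(2,2)])
  show "(\<lambda>\<theta>. 1/2 * (\<Sum>k\<in>{1..N}. real m * ln (2 * pi)
    + 2 * (\<Sum>j<m. ln (sqrtRe \<sigma>E S k \<theta> $$ (j, j)))
    + (\<Sum>j<m. colmat (innov_bar \<sigma>E S k \<theta>) $$ (j, 0) * colmat (innov_bar \<sigma>E S k \<theta>) $$ (j, 0)))) differentiable (at \<theta>)"
    by (rule differentiable_mult differentiable_sum differentiable_add differentiable_const ballI
        finite_atLeastAtMost finite_lessThan e E | (simp only: lessThan_iff))+
qed

lemma neg_loglik_gradient:
  assumes \<theta>: "\<theta> \<in> \<Omega>"
  shows "partial_deriv i (neg_loglik S m N) \<theta> =
       (\<Sum>k=1..N. mtrace (minv (sqrtRe \<sigma>E S k \<theta>) * mat_pd i (sqrtRe \<sigma>E S k) \<theta>) +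
         innov_bar \<sigma>E S k \<theta> \<bullet> vec_pd i (innov_bar \<sigma>E S k) \<theta>)"
proof (rule partial_deriv_eqI[OF dom \<theta> neg_loglik_entries])
  let ?l = "\<lambda>t. \<theta> + t *\<^sub>R axis i 1" and ?E = "sqrtRe \<sigma>E S" and ?e = "\<lambda>k \<theta>. colmat (innov_bar \<sigma>E S k \<theta>)"
  \<comment> \<open>Both factors are upper triangular, so only their diagonals enter the trace,
    which becomes the sum of logarithmic derivatives of the diagonal entries of the root.\<close>
  have tr: "mtrace (minv (?E k \<theta>) * mat_pd i (?E k) \<theta>) = (\<Sum>j<m. 1 / ?E k \<theta> $$ (j, j) * mat_pd i (?E k) \<theta> $$ (j, j))"
    if k: "k \<in> {1..N}" for k
  proof -
    note E = sqrtRe_props[OF k \<theta>]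
    note V = minv_carrier[OF E(1,2)] upper_triangular_minv[OF E(1,4,2)]
    note E' = mat_pd_carrier[OF sqrtRe_diff[OF k] \<theta>, of i]
      upper_triangular_mat_pd[OF dom sqrtRe_diff[OF k] \<theta> sqrtRe_props(4)[OF k], of i]
    have "mtrace (minv (?E k \<theta>) * mat_pd i (?E k) \<theta>) = (\<Sum>j<m. (minv (?E k \<theta>) * mat_pd i (?E k) \<theta>) $$ (j, j))"
      using V(1) by (simp add: mtrace_def)
    also have "\<dots> = (\<Sum>j<m. 1 / ?E k \<theta> $$ (j, j) * mat_pd i (?E k) \<theta> $$ (j, j))"
      by (intro sum.cong refl) (simp add: diag_mult_upper_triangular[OF V(1) E'(1) V(2) E'(2)]
        diag_minv_upper_triangular[OF E(1,4,2)] del: index_mult_mat)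
    finally show ?thesis .
  qed
  have sp: "innov_bar \<sigma>E S k \<theta> \<bullet> vec_pd i (innov_bar \<sigma>E S k) \<theta> = (\<Sum>j<m. ?e k \<theta> $$ (j, 0) * mat_pd i (?e k) \<theta> $$ (j, 0))"
    if k: "k \<in> {1..N}" for k
  proof -
    have "colmat (vec_pd i (innov_bar \<sigma>E S k) \<theta>) = mat_pd i (?e k) \<theta>"
      by (rule colmat_vec_pd[OF dom \<theta> _ innov_bar_diff[OF k]]) (rule innov_bar_carrier[OF k])
    from this[symmetric] show ?thesis
      using innov_bar_carrier[OF k \<theta>] by (auto simp: scalar_prod_def lessThan_atLeast0 intro!: sum.cong)
  qed
  have dE: "((\<lambda>t. ln (?E k (?l t) $$ (j, j))) has_real_derivative 1 / ?E k \<theta> $$ (j, j) * mat_pd i (?E k) \<theta> $$ (j, j)) (at 0)"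
    if "k \<in> {1..N}" "j < m" for k j
    using DERIV_chain2[of ln "1 / ?E k \<theta> $$ (j, j)" "\<lambda>t. ?E k (?l t) $$ (j, j)" 0, OF _ has_mat_pd[OF sqrtRe_diff[OF that(1)] \<theta> that(2,2)]]
      DERIV_ln_nonzero[OF sqrtRe_diag_nonzero[OF that(1) \<theta> that(2)]] by simp
  have de: "((\<lambda>t. ?e k (?l t) $$ (j, 0) * ?e k (?l t) $$ (j, 0)) has_real_derivative
      2 * (?e k \<theta> $$ (j, 0) * mat_pd i (?e k) \<theta> $$ (j, 0))) (at 0)" if "k \<in> {1..N}" "j < m" for k j
    using has_mat_pd[OF innov_bar_diff[OF that(1)] \<theta> that(2), of 0 i]
    by (auto intro!: derivative_eq_intros)
  have "((\<lambda>t. 1/2 * (\<Sum>k\<in>{1..N}. real m * ln (2 * pi) + 2 * (\<Sum>j<m. ln (?E k (?l t) $$ (j, j)))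
      + (\<Sum>j<m. ?e k (?l t) $$ (j, 0) * ?e k (?l t) $$ (j, 0)))) has_real_derivative
    1/2 * (\<Sum>k\<in>{1..N}. 0 + 2 * (\<Sum>j<m. 1 / ?E k \<theta> $$ (j, j) * mat_pd i (?E k) \<theta> $$ (j, j))
      + (\<Sum>j<m. 2 * (?e k \<theta> $$ (j, 0) * mat_pd i (?e k) \<theta> $$ (j, 0))))) (at 0)"
    by (intro DERIV_cmult DERIV_sum DERIV_add DERIV_const dE de) auto
  also have "1/2 * (\<Sum>k\<in>{1..N}. 0 + 2 * (\<Sum>j<m. 1 / ?E k \<theta> $$ (j, j) * mat_pd i (?E k) \<theta> $$ (j, j))
      + (\<Sum>j<m. 2 * (?e k \<theta> $$ (j, 0) * mat_pd i (?e k) \<theta> $$ (j, 0))))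
    = (\<Sum>k=1..N. mtrace (minv (?E k \<theta>) * mat_pd i (?E k) \<theta>) + innov_bar \<sigma>E S k \<theta> \<bullet> vec_pd i (innov_bar \<sigma>E S k) \<theta>)"
    unfolding sum_distrib_left[of "1/2"]
  proof (intro sum.cong refl)
    fix k assume k: "k \<in> {1..N}"
    \<comment> \<open>The factor 1/2 of the likelihood absorbs the 2 in front of the logarithm and
      the 2 from differentiating squares.\<close>
    have half: "1/2 * (0 + 2 * a + 2 * b) = a + b" for a b :: real by simp
    show "1/2 * (0 + 2 * (\<Sum>j<m. 1 / ?E k \<theta> $$ (j, j) * mat_pd i (?E k) \<theta> $$ (j, j))
        + (\<Sum>j<m. 2 * (?e k \<theta> $$ (j, 0) * mat_pd i (?e k) \<theta> $$ (j, 0))))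
      = mtrace (minv (?E k \<theta>) * mat_pd i (?E k) \<theta>) + innov_bar \<sigma>E S k \<theta> \<bullet> vec_pd i (innov_bar \<sigma>E S k) \<theta>"
      unfolding tr[OF k] sp[OF k] sum_distrib_left[of 2, symmetric] half ..
  qed
  finally show "((\<lambda>t. 1/2 * (\<Sum>k\<in>{1..N}. real m * ln (2 * pi) + 2 * (\<Sum>j<m. ln (?E k (?l t) $$ (j, j)))
      + (\<Sum>j<m. ?e k (?l t) $$ (j, 0) * ?e k (?l t) $$ (j, 0)))) has_real_derivative
    (\<Sum>k=1..N. mtrace (minv (?E k \<theta>) * mat_pd i (?E k) \<theta>) + innov_bar \<sigma>E S k \<theta> \<bullet> vec_pd i (innov_bar \<sigma>E S k) \<theta>)) (at 0)" .
qed

lemma all_diff: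
  shows "k \<in> {1..N} \<Longrightarrow> \<theta> \<in> \<Omega> \<Longrightarrow> mat_diff (sqrtR \<sigma>R S k) \<theta> \<and> vec_diff (meas_bar \<sigma>R S k) \<theta> \<and>
       mat_diff (\<lambda>\<theta>'. Qh k \<theta>' * transpose_mat (sG S k \<theta>')) \<theta> \<and>
       mat_diff (sqrtRe \<sigma>E S k) \<theta> \<and> mat_diff (gain_bar \<sigma>E S k) \<theta> \<and> vec_diff (innov_bar \<sigma>E S k) \<theta>"
    and "k \<in> {1..Suc N} \<Longrightarrow> \<theta> \<in> \<Omega> \<Longrightarrow> mat_diff (sqrtP \<sigma>P S k) \<theta> \<and> vec_diff (state_bar \<sigma>P S k) \<theta>"
proof -
  show "mat_diff (sqrtR \<sigma>R S k) \<theta> \<and> vec_diff (meas_bar \<sigma>R S k) \<theta> \<and>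
       mat_diff (\<lambda>\<theta>'. Qh k \<theta>' * transpose_mat (sG S k \<theta>')) \<theta> \<and>
       mat_diff (sqrtRe \<sigma>E S k) \<theta> \<and> mat_diff (gain_bar \<sigma>E S k) \<theta> \<and> vec_diff (innov_bar \<sigma>E S k) \<theta>"
    if k: "k \<in> {1..N}" and \<theta>: "\<theta> \<in> \<Omega>"
  proof (intro conjI)
    show "vec_diff (meas_bar \<sigma>R S k) \<theta>"
      using vec_diff_iff_colmat[of \<Omega> \<theta> "meas_bar \<sigma>R S k" m] mat_diff_onD(2)[OF meas_bar_diff[OF k] \<theta>]
        meas_bar_carrier[OF k] dom \<theta> by simp
    show "vec_diff (innov_bar \<sigma>E S k) \<theta>"
      using vec_diff_iff_colmat[of \<Omega> \<theta> "innov_bar \<sigma>E S k" m] mat_diff_onD(2)[OF innov_bar_diff[OF k] \<theta>]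
        innov_bar_carrier[OF k] dom \<theta> by simp
  qed (rule mat_diff_onD(2)[OF sqrtR_diff[OF k] \<theta>] mat_diff_onD(2)[OF Qh_diff[OF k] \<theta>]
      mat_diff_onD(2)[OF sqrtRe_diff[OF k] \<theta>] mat_diff_onD(2)[OF gain_bar_diff[OF k] \<theta>])+
  show "mat_diff (sqrtP \<sigma>P S k) \<theta> \<and> vec_diff (state_bar \<sigma>P S k) \<theta>" if k: "k \<in> {1..Suc N}" and \<theta>: "\<theta> \<in> \<Omega>"
    using vec_diff_iff_colmat[of \<Omega> \<theta> "state_bar \<sigma>P S k" n] mat_diff_onD(2)[OF state_bar_diff[OF k] \<theta>]
      mat_diff_onD(2)[OF sqrtP_diff[OF k] \<theta>] state_bar_carrier[OF k] dom \<theta> by simp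
qed

end

theorem theorem1:
  fixes S :: "(real ^ 'p::finite) system" and \<Omega> :: "(real ^ 'p) set"
    and n m q N :: nat
    and Qh :: "nat \<Rightarrow> real ^ 'p \<Rightarrow> real mat"
    and \<sigma>R \<sigma>Q \<sigma>P \<sigma>E :: "nat \<Rightarrow> nat \<Rightarrow> real"
  assumes dom: "open \<Omega>"
    and dims: "\<And>k \<theta>. k \<in> {1..N} \<Longrightarrow> \<theta> \<in> \<Omega> \<Longrightarrow>
        sF S k \<theta> \<in> carrier_mat n n \<and> sG S k \<theta> \<in> carrier_mat n q \<and> sH S k \<theta> \<in> carrier_mat m n \<and>
        sQ S k \<theta> \<in> carrier_mat q q \<and> sR S k \<theta> \<in> carrier_mat m m"
    and dims0: "\<And>\<theta>. \<theta> \<in> \<Omega> \<Longrightarrow> sPi0 S \<theta> \<in> carrier_mat n n \<and> sx0 S \<theta> \<in> carrier_vec n"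
    and dimz: "\<And>k. k \<in> {1..N} \<Longrightarrow> sz S k \<in> carrier_vec m"
    and diff: "\<And>k \<theta>. k \<in> {1..N} \<Longrightarrow> \<theta> \<in> \<Omega> \<Longrightarrow>
        mat_diff (sF S k) \<theta> \<and> mat_diff (sG S k) \<theta> \<and> mat_diff (sH S k) \<theta> \<and>
        mat_diff (sQ S k) \<theta> \<and> mat_diff (sR S k) \<theta>"
    and diff0: "\<And>\<theta>. \<theta> \<in> \<Omega> \<Longrightarrow> mat_diff (sPi0 S) \<theta> \<and> vec_diff (sx0 S) \<theta>"
    and signs: "\<And>k j. {\<sigma>R k j, \<sigma>Q k j, \<sigma>P k j, \<sigma>E k j} \<subseteq> {1, -1}"
    and R_pos: "\<And>k \<theta>. k \<in> {1..N} \<Longrightarrow> \<theta> \<in> \<Omega> \<Longrightarrow> pos_def (sR S k \<theta>)"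
    \<comment> \<open>needed for \<open>P\<^sub>k\<^sup>-\<^sup>T\<^sup>/\<^sup>2\<close> to exist; \<open>k = 1\<close> is \<open>\<Pi>\<^sub>0 > 0\<close>\<close>
    and P_pos: "\<And>k \<theta>. k \<in> {1..Suc N} \<Longrightarrow> \<theta> \<in> \<Omega> \<Longrightarrow> pos_def (kf_P S k \<theta>)"
    \<comment> \<open>\<open>Q\<^sub>k\<close> may be singular; there the derivative of \<open>Q\<^sub>k\<^sup>1\<^sup>/\<^sup>2 G\<^sub>k\<^sup>T\<close> is required to exist\<close>
    and Q_root: "\<And>k \<theta>. k \<in> {1..N} \<Longrightarrow> \<theta> \<in> \<Omega> \<Longrightarrow> chol_factor (\<sigma>Q k) (sQ S k \<theta>) (Qh k \<theta>)"
    and Q_diff: "\<And>k \<theta>. k \<in> {1..N} \<Longrightarrow> \<theta> \<in> \<Omega> \<Longrightarrow> \<not> pos_def (sQ S k \<theta>) \<Longrightarrow>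
        mat_diff (\<lambda>\<theta>'. Qh k \<theta>' * transpose_mat (sG S k \<theta>')) \<theta>"
  shows "
    \<comment> \<open>all derivatives occurring below exist\<close>
    (\<forall>\<theta>\<in>\<Omega>. \<forall>k\<in>{1..N}.
       mat_diff (sqrtR \<sigma>R S k) \<theta> \<and> vec_diff (meas_bar \<sigma>R S k) \<theta> \<and>
       mat_diff (\<lambda>\<theta>'. Qh k \<theta>' * transpose_mat (sG S k \<theta>')) \<theta> \<and>
       mat_diff (sqrtRe \<sigma>E S k) \<theta> \<and> mat_diff (gain_bar \<sigma>E S k) \<theta> \<and> vec_diff (innov_bar \<sigma>E S k) \<theta>) \<and>
    (\<forall>\<theta>\<in>\<Omega>. \<forall>k\<in>{1..Suc N}. mat_diff (sqrtP \<sigma>P S k) \<theta> \<and> vec_diff (state_bar \<sigma>P S k) \<theta>) \<and>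
    (\<forall>\<theta>\<in>\<Omega>. neg_loglik S m N differentiable (at \<theta>)) \<and>
    \<comment> \<open>I and II. Every orthogonal \<open>Ok\<close> that makes the first two block columns upper triangular
      is covered: its signs on the diagonal define \<open>\<sigma>E k\<close> and \<open>\<sigma>P (Suc k)\<close>.\<close>
    (\<forall>\<theta>\<in>\<Omega>. \<forall>k\<in>{1..N}. \<forall>i Ok E Kt e P1 x1 X Y M L V W B K T \<gamma>.
       Ok \<in> carrier_mat (m + n + q) (m + n + q) \<and> orth_mat Ok \<and>
       E \<in> carrier_mat m m \<and> Kt \<in> carrier_mat m n \<and> e \<in> carrier_vec m \<and>
       P1 \<in> carrier_mat n n \<and> x1 \<in> carrier_vec n \<and> \<gamma> \<in> carrier_vec q \<and>
       X \<in> carrier_mat m m \<and> Y \<in> carrier_mat m n \<and> M \<in> carrier_vec m \<and>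
       L \<in> carrier_mat n m \<and> V \<in> carrier_mat n n \<and> W \<in> carrier_vec n \<and>
       B \<in> carrier_mat q m \<and> K \<in> carrier_mat q n \<and> T \<in> carrier_vec q \<and>
       upper_triangular E \<and> (\<forall>j<m. 0 \<le> \<sigma>E k j * E $$ (j, j)) \<and>
       upper_triangular P1 \<and> (\<forall>j<n. 0 \<le> \<sigma>P (Suc k) j * P1 $$ (j, j)) \<and>
       Ok *
       ((sqrtR \<sigma>R S k \<theta> @\<^sub>c 0\<^sub>m m n @\<^sub>c colmat (- meas_bar \<sigma>R S k \<theta>) @\<^sub>c
           mat_pd i (sqrtR \<sigma>R S k) \<theta> @\<^sub>c 0\<^sub>m m n @\<^sub>c colmat (vec_pd i (\<lambda>\<theta>'. - meas_bar \<sigma>R S k \<theta>') \<theta>))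
        @\<^sub>r
        (sqrtP \<sigma>P S k \<theta> * transpose_mat (sH S k \<theta>) @\<^sub>c sqrtP \<sigma>P S k \<theta> * transpose_mat (sF S k \<theta>) @\<^sub>c
           colmat (state_bar \<sigma>P S k \<theta>) @\<^sub>c
           mat_pd i (\<lambda>\<theta>'. sqrtP \<sigma>P S k \<theta>' * transpose_mat (sH S k \<theta>')) \<theta> @\<^sub>c
           mat_pd i (\<lambda>\<theta>'. sqrtP \<sigma>P S k \<theta>' * transpose_mat (sF S k \<theta>')) \<theta> @\<^sub>c
           colmat (vec_pd i (state_bar \<sigma>P S k) \<theta>))
        @\<^sub>r
        (0\<^sub>m q m @\<^sub>c Qh k \<theta> * transpose_mat (sG S k \<theta>) @\<^sub>c 0\<^sub>m q 1 @\<^sub>c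
           0\<^sub>m q m @\<^sub>c mat_pd i (\<lambda>\<theta>'. Qh k \<theta>' * transpose_mat (sG S k \<theta>')) \<theta> @\<^sub>c 0\<^sub>m q 1))
       =
       ((E @\<^sub>c Kt @\<^sub>c colmat (- e) @\<^sub>c X @\<^sub>c Y @\<^sub>c colmat M)
        @\<^sub>r
        (0\<^sub>m n m @\<^sub>c P1 @\<^sub>c colmat x1 @\<^sub>c L @\<^sub>c V @\<^sub>c colmat W)
        @\<^sub>r
        (0\<^sub>m q m @\<^sub>c 0\<^sub>m q n @\<^sub>c colmat \<gamma> @\<^sub>c B @\<^sub>c K @\<^sub>c colmat T))
       \<longrightarrow>
       E = sqrtRe \<sigma>E S k \<theta> \<and> Kt = transpose_mat (gain_bar \<sigma>E S k \<theta>) \<and> e = innov_bar \<sigma>E S k \<theta> \<and>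
       P1 = sqrtP \<sigma>P S (Suc k) \<theta> \<and> x1 = state_bar \<sigma>P S (Suc k) \<theta> \<and>
       (let A = four_block_mat X Y L V *
                four_block_mat (minv E) (- (minv E * Kt * minv P1)) (0\<^sub>m n m) (minv P1);
            Lb = str_lower A; D = diag_part A; Ub = str_upper A;
            J = four_block_mat E Kt (0\<^sub>m n m) P1
        in
          four_block_mat (mat_pd i (sqrtRe \<sigma>E S k) \<theta>)
            (mat_pd i (\<lambda>\<theta>'. transpose_mat (gain_bar \<sigma>E S k \<theta>')) \<theta>)
            (0\<^sub>m n m) (mat_pd i (sqrtP \<sigma>P S (Suc k)) \<theta>)
          = (transpose_mat Lb + D + Ub) * J \<and>
          (- vec_pd i (innov_bar \<sigma>E S k) \<theta>) @\<^sub>v vec_pd i (state_bar \<sigma>P S (Suc k)) \<theta>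
          = (transpose_mat Lb - Lb) *\<^sub>v ((- e) @\<^sub>v x1)
            + transpose_mat (minv J) *\<^sub>v ((transpose_mat B @\<^sub>r transpose_mat K) *\<^sub>v \<gamma>)
            + (M @\<^sub>v W))) \<and>
    \<comment> \<open>III. The library's \<open>ln\<close> satisfies \<open>ln (- x) = ln x\<close>, which makes the first formula
      independent of the sign convention \<open>\<sigma>E\<close>.\<close>
    (\<forall>\<theta>\<in>\<Omega>. neg_loglik S m N \<theta> =
       1/2 * (\<Sum>k=1..N. real m * ln (2 * pi) + 2 * ln (Determinant.det (sqrtRe \<sigma>E S k \<theta>)) +
         innov_bar \<sigma>E S k \<theta> \<bullet> innov_bar \<sigma>E S k \<theta>)) \<and>
    (\<forall>\<theta>\<in>\<Omega>. \<forall>i. partial_deriv i (neg_loglik S m N) \<theta> =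
       (\<Sum>k=1..N. mtrace (minv (sqrtRe \<sigma>E S k \<theta>) * mat_pd i (sqrtRe \<sigma>E S k) \<theta>) +
         innov_bar \<sigma>E S k \<theta> \<bullet> vec_pd i (innov_bar \<sigma>E S k) \<theta>))"
proof -
  interpret kalman_system S \<Omega> n m q N Qh \<sigma>R \<sigma>Q \<sigma>P \<sigma>E
    by unfold_locales (rule assms; assumption)+
  show ?thesis
    unfolding Let_def
  proof (intro conjI)
    show "\<forall>\<theta>\<in>\<Omega>. \<forall>k\<in>{1..N}.
       mat_diff (sqrtR \<sigma>R S k) \<theta> \<and> vec_diff (meas_bar \<sigma>R S k) \<theta> \<and>
       mat_diff (\<lambda>\<theta>'. Qh k \<theta>' * transpose_mat (sG S k \<theta>')) \<theta> \<and>
       mat_diff (sqrtRe \<sigma>E S k) \<theta> \<and> mat_diff (gain_bar \<sigma>E S k) \<theta> \<and> vec_diff (innov_bar \<sigma>E S k) \<theta>"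
      using all_diff(1) by blast
    show "\<forall>\<theta>\<in>\<Omega>. \<forall>k\<in>{1..Suc N}. mat_diff (sqrtP \<sigma>P S k) \<theta> \<and> vec_diff (state_bar \<sigma>P S k) \<theta>"
      using all_diff(2) by blast
    show "\<forall>\<theta>\<in>\<Omega>. neg_loglik S m N differentiable (at \<theta>)"
      using neg_loglik_differentiable by blast
    show "\<forall>\<theta>\<in>\<Omega>. neg_loglik S m N \<theta> =
       1/2 * (\<Sum>k=1..N. real m * ln (2 * pi) + 2 * ln (Determinant.det (sqrtRe \<sigma>E S k \<theta>)) +
         innov_bar \<sigma>E S k \<theta> \<bullet> innov_bar \<sigma>E S k \<theta>)"
      using neg_loglik_sqrt by blast
    show "\<forall>\<theta>\<in>\<Omega>. \<forall>i. partial_deriv i (neg_loglik S m N) \<theta> =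
       (\<Sum>k=1..N. mtrace (minv (sqrtRe \<sigma>E S k \<theta>) * mat_pd i (sqrtRe \<sigma>E S k) \<theta>) +
         innov_bar \<sigma>E S k \<theta> \<bullet> vec_pd i (innov_bar \<sigma>E S k) \<theta>)"
      using neg_loglik_gradient by blast
  qed (intro ballI allI impI, elim conjE, intro conjI, (rule array_step; assumption)+)
qed

end
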